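(* Let $N \in \{1, 2, 3, 4, 5, 6, 7, 8, 9, 10, 12, 13, 18, 25\}$ and let $j^{(N)}$ be the Hauptmodul of level $N$ described in the context. Define polynomials $P_\nu^{(N)}(x)$, $\nu\ge 0$, by the formal identity \[\frac{j^{(N)\prime}(z)}{x - j^{(N)}(z)} = \sum_{\nu=0}^{\infty} P_{\nu}^{(N)}(x)\, q^{\nu}, \qquad q=e^{2\pi i z},\ j^{(N)\prime}=q\frac{d j^{(N)}}{dq}.\] Then for every positive integer $\nu$, \[P_{\nu}^{(N)}\big(j^{(N)}(z)\big)=\sum_{d\mid (\nu,N)} \frac{\nu}{d}\, J^{(N/d)}(z)\, \big|\, T_{\nu/d}\,V_d,\] where for each $d$ the Hecke operator $T_{\nu/d}$ is the weight-$0$ Hecke operator on level $N/d$.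
   Context: For $M$ with $\Gamma_0(M)$ of genus zero, $J^{(M)}$ denotes the normalized Hauptmodul of level $M$: the unique modular function on $\Gamma_0(M)$, holomorphic on the upper half-plane and at all cusps other than $i\infty$, whose $q$-expansion at $i\infty$ is $q^{-1}+O(q)$ (constant term $0$). The Hauptmodul $j^{(N)}$ is $J^{(N)}$ plus a constant; concretely $j^{(1)}=j$ (the modular $j$-invariant) and, with $\eta(z)=q^{1/24}\prod_{n\ge1}(1-q^n)$: $j^{(2)}=\eta(z)^{24}/\eta(2z)^{24}$, $j^{(3)}=\eta(z)^{12}/\eta(3z)^{12}$, $j^{(4)}=\eta(z)^8/\eta(4z)^8$, $j^{(5)}=\eta(z)^6/\eta(5z)^6$, $j^{(6)}=\eta(2z)^3\eta(3z)^9/(\eta(z)^3\eta(6z)^9)$, $j^{(7)}=\eta(z)^4/\eta(7z)^4$, $j^{(8)}=\eta(z)^4\eta(4z)^2/(\eta(2z)^2\eta(8z)^4)$, $j^{(9)}=\eta(z)^3/\eta(9z)^3$, $j^{(10)}=\eta(2z)\eta(5z)^5/(\eta(z)\eta(10z)^5)$, $j^{(12)}=\eta(4z)^4\eta(6z)^2/(\eta(2z)^2\eta(12z)^4)$, $j^{(13)}=\eta(z)^2/\eta(13z)^2$, $j^{(25)}=\eta(z)/\eta(25z)$, and for $N=18$, $j^{(18)}$ is any Hauptmodul of $\Gamma_0(18)$ with expansion $q^{-1}+O(1)$. Operators on $q$-series $f=\sum a_nq^n$: $f|V_d=\sum a_n q^{dn}$; the weight-$0$ Hecke operator of index $m$ on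 level $M$ acts by $f|T_m=\sum_n\big(\sum_{e\mid (m,n),\,(e,M)=1} e^{-1} a_{mn/e^2}\big)q^n$ (so for primes $p\mid M$, $T_p=U_p$ with $f|U_p=\sum a_{pn}q^n$). *)

theory Defs
  imports "HOL-Complex_Analysis.Complex_Analysis"
begin

definition upper_half_plane :: "complex set" where
  "upper_half_plane = {z. Im z > 0}"

text \<open>The quadruple \<open>(a, b, c, d)\<close> stands for the matrix with rows \<open>(a, b)\<close> and \<open>(c, d)\<close>.\<close>

type_synonym mat2 = "int \<times> int \<times> int \<times> int"

definition SL2Z :: "mat2 set" where
  "SL2Z = {(a, b, c, d). a * d - b * c = 1}"

definition Gamma0 :: "nat \<Rightarrow> mat2 set" where
  "Gamma0 M = {(a, b, c, d). (a, b, c, d) \<in> SL2Z \<and> int M dvd c}"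

fun moebius_act :: "mat2 \<Rightarrow> complex \<Rightarrow> complex" where
  "moebius_act (a, b, c, d) z = (of_int a * z + of_int b) / (of_int c * z + of_int d)"

text \<open>
  Every cusp is \<open>\<gamma>\<infinity>\<close> for some \<open>\<gamma> = (a, b, c, d)\<close> in \<open>SL2Z\<close>, namely the point \<open>a/c\<close> of the
  rational projective line. The following says that \<open>\<gamma>\<infinity>\<close> lies in the \<open>Gamma0 M\<close>-orbit
  of \<open>\<infinity>\<close>; two points \<open>a/c\<close> and \<open>a'/c'\<close> are compared by cross multiplication, which
  covers \<open>c = 0\<close>.
\<close>

definition cusp_equiv_infinity :: "nat \<Rightarrow> mat2 \<Rightarrow> bool" where
  "cusp_equiv_infinity M \<gamma> \<longleftrightarrow>
     (case \<gamma> of (a, b, c, d) \<Rightarrow> \<exists>(a', b', c', d') \<in> Gamma0 M. a * c' = a' * c)"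

definition nome :: "nat \<Rightarrow> complex \<Rightarrow> complex" where
  "nome h z = exp (2 * of_real pi * \<i> * z / of_nat h)"

text \<open>\<open>f\<close> is given near \<open>i\<infinity>\<close> by the convergent Laurent series \<open>F\<close> in \<open>exp (2\<pi>iz/h)\<close>.\<close>

definition has_q_expansion :: "nat \<Rightarrow> (complex \<Rightarrow> complex) \<Rightarrow> complex fls \<Rightarrow> bool" where
  "has_q_expansion h f F \<longleftrightarrow>
     fls_conv_radius F > 0 \<and> (\<exists>y. \<forall>z. Im z > y \<longrightarrow> f z = eval_fls F (nome h z))"

definition q_expansion :: "(complex \<Rightarrow> complex) \<Rightarrow> complex fls" where
  "q_expansion f = (THE F. has_q_expansion 1 f F)"

definition modular_function :: "nat \<Rightarrow> (complex \<Rightarrow> complex) \<Rightarrow> bool" where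
  "modular_function M f \<longleftrightarrow>
     f meromorphic_on upper_half_plane \<and>
     (\<forall>\<gamma>\<in>Gamma0 M. \<forall>z\<in>upper_half_plane. f (moebius_act \<gamma> z) = f z) \<and>
     (\<forall>\<gamma>\<in>SL2Z. \<exists>h>0. \<exists>F. has_q_expansion h (\<lambda>z. f (moebius_act \<gamma> z)) F)"

definition holomorphic_at_cusp :: "mat2 \<Rightarrow> (complex \<Rightarrow> complex) \<Rightarrow> bool" where
  "holomorphic_at_cusp \<gamma> f \<longleftrightarrow>
     (\<exists>h>0. \<exists>F. has_q_expansion h (\<lambda>z. f (moebius_act \<gamma> z)) F \<and> fls_subdegree F \<ge> 0)"

text \<open>Expansion \<open>q\<inverse> + O(1)\<close> at \<open>i\<infinity>\<close>, and no other poles on the modular curve.\<close>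

definition hauptmodul :: "nat \<Rightarrow> (complex \<Rightarrow> complex) \<Rightarrow> bool" where
  "hauptmodul M f \<longleftrightarrow>
     modular_function M f \<and>
     f holomorphic_on upper_half_plane \<and>
     (\<forall>\<gamma>\<in>SL2Z. \<not> cusp_equiv_infinity M \<gamma> \<longrightarrow> holomorphic_at_cusp \<gamma> f) \<and>
     (\<exists>F. has_q_expansion 1 f F \<and> fls_subdegree F = -1 \<and> fls_nth F (-1) = 1)"

text \<open>Expansion \<open>q\<inverse> + O(q)\<close> at \<open>i\<infinity>\<close>.\<close>

definition normalized_hauptmodul :: "nat \<Rightarrow> (complex \<Rightarrow> complex) \<Rightarrow> bool" where
  "normalized_hauptmodul M f \<longleftrightarrow>
     hauptmodul M f \<and> (\<exists>F. has_q_expansion 1 f F \<and> fls_nth F 0 = 0)"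

definition dedekind_eta :: "complex \<Rightarrow> complex" where
  "dedekind_eta z = nome 24 z * (\<Prod>n. 1 - nome 1 z ^ Suc n)"

definition eisenstein_E4 :: "complex \<Rightarrow> complex" where
  "eisenstein_E4 z =
     1 + 240 * (\<Sum>n. of_nat (\<Sum>k | k dvd Suc n. k ^ 3) * nome 1 z ^ Suc n)"

text \<open>The modular \<open>j\<close>-invariant \<open>E\<^sub>4\<^sup>3/\<Delta>\<close>, where \<open>\<Delta> = \<eta>\<^sup>2\<^sup>4\<close>.\<close>

definition modular_j :: "complex \<Rightarrow> complex" where
  "modular_j z = eisenstein_E4 z ^ 3 / dedekind_eta z ^ 24"

text \<open>Only meaningful for the listed levels; level 18 has no prescribed formula.\<close>

definition explicit_hauptmodul :: "nat \<Rightarrow> complex \<Rightarrow> complex" where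
  "explicit_hauptmodul N z = (let \<eta> = (\<lambda>d. dedekind_eta (of_nat d * z)) in
     if N = 1 then modular_j z
     else if N = 2 then \<eta> 1 ^ 24 / \<eta> 2 ^ 24
     else if N = 3 then \<eta> 1 ^ 12 / \<eta> 3 ^ 12
     else if N = 4 then \<eta> 1 ^ 8 / \<eta> 4 ^ 8
     else if N = 5 then \<eta> 1 ^ 6 / \<eta> 5 ^ 6
     else if N = 6 then \<eta> 2 ^ 3 * \<eta> 3 ^ 9 / (\<eta> 1 ^ 3 * \<eta> 6 ^ 9)
     else if N = 7 then \<eta> 1 ^ 4 / \<eta> 7 ^ 4
     else if N = 8 then \<eta> 1 ^ 4 * \<eta> 4 ^ 2 / (\<eta> 2 ^ 2 * \<eta> 8 ^ 4)
     else if N = 9 then \<eta> 1 ^ 3 / \<eta> 9 ^ 3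
     else if N = 10 then \<eta> 2 * \<eta> 5 ^ 5 / (\<eta> 1 * \<eta> 10 ^ 5)
     else if N = 12 then \<eta> 4 ^ 4 * \<eta> 6 ^ 2 / (\<eta> 2 ^ 2 * \<eta> 12 ^ 4)
     else if N = 13 then \<eta> 1 ^ 2 / \<eta> 13 ^ 2
     else if N = 25 then \<eta> 1 / \<eta> 25
     else 0)"

definition is_level_j :: "nat \<Rightarrow> (complex \<Rightarrow> complex) \<Rightarrow> bool" where
  "is_level_j N j \<longleftrightarrow>
     (if N = 18 then hauptmodul 18 j
      else (\<forall>z\<in>upper_half_plane. j z = explicit_hauptmodul N z))"

text \<open>
  The generating identity \<open>j' / (x - j) = \<Sum>\<nu>. P\<^sub>\<nu>(x) q^\<nu>\<close>, where \<open>F\<close> is the \<open>q\<close>-expansion of \<open>j\<close> and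
  \<open>j' = q dj/dq\<close>. It is an identity of formal Laurent series in \<open>q\<close> over the complex numbers,
  one for each complex \<open>x\<close>.
\<close>

definition generates_polys :: "complex fls \<Rightarrow> (nat \<Rightarrow> complex poly) \<Rightarrow> bool" where
  "generates_polys F P \<longleftrightarrow>
     (\<forall>x. fls_X * fls_deriv F / (fls_const x - F) =
          fps_to_fls (Abs_fps (\<lambda>\<nu>. poly (P \<nu>) x)))"

text \<open>
  The weight-0 Hecke operator of index \<open>m > 0\<close> on level \<open>M\<close>. The operator \<open>V\<^sub>d\<close> is
  \<^const>\<open>fls_compose_power\<close>.
\<close>

definition hecke_T :: "nat \<Rightarrow> nat \<Rightarrow> complex fls \<Rightarrow> complex fls" where
  "hecke_T M m F = Abs_fls (\<lambda>n.
     \<Sum>e | e dvd m \<and> int e dvd n \<and> coprime e M.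
       fls_nth F (int m * n div (int e)\<^sup>2) / of_nat e)"

lemma fls_nth_hecke_T:
  assumes "m > 0"
  shows "fls_nth (hecke_T M m F) n =
    (\<Sum>e | e dvd m \<and> int e dvd n \<and> coprime e M.
       fls_nth F (int m * n div (int e)\<^sup>2) / of_nat e)"
proof -
  define B where "B = int m * \<bar>fls_subdegree F\<bar>"
  have zero: "fls_nth F (int m * k div (int e)\<^sup>2) = 0"
    if k: "k < - B" and e: "e dvd m" "int e dvd k" for k e
  proof -
    obtain a where a: "m = e * a" using e(1) by auto
    obtain b where b: "k = int e * b" using e(2) by auto
    have pos: "e > 0" "a > 0" using assms a by auto
    have eq: "int m * k div (int e)\<^sup>2 = int a * b"
      using pos by (simp add: a b power2_eq_square algebra_simps)
    have "int e * b < int e * (- (int a * \<bar>fls_subdegree F\<bar>))"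
      using k by (simp add: B_def a b algebra_simps)
    then have b_less: "b < - (int a * \<bar>fls_subdegree F\<bar>)"
      using pos(1) by (simp only: mult_less_cancel_left_pos of_nat_0_less_iff)
    have a_ge: "int a \<ge> 1" using pos by simp
    have "\<bar>fls_subdegree F\<bar> \<le> int a * \<bar>fls_subdegree F\<bar>"
      using mult_right_mono[OF a_ge, of "\<bar>fls_subdegree F\<bar>"] by simp
    then have b_neg: "b < - \<bar>fls_subdegree F\<bar>" using b_less by linarith
    have "int a * b \<le> 1 * b"
      using a_ge b_neg by (intro mult_right_mono_neg) auto
    then have "int a * b < fls_subdegree F" using b_neg by linarith
    then show ?thesis unfolding eq by (rule fls_eq0_below_subdegree)
  qed
  show ?thesis
    unfolding hecke_T_def
  proof (rule nth_Abs_fls_lower_bound[of "- B"])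
    show "\<forall>k < - B. (\<Sum>e | e dvd m \<and> int e dvd k \<and> coprime e M.
        fls_nth F (int m * k div (int e)\<^sup>2) / of_nat e) = 0"
      using zero by (auto intro!: sum.neutral)
  qed
qed

text \<open>\<open>f\<close> is represented on the whole upper half-plane by the \<open>q\<close>-series \<open>F\<close>.\<close>

definition equals_q_series :: "(complex \<Rightarrow> complex) \<Rightarrow> complex fls \<Rightarrow> bool" where
  "equals_q_series f F \<longleftrightarrow>
     fls_conv_radius F \<ge> 1 \<and> (\<forall>z\<in>upper_half_plane. f z = eval_fls F (nome 1 z))"

end

theory Submission
  imports Defs
begin

text \<open>
  Let \<open>H\<close> be the sum of \<open>J\<^bsup>(N/gcd(a,N))\<^esup>((a z + b)/e)\<close> over the Hermite normal forms with \<open>a e = \<nu>\<close> and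
  \<open>0 \<le> b < e\<close>; summing over \<open>b\<close> first shows that its \<open>q\<close>-expansion is the right-hand side. Since \<open>\<Gamma>\<^sub>0(N)\<close>
  permutes the sublattices of index \<open>\<nu>\<close> and preserves their type \<open>gcd(a,N)\<close>, \<open>H\<close> is \<open>\<Gamma>\<^sub>0(N)\<close>-invariant.
  At cusps inequivalent to \<open>\<infinity>\<close> the polar parts cancel in the sum over \<open>b\<close>, and at \<open>\<infinity>\<close> the expansion is
  \<open>q\<^sup>-\<^sup>\<nu> + O(q)\<close>. The generating identity makes \<open>P\<^sub>\<nu>\<close> the Faber polynomial with \<open>P\<^sub>\<nu>(j) = q\<^sup>-\<^sup>\<nu> + O(q)\<close>, whatever
  the constant term of \<open>j\<close>. So \<open>H - P\<^sub>\<nu>(j)\<close> is regular everywhere and vanishes at \<open>\<infinity>\<close>, and the maximum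
  principle on the compactified modular curve makes it zero.

  It remains to see that the explicit \<open>j\<^bsup>(N)\<^esup>\<close> is \<open>J\<^bsup>(N)\<^esup>\<close> plus a constant. The conditionally convergent
  Eisenstein series of weight two gives the transformation of \<open>\<eta>\<^sup>2\<^sup>4\<close>, so \<open>\<bar>\<eta>\<bar>\<^sup>4 Im z\<close> is invariant. Only the absolute
  value of an eta quotient is thus known to be invariant, but this suffices for the maximum principle,
  applied to \<open>(J - x\<^sub>0) / f\<close> where \<open>f\<close> is the eta quotient and \<open>x\<^sub>0\<close> the value of \<open>J\<close> at the unique cusp at
  which \<open>f\<close> vanishes.
\<close>

subsection \<open>The modular group\<close>

text \<open>The hypotheses supply \<open>J M\<close> for every \<open>M\<close> dividing
  \<open>N\<close>, so no Hauptmodul is constructed: a listed function only has to be compared with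
  \<open>J N\<close>. For an eta quotient \<open>f\<close>, invariance of the difference
  \<open>f - J\<close> would call for the full multiplier system of the eta function. In
  \<open>(J - x0) / f\<close> absolute values suffice, but the zeros have to match at every cusp.
  This is why the zero of \<open>f\<close> is located at a cusp \<open>1/g0\<close> with
  \<open>g0\<close> coprime to \<open>N/g0\<close>: all fractions \<open>a/c\<close> with
  \<open>gcd c N = g0\<close> then form one cusp, at which \<open>J\<close> has one value.

  The constant term of the Faber polynomial evaluated at \<open>j\<close> vanishes for a residue
  reason: it is the coefficient of \<open>q\<close> in the preceding Faber series minus a multiple
  of a coefficient of \<open>j\<close>, and the two agree because a polynomial in \<open>j\<close>
  times the derivative of \<open>j\<close> is itself a derivative. On the other side the constant
  term vanishes because every \<open>J M\<close> is normalized.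

  The row sums of weights two and four, and the zeta value at 4, are all read off from the
  reflection formula of the Gamma function, differentiated repeatedly.\<close>

fun mat_mul :: "mat2 \<Rightarrow> mat2 \<Rightarrow> mat2" where
  "mat_mul (a, b, c, d) (a', b', c', d') =
     (a * a' + b * c', a * b' + b * d', c * a' + d * c', c * b' + d * d')"

fun mat_det :: "mat2 \<Rightarrow> int" where
  "mat_det (a, b, c, d) = a * d - b * c"

fun mat_adj :: "mat2 \<Rightarrow> mat2" where
  "mat_adj (a, b, c, d) = (d, -b, -c, a)"

lemma mat_mul_assoc: "mat_mul (mat_mul A B) C = mat_mul A (mat_mul B C)"
  by (cases A; cases B; cases C) (simp add: algebra_simps)

lemma mat_det_mul: "mat_det (mat_mul A B) = mat_det A * mat_det B"
  by (cases A; cases B) (simp add: algebra_simps)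

lemma mat_det_adj [simp]: "mat_det (mat_adj A) = mat_det A"
  by (cases A) (simp add: algebra_simps)

lemma mat_adj_SL2Z: "mat_det A = 1 \<Longrightarrow> mat_mul (mat_adj A) A = (1, 0, 0, 1)"
  "mat_det A = 1 \<Longrightarrow> mat_mul A (mat_adj A) = (1, 0, 0, 1)"
  by (cases A; simp add: algebra_simps)+

lemma mat_mul_id [simp]: "mat_mul (1, 0, 0, 1) A = A" "mat_mul A (1, 0, 0, 1) = A"
  by (cases A; simp)+

lemma SL2Z_iff: "A \<in> SL2Z \<longleftrightarrow> mat_det A = 1"
  by (cases A) (simp add: SL2Z_def)

lemma Gamma0_imp_SL2Z: "A \<in> Gamma0 N \<Longrightarrow> A \<in> SL2Z"
  by (auto simp: Gamma0_def)

section \<open>The action on the upper half-plane\<close>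

lemma moebius_denominator_nonzero:
  assumes "(c, d) \<noteq> (0, 0)" "Im z > 0"
  shows "of_int c * z + of_int d \<noteq> (0 :: complex)"
proof
  assume "of_int c * z + of_int d = 0"
  hence "of_int c * Im z = 0" "of_int c * Re z + of_int d = 0"
    by (simp_all add: complex_eq_iff)
  with assms show False by auto
qed

lemma moebius_act_Im:
  assumes "mat_det (a, b, c, d) > 0" "Im z > 0"
  shows "Im (moebius_act (a, b, c, d) z) =
    of_int (mat_det (a, b, c, d)) * Im z / norm (of_int c * z + of_int d) ^ 2"
proof -
  have nz: "of_int c * z + of_int d \<noteq> 0"
    using assms by (intro moebius_denominator_nonzero) auto
  show ?thesis
    using nz by (simp add: Im_divide cmod_def) (simp add: algebra_simps)
qed

lemma moebius_act_upper:
  assumes "mat_det A > 0" "Im z > 0"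
  shows "Im (moebius_act A z) > 0"
proof -
  obtain a b c d where A: "A = (a, b, c, d)" by (cases A) auto
  have nz: "of_int c * z + of_int d \<noteq> 0"
    using assms A by (intro moebius_denominator_nonzero) auto
  show ?thesis
    unfolding A using assms nz unfolding A
    by (subst moebius_act_Im) (auto intro!: divide_pos_pos mult_pos_pos
        simp del: of_int_mult of_int_diff)
qed

lemma moebius_act_mul:
  assumes "mat_det A > 0" "mat_det B > 0" "Im z > 0"
  shows "moebius_act (mat_mul A B) z = moebius_act A (moebius_act B z)"
proof -
  obtain a b c d where A: "A = (a, b, c, d)" by (cases A) auto
  obtain a' b' c' d' where B: "B = (a', b', c', d')" by (cases B) auto
  have nz: "of_int c' * z + of_int d' \<noteq> 0"
    using assms B by (intro moebius_denominator_nonzero) auto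
  have "Im (moebius_act B z) > 0"
    using assms by (intro moebius_act_upper)
  hence nz2: "of_int c * moebius_act B z + of_int d \<noteq> 0"
    using assms A by (intro moebius_denominator_nonzero) auto
  have "of_int (c * a' + d * c') * z + of_int (c * b' + d * d') =
      (of_int c * moebius_act B z + of_int d) * (of_int c' * z + of_int d')"
    using nz by (simp add: B field_simps)
  moreover have "of_int (a * a' + b * c') * z + of_int (a * b' + b * d') =
      (of_int a * moebius_act B z + of_int b) * (of_int c' * z + of_int d')"
    using nz by (simp add: B field_simps)
  ultimately show ?thesis
    using nz nz2 by (simp add: A B del: of_int_add of_int_mult)
qed

lemma moebius_act_adj:
  assumes "A \<in> SL2Z" "Im z > 0"
  shows "moebius_act A (moebius_act (mat_adj A) z) = z"
    "moebius_act (mat_adj A) (moebius_act A z) = z"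
  using assms moebius_act_mul[of A "mat_adj A" z] moebius_act_mul[of "mat_adj A" A z]
  by (simp_all add: SL2Z_iff mat_adj_SL2Z)

lemma holomorphic_on_moebius_act:
  assumes "mat_det A > 0"
  shows "moebius_act A holomorphic_on upper_half_plane"
proof -
  obtain a b c d where A: "A = (a, b, c, d)" by (cases A) auto
  have "(\<lambda>z. (of_int a * z + of_int b) / (of_int c * z + of_int d)) holomorphic_on upper_half_plane"
  proof (intro holomorphic_intros)
    fix z assume "z \<in> upper_half_plane"
    thus "of_int c * z + of_int d \<noteq> 0"
      using assms A by (intro moebius_denominator_nonzero) (auto simp: upper_half_plane_def)
  qed
  moreover have "moebius_act A = (\<lambda>z. (of_int a * z + of_int b) / (of_int c * z + of_int d))"
    by (simp add: A fun_eq_iff)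
  ultimately show ?thesis by simp
qed

lemma holomorphic_on_compose_moebius:
  assumes "f holomorphic_on upper_half_plane" "mat_det A > 0"
  shows "(\<lambda>z. f (moebius_act A z)) holomorphic_on upper_half_plane"
  by (rule holomorphic_on_compose_gen[OF holomorphic_on_moebius_act[OF assms(2)] assms(1),
        unfolded o_def])
     (auto simp: upper_half_plane_def moebius_act_upper[OF assms(2)])

lemma open_upper_half_plane: "open upper_half_plane"
  unfolding upper_half_plane_def by (rule open_halfspace_Im_gt)

lemma convex_upper_half_plane: "convex upper_half_plane"
  unfolding upper_half_plane_def by (rule convex_halfspace_Im_gt)

lemma connected_upper_half_plane: "connected upper_half_plane"
  by (rule convex_connected[OF convex_upper_half_plane])

text \<open>A coprime pair \<open>(c, d)\<close> with minimal \<open>norm (c z + d)\<close> is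
  completed to a matrix, and a translation moves the real part into range. The upper row of the
  result is again a coprime pair, so an image of modulus below 1 would contradict minimality. Of the
  usual bound \<open>sqrt 3 / 2\<close> only \<open>1 / 2\<close> is kept; it serves to stay away
  from the real axis.\<close>

lemma SL2Z_reduction:
  assumes z: "Im z > 0"
  obtains \<gamma> where "\<gamma> \<in> SL2Z" "\<bar>Re (moebius_act \<gamma> z)\<bar> \<le> 1 / 2" "Im (moebius_act \<gamma> z) \<ge> 1 / 2"
proof -
  define S where "S = {(c, d). coprime c d \<and> norm (of_int c * z + of_int d) \<le> 1}"
  define B where "B = \<lceil>1 / Im z\<rceil>"
  define B' where "B' = \<lceil>1 + of_int B * norm z\<rceil>"
  have "S \<subseteq> {-B..B} \<times> {-B'..B'}"
  proof safe
    fix c d assume cd: "(c, d) \<in> S"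
    hence *: "norm (of_int c * z + of_int d) \<le> 1" by (simp add: S_def)
    have "\<bar>of_int c\<bar> * Im z = \<bar>Im (of_int c * z + of_int d)\<bar>"
      using z by (simp add: abs_mult)
    also have "\<dots> \<le> 1" using abs_Im_le_cmod * by (rule order_trans)
    finally have "\<bar>of_int c\<bar> \<le> 1 / Im z" using z by (simp add: field_simps)
    hence c: "\<bar>c\<bar> \<le> B" unfolding B_def by linarith
    have "\<bar>real_of_int d\<bar> = norm (of_int c * z + of_int d - of_int c * z)"
      by simp
    also have "\<dots> \<le> norm (of_int c * z + of_int d) + norm (of_int c * z)"
      by (rule norm_triangle_ineq4)
    also have "\<dots> \<le> 1 + real_of_int B * norm z"
      using c * by (intro add_mono) (auto simp: norm_mult intro!: mult_right_mono)
    finally have d: "\<bar>d\<bar> \<le> B'" unfolding B'_def by linarith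
    show "c \<in> {-B..B}" "d \<in> {-B'..B'}" using c d by auto
  qed
  hence fin: "finite S" by (rule finite_subset) auto
  have ne: "(0, 1) \<in> S" by (simp add: S_def)
  define f where "f = (\<lambda>(c, d). norm (of_int c * z + of_int d))"
  obtain c d where cd: "(c, d) \<in> S" "\<And>x. x \<in> S \<Longrightarrow> f (c, d) \<le> f x"
    using arg_min_if_finite(1)[OF fin, of f] ne arg_min_least[OF fin, of _ f]
    by (metis empty_iff surj_pair)
  have "coprime c d" using cd(1) by (simp add: S_def)
  then obtain u v where uv: "u * c + v * d = 1" using bezout_int[of c d] by auto
  define \<gamma>0 :: mat2 where "\<gamma>0 = (v, -u, c, d)"
  have \<gamma>0: "mat_det \<gamma>0 = 1" using uv by (simp add: \<gamma>0_def algebra_simps)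
  define k where "k = round (Re (moebius_act \<gamma>0 z))"
  define \<gamma> where "\<gamma> = mat_mul (1, -k, 0, 1) \<gamma>0"
  have \<gamma>: "mat_det \<gamma> = 1" unfolding \<gamma>_def using \<gamma>0 by (simp add: mat_det_mul)
  define w where "w = moebius_act \<gamma> z"
  have w: "w = moebius_act \<gamma>0 z - of_int k"
    unfolding w_def \<gamma>_def using \<gamma>0 z by (subst moebius_act_mul) auto
  have Re_w: "\<bar>Re w\<bar> \<le> 1 / 2"
    unfolding w k_def using of_int_round_abs_le[of "Re (moebius_act \<gamma>0 z)"]
    by (simp add: abs_minus_commute)
  have Im_w: "Im w > 0" unfolding w_def using \<gamma> z by (intro moebius_act_upper) auto
  have \<gamma>_eq: "\<gamma> = (v - k * c, -u - k * d, c, d)" by (simp add: \<gamma>_def \<gamma>0_def)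
  have "norm w \<ge> 1"
  proof (rule ccontr)
    assume "\<not> norm w \<ge> 1"
    hence w1: "norm w < 1" by simp
    have nz: "of_int c * z + of_int d \<noteq> 0"
      using \<gamma> z unfolding \<gamma>_eq by (intro moebius_denominator_nonzero) auto
    let ?a = "v - k * c" and ?b = "-u - k * d"
    have "w = (of_int ?a * z + of_int ?b) / (of_int c * z + of_int d)"
      unfolding w_def \<gamma>_eq by simp
    hence eq: "of_int ?a * z + of_int ?b = w * (of_int c * z + of_int d)"
      using nz by simp
    have lt: "norm (of_int ?a * z + of_int ?b) < norm (of_int c * z + of_int d)"
      unfolding eq norm_mult using w1 nz by simp
    have "coprime ?a ?b"
    proof (rule coprimeI)
      fix l assume "l dvd ?a" "l dvd ?b"
      hence "l dvd ?a * d - ?b * c" by (metis dvd_diff dvd_mult2)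
      thus "is_unit l" using \<gamma> unfolding \<gamma>_eq mat_det.simps by simp
    qed
    moreover have "norm (of_int ?a * z + of_int ?b) \<le> 1"
      using lt cd(1) by (simp add: S_def)
    ultimately have "(?a, ?b) \<in> S" by (simp add: S_def)
    from cd(2)[OF this] lt show False by (simp add: f_def)
  qed
  hence "1 \<le> (Re w)\<^sup>2 + (Im w)\<^sup>2" unfolding cmod_def by simp
  moreover have "(Re w)\<^sup>2 \<le> (1 / 2)\<^sup>2" using Re_w by (intro abs_le_square_iff[THEN iffD1]) simp
  ultimately have "(1 / 2)\<^sup>2 \<le> (Im w)\<^sup>2" by (simp add: power2_eq_square)
  hence "Im w \<ge> 1 / 2" using Im_w by (subst (asm) power_mono_iff) auto
  thus ?thesis using that[of \<gamma>] Re_w \<gamma> by (simp add: w_def SL2Z_iff)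
qed

text \<open>Coset representatives are separated by the lower row modulo \<open>N\<close>.\<close>

lemma Gamma0_finite_index:
  assumes "N > 0"
  obtains R where "finite R" "R \<subseteq> SL2Z"
    "\<And>\<gamma>. \<gamma> \<in> SL2Z \<Longrightarrow> \<exists>\<rho>\<in>R. \<exists>g\<in>Gamma0 N. \<gamma> = mat_mul g \<rho>"
proof -
  define \<phi> :: "mat2 \<Rightarrow> int \<times> int" where "\<phi> = (\<lambda>(a, b, c, d). (c mod int N, d mod int N))"
  have sub: "\<phi> ` SL2Z \<subseteq> {0..<int N} \<times> {0..<int N}"
    using assms by (auto simp: \<phi>_def split: prod.splits)
  have fin: "finite (\<phi> ` SL2Z)" by (rule finite_subset[OF sub]) auto
  define R where "R = inv_into SL2Z \<phi> ` (\<phi> ` SL2Z)"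
  have "finite R" using fin unfolding R_def by blast
  moreover have "R \<subseteq> SL2Z" unfolding R_def by (auto intro!: inv_into_into)
  moreover have "\<exists>\<rho>\<in>R. \<exists>g\<in>Gamma0 N. \<gamma> = mat_mul g \<rho>" if \<gamma>: "\<gamma> \<in> SL2Z" for \<gamma>
  proof -
    define \<rho> where "\<rho> = inv_into SL2Z \<phi> (\<phi> \<gamma>)"
    have \<rho>: "\<rho> \<in> R" "\<rho> \<in> SL2Z" "\<phi> \<rho> = \<phi> \<gamma>"
      using \<gamma> by (auto simp: R_def \<rho>_def intro: inv_into_into f_inv_into_f)
    define g where "g = mat_mul \<gamma> (mat_adj \<rho>)"
    have "mat_mul g \<rho> = \<gamma>"
      using \<rho>(2) by (simp add: g_def mat_mul_assoc mat_adj_SL2Z SL2Z_iff)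
    moreover have "g \<in> Gamma0 N"
    proof -
      obtain a b c d where 1: "\<gamma> = (a, b, c, d)" by (cases \<gamma>) auto
      obtain a' b' c' d' where 2: "\<rho> = (a', b', c', d')" by (cases \<rho>) auto
      have det: "mat_det g = 1" using \<gamma> \<rho>(2) by (simp add: g_def mat_det_mul SL2Z_iff)
      have "int N dvd c - c'" "int N dvd d' - d"
        using \<rho>(3) by (simp_all add: \<phi>_def 1 2 mod_eq_dvd_iff[symmetric])
      hence "int N dvd (c - c') * d' + c' * (d' - d)" by (intro dvd_add dvd_mult dvd_mult2)
      hence "int N dvd c * d' - c' * d" by (simp add: algebra_simps)
      thus ?thesis using det SL2Z_iff[of g]
        by (simp add: Gamma0_def g_def 1 2 algebra_simps)
    qed
    ultimately show ?thesis using \<rho>(1) by metis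
  qed
  ultimately show ?thesis using that by blast
qed

text \<open>Left multiplication by \<open>(0, -1, 1, -k)\<close> with \<open>k = a div c\<close>
  changes the lower left entry from \<open>c\<close> to \<open>a mod c\<close>, so the Euclidean
  algorithm reduces every matrix to a translation. The codomain is arbitrary because the lemma
  serves both the complex-valued \<open>modular_j\<close> and a real-valued norm of the eta
  function.\<close>

lemma SL2Z_invariantI:
  fixes f :: "complex \<Rightarrow> 'a"
  assumes T: "\<And>z. Im z > 0 \<Longrightarrow> f (z + 1) = f z"
    and S: "\<And>z. Im z > 0 \<Longrightarrow> f (- 1 / z) = f z"
    and \<gamma>: "\<gamma> \<in> SL2Z" and z: "Im z > 0"
  shows "f (moebius_act \<gamma> z) = f z"
proof -
  have Tn: "f (z + of_nat n) = f z" if "Im z > 0" for n z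
    using that
  proof (induction n)
    case (Suc n)
    thus ?case using T[of "z + of_nat n"] by (simp add: algebra_simps)
  qed auto
  have Tk: "f (z + of_int k) = f z" if "Im z > 0" for k z
  proof (cases k rule: int_cases2)
    case (nonneg n) thus ?thesis using Tn[OF that, of n] by simp
  next
    case (nonpos n) thus ?thesis using Tn[of "z - of_nat n" n] that by simp
  qed
  obtain a b c d where "\<gamma> = (a, b, c, d)" by (cases \<gamma>) auto
  have "mat_det (a, b, c, d) = 1 \<Longrightarrow> f (moebius_act (a, b, c, d) z) = f z" for a b c d
  proof (induction "nat \<bar>c\<bar>" arbitrary: a b c d rule: less_induct)
    case less
    show ?case
    proof (cases "c = 0")
      case True
      with less.prems have "a * d = 1" by simp
      hence "a = 1 \<and> d = 1 \<or> a = -1 \<and> d = -1" by (simp add: zmult_eq_1_iff)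
      hence "moebius_act (a, b, c, d) z = z + of_int (a * b)" using True by auto
      thus ?thesis using Tk[OF z, of "a * b"] by (simp del: of_int_mult)
    next
      case False
      define k where "k = a div c"
      have "nat \<bar>a mod c\<bar> < nat \<bar>c\<bar>" using False abs_mod_less[of c a] by linarith
      hence "f (moebius_act (- c, - d, a mod c, b - k * d) z) = f z"
        using less.prems
        by (intro less.hyps) (simp_all add: k_def algebra_simps minus_div_mult_eq_mod[symmetric])
      moreover have "(- c, - d, a mod c, b - k * d) = mat_mul (0, -1, 1, -k) (a, b, c, d)"
        by (simp add: k_def minus_div_mult_eq_mod[symmetric])
      ultimately have "f (moebius_act (0, -1, 1, -k) (moebius_act (a, b, c, d) z)) = f z"
        using less.prems z moebius_act_mul[of "(0, -1, 1, -k)" "(a, b, c, d)" z] by simp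
      moreover have "Im (moebius_act (a, b, c, d) z) > 0"
        using less.prems z by (intro moebius_act_upper) auto
      ultimately show ?thesis
        using S[of "moebius_act (a, b, c, d) z - of_int k"]
          Tk[of "moebius_act (a, b, c, d) z - of_int k" k] by simp
    qed
  qed
  thus ?thesis using \<gamma> \<open>\<gamma> = _\<close> by (simp add: SL2Z_iff)
qed

subsection \<open>Regularity at infinity\<close>

definition i_infinity :: "complex filter" where
  "i_infinity = filtercomap Im at_top"

lemma eventually_i_infinity: "eventually P i_infinity \<longleftrightarrow> (\<exists>y. \<forall>z. Im z > y \<longrightarrow> P z)"
  unfolding i_infinity_def eventually_filtercomap_at_top_dense by (rule refl)

lemma eventually_Im_gt_i_infinity: "eventually (\<lambda>z. Im z > y) i_infinity"
  by (auto simp: eventually_i_infinity)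

lemma i_infinity_neq_bot [simp]: "i_infinity \<noteq> bot"
proof
  assume "i_infinity = bot"
  hence "eventually (\<lambda>_. False) i_infinity" by simp
  then obtain y where "\<forall>z. \<not> Im z > y" by (auto simp: eventually_i_infinity)
  from this[rule_format, of "Complex 0 (y + 1)"] show False by simp
qed

lemma nome_nonzero [simp]: "nome h z \<noteq> 0"
  by (simp add: nome_def)

lemma norm_nome: "norm (nome h z) = exp (- 2 * pi * Im z / real h)"
  unfolding nome_def norm_exp_eq_Re by (simp add: Re_divide power2_eq_square)

lemma nome_1_lt_1: "Im z > 0 \<Longrightarrow> norm (nome 1 z) < 1"
  by (simp add: norm_nome)

lemma nome_mult_power: "k > 0 \<Longrightarrow> nome (h * k) z ^ k = nome h z"
  unfolding nome_def by (simp add: exp_of_nat_mult[symmetric])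

lemma nome_power: "nome h z ^ k = nome h (of_nat k * z)"
  unfolding nome_def by (simp add: exp_of_nat_mult[symmetric] mult_ac)

lemma nome_add: "nome h (z + w) = nome h z * nome h w"
  unfolding nome_def by (simp add: exp_add[symmetric] ring_distribs add_divide_distrib)

lemma nome_uminus: "nome h (- z) = inverse (nome h z)"
  unfolding nome_def by (simp add: exp_minus)

lemma nome_divide: "nome h (z / of_nat k) = nome (h * k) z"
  unfolding nome_def by (simp add: mult_ac)

lemma nome_1_of_int: "nome 1 (of_int k) = 1"
proof -
  have "2 * of_real pi * \<i> * of_int k / of_nat 1 = (2 * of_int k * pi) * \<i>" by simp
  thus ?thesis unfolding nome_def exp_eq_1 by force
qed

lemma nome_1_plus_of_int: "nome 1 (z + of_int k) = nome 1 z"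
  by (simp add: nome_add nome_1_of_int[simplified])

lemma filterlim_nome: "h > 0 \<Longrightarrow> filterlim (nome h) (at 0) i_infinity"
proof -
  assume h: "h > 0"
  have "((\<lambda>z. exp (- (2 * pi / real h) * Im z)) \<longlongrightarrow> 0) i_infinity"
  proof (rule filterlim_compose[OF exp_at_bot], rule filterlim_tendsto_neg_mult_at_bot[OF tendsto_const])
    show "- (2 * pi / real h) < 0" using h by simp
    show "filterlim Im at_top i_infinity" unfolding i_infinity_def by (rule filterlim_filtercomap)
  qed
  hence "(nome h \<longlongrightarrow> 0) i_infinity"
    by (intro tendsto_norm_zero_cancel[of "nome h"]) (simp add: norm_nome field_simps)
  thus ?thesis by (auto simp: filterlim_at)
qed

lemma nome_surj:
  assumes "h > 0" "w \<noteq> 0"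
  obtains z where "w = nome h z"
  using that[of "of_nat h * Ln w / (2 * of_real pi * \<i>)"] assms by (simp add: nome_def)

text \<open>Each half-plane \<open>Im z > y\<close> is mapped by \<open>nome h\<close> onto a full
  punctured disc around 0, so statements can be transferred in both directions.\<close>

lemma eventually_nome_iff:
  assumes "h > 0"
  shows "eventually (\<lambda>z. P (nome h z)) i_infinity \<longleftrightarrow> eventually P (at 0)"
proof
  assume "eventually P (at 0)"
  thus "eventually (\<lambda>z. P (nome h z)) i_infinity"
    using filterlim_nome[OF assms] unfolding filterlim_iff by blast
next
  assume "eventually (\<lambda>z. P (nome h z)) i_infinity"
  then obtain y where y: "\<And>z. Im z > y \<Longrightarrow> P (nome h z)" by (auto simp: eventually_i_infinity)
  have "eventually (\<lambda>w. w \<in> ball 0 (exp (- 2 * pi * y / real h)) - {0}) (at (0 :: complex))"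
    by (intro eventually_at_in_open) auto
  thus "eventually P (at 0)"
  proof eventually_elim
    case (elim w)
    then obtain z where w: "w = nome h z" using nome_surj[OF assms, of w] by auto
    have "exp (- 2 * pi * Im z / real h) < exp (- 2 * pi * y / real h)"
      using elim unfolding w by (simp add: norm_nome)
    hence "Im z > y" using assms by (simp add: field_simps)
    thus ?case using y w by simp
  qed
qed

text \<open>The parameter \<open>h\<close> is left open because cusps have different widths; two
  functions are brought to a common parameter in \<open>regular_at_infinity_common\<close>. An
  analytic germ \<open>G\<close> in place of a power series makes closure under products, inverses
  and substitutions immediate.\<close>

definition regular_at_infinity :: "(complex \<Rightarrow> complex) \<Rightarrow> bool" where
  "regular_at_infinity f \<longleftrightarrow>
     (\<exists>h>0. \<exists>G. G analytic_on {0} \<and> eventually (\<lambda>z. f z = G (nome h z)) i_infinity)"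

lemma regular_at_infinityI:
  assumes "h > 0" "G analytic_on {0}" "eventually (\<lambda>z. f z = G (nome h z)) i_infinity"
  shows "regular_at_infinity f"
  using assms unfolding regular_at_infinity_def by blast

lemma regular_at_infinity_cong:
  assumes "eventually (\<lambda>z. f z = g z) i_infinity"
  shows "regular_at_infinity f \<longleftrightarrow> regular_at_infinity g"
  unfolding regular_at_infinity_def
  by (intro ex_cong1 conj_cong refl) (use assms in \<open>auto elim: eventually_elim2\<close>)

lemma analytic_at_0_compose_monomial:
  assumes "G analytic_on {0}" "k > 0"
  shows "(\<lambda>w. G (c * w ^ k)) analytic_on {0 :: complex}"
proof -
  have "G \<circ> (\<lambda>w. c * w ^ k) analytic_on {0}"
    by (rule analytic_on_compose) (use assms in \<open>auto intro!: analytic_intros simp: power_0_left\<close>)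
  thus ?thesis by (simp add: o_def)
qed

lemma regular_at_infinity_common:
  assumes "regular_at_infinity f" "regular_at_infinity g"
  obtains h F G where "h > 0" "F analytic_on {0}" "G analytic_on {0}"
    "eventually (\<lambda>z. f z = F (nome h z)) i_infinity" "eventually (\<lambda>z. g z = G (nome h z)) i_infinity"
proof -
  obtain h F where F: "h > 0" "F analytic_on {0}" "eventually (\<lambda>z. f z = F (nome h z)) i_infinity"
    using assms(1) by (auto simp: regular_at_infinity_def)
  obtain k G where G: "k > 0" "G analytic_on {0}" "eventually (\<lambda>z. g z = G (nome k z)) i_infinity"
    using assms(2) by (auto simp: regular_at_infinity_def)
  show ?thesis
  proof (rule that[of "h * k" "\<lambda>w. F (1 * w ^ k)" "\<lambda>w. G (1 * w ^ h)"])
    show "eventually (\<lambda>z. f z = F (1 * nome (h * k) z ^ k)) i_infinity"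
      using F(3) by eventually_elim (use G(1) in \<open>simp add: nome_mult_power\<close>)
    show "eventually (\<lambda>z. g z = G (1 * nome (h * k) z ^ h)) i_infinity"
      using G(3) by eventually_elim (use F(1) in \<open>simp add: nome_mult_power mult.commute[of h]\<close>)
    show "(\<lambda>w. F (1 * w ^ k)) analytic_on {0}" "(\<lambda>w. G (1 * w ^ h)) analytic_on {0}"
      using F G by (intro analytic_at_0_compose_monomial; simp)+
  qed (use F G in auto)
qed

lemma regular_at_infinity_const [simp]: "regular_at_infinity (\<lambda>_. c)"
  by (rule regular_at_infinityI[of 1 "\<lambda>_. c"]) auto

lemma regular_at_infinity_nome: "h > 0 \<Longrightarrow> regular_at_infinity (nome h)"
  by (rule regular_at_infinityI[of h "\<lambda>w. w"]) auto

lemma regular_at_infinity_add: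
  assumes "regular_at_infinity f" "regular_at_infinity g"
  shows "regular_at_infinity (\<lambda>z. f z + g z)"
proof -
  obtain h F G where *: "h > 0" "F analytic_on {0}" "G analytic_on {0}"
    "eventually (\<lambda>z. f z = F (nome h z)) i_infinity" "eventually (\<lambda>z. g z = G (nome h z)) i_infinity"
    using regular_at_infinity_common[OF assms] .
  show ?thesis
    by (rule regular_at_infinityI[of h "\<lambda>w. F w + G w"])
       (use * in \<open>auto intro!: analytic_intros elim: eventually_elim2\<close>)
qed

lemma regular_at_infinity_mult:
  assumes "regular_at_infinity f" "regular_at_infinity g"
  shows "regular_at_infinity (\<lambda>z. f z * g z)"
proof -
  obtain h F G where *: "h > 0" "F analytic_on {0}" "G analytic_on {0}"
    "eventually (\<lambda>z. f z = F (nome h z)) i_infinity" "eventually (\<lambda>z. g z = G (nome h z)) i_infinity"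
    using regular_at_infinity_common[OF assms] .
  show ?thesis
    by (rule regular_at_infinityI[of h "\<lambda>w. F w * G w"])
       (use * in \<open>auto intro!: analytic_intros elim: eventually_elim2\<close>)
qed

lemma regular_at_infinity_sum:
  assumes "\<And>i. i \<in> I \<Longrightarrow> regular_at_infinity (f i)"
  shows "regular_at_infinity (\<lambda>z. \<Sum>i\<in>I. f i z)"
  using assms by (induction I rule: infinite_finite_induct) (auto intro!: regular_at_infinity_add)

lemma regular_at_infinity_power:
  "regular_at_infinity f \<Longrightarrow> regular_at_infinity (\<lambda>z. f z ^ n)"
  by (induction n) (auto intro!: regular_at_infinity_mult)

lemma regular_at_infinity_poly:
  "regular_at_infinity f \<Longrightarrow> regular_at_infinity (\<lambda>z. poly p (f z))"
  by (induction p) (auto intro!: regular_at_infinity_add regular_at_infinity_mult)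

lemma regular_at_infinity_diff:
  "regular_at_infinity f \<Longrightarrow> regular_at_infinity g \<Longrightarrow> regular_at_infinity (\<lambda>z. f z - g z)"
  using regular_at_infinity_add[of f "\<lambda>z. -1 * g z"] regular_at_infinity_mult[of "\<lambda>_. -1" g]
  by simp

lemma regular_at_infinity_inverse:
  assumes "regular_at_infinity f" "(f \<longlongrightarrow> c) i_infinity" "c \<noteq> 0"
  shows "regular_at_infinity (\<lambda>z. inverse (f z))"
proof -
  obtain h G where G: "h > 0" "G analytic_on {0}" "eventually (\<lambda>z. f z = G (nome h z)) i_infinity"
    using assms(1) by (auto simp: regular_at_infinity_def)
  have "(G \<longlongrightarrow> G 0) (at 0)"
    using G(2) analytic_at_imp_isCont isContD by blast
  hence "((\<lambda>z. G (nome h z)) \<longlongrightarrow> G 0) i_infinity"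
    using filterlim_compose filterlim_nome[OF G(1)] by blast
  hence "(f \<longlongrightarrow> G 0) i_infinity"
    using G(3) by (subst tendsto_cong)
  hence "G 0 = c" using assms(2) tendsto_unique[OF i_infinity_neq_bot] by blast
  show ?thesis
    by (rule regular_at_infinityI[of h "\<lambda>w. inverse (G w)"])
       (use G \<open>G 0 = c\<close> assms(3) in \<open>auto intro!: analytic_intros elim: eventually_mono\<close>)
qed

lemma eventually_affine_i_infinity:
  assumes "eventually P i_infinity" "a > 0" "e > 0"
  shows "eventually (\<lambda>z. P ((of_nat a * z + of_int b) / of_nat e)) i_infinity"
proof -
  obtain y where y: "\<And>z. Im z > y \<Longrightarrow> P z" using assms(1) by (auto simp: eventually_i_infinity)
  have "eventually (\<lambda>z. Im z > y * real e / real a) i_infinity"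
    by (auto simp: eventually_i_infinity)
  thus ?thesis
    by eventually_elim (rule y, use assms(2,3) in \<open>simp add: field_simps\<close>)
qed

lemma nome_affine:
  assumes "e > 0"
  shows "nome h ((of_nat a * z + of_int b) / of_nat e) = nome (h * e) (of_int b) * nome (h * e) z ^ a"
  by (simp add: nome_divide nome_add nome_power)

lemma regular_at_infinity_affine:
  assumes "regular_at_infinity f" "a > 0" "e > 0"
  shows "regular_at_infinity (\<lambda>z. f ((of_nat a * z + of_int b) / of_nat e))"
proof -
  obtain h G where G: "h > 0" "G analytic_on {0}" "eventually (\<lambda>z. f z = G (nome h z)) i_infinity"
    using assms(1) by (auto simp: regular_at_infinity_def)
  show ?thesis
  proof (rule regular_at_infinityI)
    show "eventually (\<lambda>z. f ((of_nat a * z + of_int b) / of_nat e) =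
        G (nome (h * e) (of_int b) * nome (h * e) z ^ a)) i_infinity"
      using eventually_affine_i_infinity[OF G(3) assms(2,3), of b]
      by (simp add: nome_affine[OF assms(3)])
    show "(\<lambda>w. G (nome (h * e) (of_int b) * w ^ a)) analytic_on {0}"
      using G(2) assms(2) by (rule analytic_at_0_compose_monomial)
  qed (use G assms in auto)
qed

lemma regular_at_infinity_limit:
  assumes "regular_at_infinity f"
  obtains c where "(f \<longlongrightarrow> c) i_infinity"
proof -
  obtain h G where G: "h > 0" "G analytic_on {0}" "eventually (\<lambda>z. f z = G (nome h z)) i_infinity"
    using assms(1) by (auto simp: regular_at_infinity_def)
  have "(G \<longlongrightarrow> G 0) (at 0)"
    using G(2) analytic_at_imp_isCont isContD by blast
  hence "((\<lambda>z. G (nome h z)) \<longlongrightarrow> G 0) i_infinity"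
    using filterlim_compose filterlim_nome[OF G(1)] by blast
  hence "(f \<longlongrightarrow> G 0) i_infinity"
    using G(3) by (subst tendsto_cong)
  thus ?thesis by (rule that)
qed

subsection \<open>A maximum principle on the modular curve\<close>

text \<open>The maximum is attained at the cusp. In the local parameter it is an interior maximum of
  \<open>norm (G w)\<close> at \<open>w = 0\<close>, hence \<open>G\<close> is constant near 0, and
  the identity theorem extends this to the whole half-plane.\<close>

lemma regular_max_at_infinity_imp_const:
  assumes f: "f holomorphic_on upper_half_plane" "regular_at_infinity f" "(f \<longlongrightarrow> c) i_infinity"
    and le: "\<And>z. Im z > 0 \<Longrightarrow> norm (f z) \<le> norm c" and z: "Im z > 0"
  shows "f z = c"
proof -
  obtain h G where G: "h > 0" "G analytic_on {0}" "eventually (\<lambda>z. f z = G (nome h z)) i_infinity"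
    using f(2) by (auto simp: regular_at_infinity_def)
  have "(G \<longlongrightarrow> G 0) (at 0)"
    using G(2) analytic_at_imp_isCont isContD by blast
  hence "((\<lambda>z. G (nome h z)) \<longlongrightarrow> G 0) i_infinity"
    using filterlim_compose filterlim_nome[OF G(1)] by blast
  hence "(f \<longlongrightarrow> G 0) i_infinity"
    using G(3) by (subst tendsto_cong)
  hence G0: "G 0 = c" using f(3) tendsto_unique[OF i_infinity_neq_bot] by blast
  obtain r where r: "r > 0" "G holomorphic_on ball 0 r"
    using G(2) by (auto simp: analytic_on_def)
  have "eventually (\<lambda>z. norm (G (nome h z)) \<le> norm c) i_infinity"
    using G(3) eventually_Im_gt_i_infinity[of 0] by eventually_elim (use le in metis)
  hence "eventually (\<lambda>w. norm (G w) \<le> norm c) (at 0)"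
    by (subst (asm) eventually_nome_iff[OF G(1)])
  then obtain r' where r': "r' > 0" "\<And>w. w \<noteq> 0 \<Longrightarrow> norm w < r' \<Longrightarrow> norm (G w) \<le> norm c"
    by (auto simp: eventually_at)
  define s where "s = min r r'"
  have s: "s > 0" "s \<le> r" using r(1) r'(1) by (auto simp: s_def)
  have bound: "norm (G w) \<le> norm c" if "norm w < s" for w
    using r'(2)[of w] that G0 by (cases "w = 0") (auto simp: s_def)
  have "G constant_on ball 0 s"
    by (rule maximum_modulus_principle[of _ _ "ball 0 s" 0])
       (use s r(2) bound G0 in \<open>auto intro: holomorphic_on_subset\<close>)
  hence Gc: "G w = c" if "norm w < s" for w
    using that s(1) G0 unfolding constant_on_def by (metis dist_0_norm mem_ball norm_zero)
  have "eventually (\<lambda>w. w \<in> ball 0 s) (at (0 :: complex))"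
    using s(1) by (intro eventually_at_in_open') auto
  hence "eventually (\<lambda>z. nome h z \<in> ball 0 s) i_infinity"
    by (subst eventually_nome_iff[OF G(1)])
  hence "eventually (\<lambda>z. f z = c) i_infinity"
    using G(3) by eventually_elim (use Gc in auto)
  then obtain y' where y': "\<And>z. Im z > y' \<Longrightarrow> f z = c" by (auto simp: eventually_i_infinity)
  show ?thesis
  proof (rule analytic_continuation_open[of "{z. Im z > max 0 y'}" upper_half_plane f "\<lambda>_. c"])
    have "Complex 0 (max 0 y' + 1) \<in> {z. Im z > max 0 y'}" by auto
    thus "{z. Im z > max 0 y'} \<noteq> {}" by blast
  qed (use z f(1) y' open_upper_half_plane connected_upper_half_plane in
        \<open>auto simp: open_halfspace_Im_gt upper_half_plane_def simp del: max_less_iff_conj\<close>)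
qed

text \<open>Let \<open>C\<close> be the largest modulus of a limit at a cusp. If
  \<open>norm g\<close> never exceeds \<open>C\<close>, the maximum sits at a cusp. If it does at
  some \<open>z0\<close>, then near every cusp \<open>norm g\<close> stays below
  \<open>norm (g z0)\<close>, so only finitely many compact pieces compete and the maximum is
  attained at an interior point.\<close>

theorem constant_if_regular_at_cusps:
  fixes g :: "complex \<Rightarrow> complex"
  assumes N: "N > 0" and holo: "g holomorphic_on upper_half_plane"
    and inv: "\<And>\<gamma> z. \<gamma> \<in> Gamma0 N \<Longrightarrow> Im z > 0 \<Longrightarrow> norm (g (moebius_act \<gamma> z)) = norm (g z)"
    and reg: "\<And>\<gamma>. \<gamma> \<in> SL2Z \<Longrightarrow> regular_at_infinity (\<lambda>z. g (moebius_act \<gamma> z))"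
  obtains c where "\<And>z. Im z > 0 \<Longrightarrow> g z = c"
proof -
  obtain R where R: "finite R" "R \<subseteq> SL2Z"
    "\<And>\<gamma>. \<gamma> \<in> SL2Z \<Longrightarrow> \<exists>\<rho>\<in>R. \<exists>g\<in>Gamma0 N. \<gamma> = mat_mul g \<rho>"
    using Gamma0_finite_index[OF N] by blast
  have R1: "mat_det \<rho> = 1" if "\<rho> \<in> R" for \<rho> using R(2) that by (auto simp: SL2Z_iff)
  have "R \<noteq> {}" using R(3)[of "(1, 0, 0, 1)"] by (auto simp: SL2Z_def)
  have reduce: "\<exists>\<rho>\<in>R. \<exists>w. \<bar>Re w\<bar> \<le> 1 / 2 \<and> Im w \<ge> 1 / 2 \<and> norm (g z) = norm (g (moebius_act \<rho> w))"
    if z: "Im z > 0" for z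
  proof -
    obtain \<gamma> where \<gamma>: "\<gamma> \<in> SL2Z" "\<bar>Re (moebius_act \<gamma> z)\<bar> \<le> 1 / 2" "Im (moebius_act \<gamma> z) \<ge> 1 / 2"
      using SL2Z_reduction[OF z] .
    define w where "w = moebius_act \<gamma> z"
    have w: "Im w > 0" using \<gamma>(3) by (simp add: w_def)
    obtain \<rho> \<delta> where \<rho>: "\<rho> \<in> R" "\<delta> \<in> Gamma0 N" "mat_adj \<gamma> = mat_mul \<delta> \<rho>"
      using R(3)[of "mat_adj \<gamma>"] \<gamma>(1) by (auto simp: SL2Z_iff)
    have "z = moebius_act (mat_adj \<gamma>) w"
      using \<gamma>(1) z by (simp add: w_def moebius_act_adj)
    also have "\<dots> = moebius_act \<delta> (moebius_act \<rho> w)"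
      unfolding \<rho>(3) using R1[OF \<rho>(1)] Gamma0_imp_SL2Z[OF \<rho>(2)] w
      by (intro moebius_act_mul) (auto simp: SL2Z_iff)
    finally have "norm (g z) = norm (g (moebius_act \<rho> w))"
      using inv[OF \<rho>(2), of "moebius_act \<rho> w"] moebius_act_upper[of \<rho> w] w R1[OF \<rho>(1)] by simp
    thus ?thesis using \<rho>(1) \<gamma>(2,3) by (auto simp: w_def)
  qed
  have "\<forall>\<rho>\<in>R. \<exists>c. ((\<lambda>z. g (moebius_act \<rho> z)) \<longlongrightarrow> c) i_infinity"
    using regular_at_infinity_limit reg R(2) by (metis subsetD)
  then obtain L where L: "\<And>\<rho>. \<rho> \<in> R \<Longrightarrow> ((\<lambda>z. g (moebius_act \<rho> z)) \<longlongrightarrow> L \<rho>) i_infinity"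
    by metis
  define C where "C = Max ((\<lambda>\<rho>. norm (L \<rho>)) ` R)"
  have C: "norm (L \<rho>) \<le> C" if "\<rho> \<in> R" for \<rho> using that R(1) by (simp add: C_def)
  have "C \<in> (\<lambda>\<rho>. norm (L \<rho>)) ` R" unfolding C_def using R(1) \<open>R \<noteq> {}\<close> by (intro Max_in) auto
  then obtain \<rho>0 where \<rho>0: "\<rho>0 \<in> R" "norm (L \<rho>0) = C" by auto
  show ?thesis
  proof (cases "\<exists>z0. Im z0 > 0 \<and> norm (g z0) > C")
    case False
    have "g z = L \<rho>0" if z: "Im z > 0" for z
    proof -
      define w where "w = moebius_act (mat_adj \<rho>0) z"
      have w: "Im w > 0" unfolding w_def using z R1[OF \<rho>0(1)] by (intro moebius_act_upper) auto
      have "g (moebius_act \<rho>0 w) = L \<rho>0"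
      proof (rule regular_max_at_infinity_imp_const[where f = "\<lambda>z. g (moebius_act \<rho>0 z)"])
        show "(\<lambda>z. g (moebius_act \<rho>0 z)) holomorphic_on upper_half_plane"
          using holo R1[OF \<rho>0(1)] by (intro holomorphic_on_compose_moebius) auto
        show "regular_at_infinity (\<lambda>z. g (moebius_act \<rho>0 z))" using reg \<rho>0(1) R(2) by blast
        show "((\<lambda>z. g (moebius_act \<rho>0 z)) \<longlongrightarrow> L \<rho>0) i_infinity" using L \<rho>0(1) by blast
        show "norm (g (moebius_act \<rho>0 z)) \<le> norm (L \<rho>0)" if "Im z > 0" for z
          using False moebius_act_upper[of \<rho>0 z] that R1[OF \<rho>0(1)] \<rho>0(2)
          by (metis not_less zero_less_one)
      qed (fact w)
      thus ?thesis unfolding w_def using z \<rho>0(1) R(2) by (auto simp: moebius_act_adj)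
    qed
    thus ?thesis by (rule that)
  next
    case True
    then obtain z0 where z0: "Im z0 > 0" "norm (g z0) > C" by blast
    have "eventually (\<lambda>z. \<forall>\<rho>\<in>R. norm (g (moebius_act \<rho> z)) < norm (g z0)) i_infinity"
    proof (intro eventually_ball_finite R(1) ballI)
      fix \<rho> assume \<rho>: "\<rho> \<in> R"
      show "eventually (\<lambda>z. norm (g (moebius_act \<rho> z)) < norm (g z0)) i_infinity"
        using order_tendstoD(2)[OF tendsto_norm[OF L[OF \<rho>]]] C[OF \<rho>] z0(2) by simp
    qed
    then obtain Y where Y: "\<And>z \<rho>. Im z > Y \<Longrightarrow> \<rho> \<in> R \<Longrightarrow> norm (g (moebius_act \<rho> z)) < norm (g z0)"
      by (auto simp: eventually_i_infinity)
    \<comment> \<open>The reduction strip truncated at height \<open>Y\<close>: above it every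
      \<open>g (moebius_act \<rho> z)\<close> is smaller than \<open>g z0\<close> in
      modulus.\<close>
    define K where "K = cbox (Complex (- 1 / 2) (1 / 2)) (Complex (1 / 2) Y)"
    have K_iff: "w \<in> K \<longleftrightarrow> \<bar>Re w\<bar> \<le> 1 / 2 \<and> 1 / 2 \<le> Im w \<and> Im w \<le> Y" for w
      by (auto simp: K_def in_cbox_complex_iff abs_le_iff)
    have red: "norm (g z) < norm (g z0) \<or>
        (\<exists>\<rho>\<in>R. \<exists>w\<in>K. norm (g z) = norm (g (moebius_act \<rho> w)))" if "Im z > 0" for z
      using reduce[OF that] Y unfolding K_iff Bex_def by (metis not_less)
    have "K \<noteq> {}" using red[OF z0(1)] by auto
    have "\<exists>w\<in>K. \<forall>w'\<in>K. norm (g (moebius_act \<rho> w')) \<le> norm (g (moebius_act \<rho> w))" if \<rho>: "\<rho> \<in> R" for \<rho>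
    proof (rule continuous_attains_sup)
      show "compact K" by (simp add: K_def)
      have "(\<lambda>z. g (moebius_act \<rho> z)) holomorphic_on upper_half_plane"
        using holo R1[OF \<rho>] by (intro holomorphic_on_compose_moebius) auto
      hence "continuous_on upper_half_plane (\<lambda>z. g (moebius_act \<rho> z))"
        by (rule holomorphic_on_imp_continuous_on)
      hence "continuous_on K (\<lambda>z. g (moebius_act \<rho> z))"
        by (rule continuous_on_subset) (auto simp: K_iff upper_half_plane_def)
      thus "continuous_on K (\<lambda>w. norm (g (moebius_act \<rho> w)))" by (rule continuous_on_norm)
    qed (fact \<open>K \<noteq> {}\<close>)
    then obtain W where W: "\<And>\<rho>. \<rho> \<in> R \<Longrightarrow> W \<rho> \<in> K"
      "\<And>\<rho> w. \<rho> \<in> R \<Longrightarrow> w \<in> K \<Longrightarrow> norm (g (moebius_act \<rho> w)) \<le> norm (g (moebius_act \<rho> (W \<rho>)))"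
      by metis
    define M where "M = Max ((\<lambda>\<rho>. norm (g (moebius_act \<rho> (W \<rho>)))) ` R)"
    have "M \<in> (\<lambda>\<rho>. norm (g (moebius_act \<rho> (W \<rho>)))) ` R"
      unfolding M_def using R(1) \<open>R \<noteq> {}\<close> by (intro Max_in) auto
    then obtain \<rho>1 where \<rho>1: "\<rho>1 \<in> R" "norm (g (moebius_act \<rho>1 (W \<rho>1))) = M" by auto
    have M: "norm (g (moebius_act \<rho> w)) \<le> M" if "\<rho> \<in> R" "w \<in> K" for \<rho> w
    proof -
      have "norm (g (moebius_act \<rho> (W \<rho>))) \<le> M" unfolding M_def using that R(1) by (intro Max_ge) auto
      thus ?thesis using W(2)[OF that] by linarith
    qed
    have z0M: "norm (g z0) \<le> M" using red[OF z0(1)] M by auto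
    have bound: "norm (g z) \<le> M" if "Im z > 0" for z
      using red[OF that] M z0M by fastforce
    define \<xi> where "\<xi> = moebius_act \<rho>1 (W \<rho>1)"
    have \<xi>: "Im \<xi> > 0" unfolding \<xi>_def using W(1)[OF \<rho>1(1)] R1[OF \<rho>1(1)]
      by (intro moebius_act_upper) (auto simp: K_iff)
    have "g constant_on upper_half_plane"
      by (rule maximum_modulus_principle[of _ _ upper_half_plane \<xi>])
         (use holo \<xi> bound \<rho>1(2) open_upper_half_plane connected_upper_half_plane
           in \<open>auto simp: \<xi>_def upper_half_plane_def\<close>)
    thus ?thesis using that by (auto simp: constant_on_def upper_half_plane_def)
  qed
qed

subsection \<open>Expansions at infinity\<close>

lemma has_q_expansion_eventually:
  assumes "has_q_expansion h f F"
  shows "fls_conv_radius F > 0" "eventually (\<lambda>z. f z = eval_fls F (nome h z)) i_infinity"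
  using assms by (auto simp: has_q_expansion_def eventually_i_infinity)

lemma has_q_expansionI:
  assumes "fls_conv_radius F > 0" "eventually (\<lambda>z. f z = eval_fls F (nome h z)) i_infinity"
  shows "has_q_expansion h f F"
  using assms by (auto simp: has_q_expansion_def eventually_i_infinity)

lemma has_q_expansion_unique:
  assumes "h > 0" "has_q_expansion h f F" "has_q_expansion h f G"
  shows "F = G"
proof (rule has_laurent_expansion_unique)
  show "eval_fls F has_laurent_expansion F"
    using has_q_expansion_eventually(1)[OF assms(2)] by (rule eval_fls_has_laurent_expansion)
  have "eventually (\<lambda>z. eval_fls G (nome h z) = eval_fls F (nome h z)) i_infinity"
    using has_q_expansion_eventually(2)[OF assms(2)] has_q_expansion_eventually(2)[OF assms(3)]
    by eventually_elim simp
  hence "eventually (\<lambda>w. eval_fls G w = eval_fls F w) (at 0)"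
    by (subst (asm) eventually_nome_iff[OF assms(1)])
  thus "eval_fls F has_laurent_expansion G"
    using has_q_expansion_eventually(1)[OF assms(3)]
    by (auto simp: has_laurent_expansion_def elim: eventually_mono)
qed

lemma q_expansion_eqI: "has_q_expansion 1 f F \<Longrightarrow> q_expansion f = F"
  unfolding q_expansion_def using has_q_expansion_unique[of 1 f] by (intro the_equality) auto

lemma eval_fls_power_series_regular:
  assumes "h > 0" "fls_conv_radius F > 0" "fls_subdegree F \<ge> 0"
    "eventually (\<lambda>z. f z = eval_fls F (nome h z)) i_infinity"
  shows "regular_at_infinity f" "(f \<longlongrightarrow> fls_nth F 0) i_infinity"
proof -
  have an: "eval_fls F analytic_on {0}"
    by (rule analytic_on_subset[OF analytic_on_eval_fls[OF order_refl]]) (use assms(2,3) in \<open>auto simp: zero_ereal_def\<close>)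
  thus "regular_at_infinity f" using assms by (intro regular_at_infinityI)
  have "(eval_fls F \<longlongrightarrow> eval_fls F 0) (at 0)"
    using an analytic_at_imp_isCont isContD by blast
  hence "((\<lambda>z. eval_fls F (nome h z)) \<longlongrightarrow> eval_fls F 0) i_infinity"
    using filterlim_compose filterlim_nome[OF assms(1)] by blast
  thus "(f \<longlongrightarrow> fls_nth F 0) i_infinity"
    using assms(3,4) by (subst tendsto_cong) (auto simp: eval_fls_at_0)
qed

lemma regular_if_holomorphic_at_cusp:
  assumes "holomorphic_at_cusp \<gamma> f"
  shows "regular_at_infinity (\<lambda>z. f (moebius_act \<gamma> z))"
  using assms unfolding holomorphic_at_cusp_def
  using eval_fls_power_series_regular(1) has_q_expansion_eventually by metis

lemma nome_1_eq_iff: "nome 1 z = nome 1 w \<longleftrightarrow> (\<exists>k::int. z = w + of_int k)"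
proof -
  have "nome 1 z = nome 1 w \<longleftrightarrow> (\<exists>k. 2 * of_real pi * \<i> * z = 2 * of_real pi * \<i> * w + (of_int (2 * k) * pi) * \<i>)"
    unfolding nome_def of_nat_1 div_by_1 exp_eq ..
  also have "\<dots> \<longleftrightarrow> (\<exists>k::int. 2 * of_real pi * \<i> * z = 2 * of_real pi * \<i> * (w + of_int k))"
    by (simp add: algebra_simps)
  also have "\<dots> \<longleftrightarrow> (\<exists>k::int. z = w + of_int k)" by simp
  finally show ?thesis .
qed

text \<open>The predicate \<open>has_q_expansion\<close> only speaks of large imaginary parts. By
  periodicity \<open>f\<close> descends to a function \<open>\<phi>\<close> on the punctured unit
  disc; as \<open>\<phi>\<close> is holomorphic there, its Laurent series at 0 converges to it on
  the whole disc.\<close>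

lemma periodic_q_expansion_upper_half_plane:
  assumes holo: "f holomorphic_on upper_half_plane"
    and per: "\<And>z. Im z > 0 \<Longrightarrow> f (z + 1) = f z"
    and exp: "has_q_expansion 1 f F"
  shows "fls_conv_radius F \<ge> 1" "Im z > 0 \<Longrightarrow> f z = eval_fls F (nome 1 z)"
proof -
  have Tn: "f (z + of_nat n) = f z" if "Im z > 0" for n z
    using that
  proof (induction n)
    case (Suc n)
    thus ?case using per[of "z + of_nat n"] by (simp add: algebra_simps)
  qed auto
  have Tk: "f (z + of_int k) = f z" if "Im z > 0" for k z
  proof (cases k rule: int_cases2)
    case (nonneg n) thus ?thesis using Tn[OF that, of n] by simp
  next
    case (nonpos n) thus ?thesis using Tn[of "z - of_nat n" n] that by simp
  qed
  define \<phi> where "\<phi> = (\<lambda>w. f (Ln w / (2 * of_real pi * \<i>)))"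
  have Im_pos: "Im z > 0" if "norm (nome 1 z) < 1" for z
    using that by (simp add: norm_nome zero_less_mult_iff)
  have \<phi>_nome: "\<phi> (nome 1 z) = f z" if "Im z > 0" for z
  proof -
    define w where "w = Ln (nome 1 z) / (2 * of_real pi * \<i>)"
    have "nome 1 w = exp (2 * of_real pi * \<i> * w)" by (simp add: nome_def)
    also have "\<dots> = exp (Ln (nome 1 z))" by (simp add: w_def)
    also have "\<dots> = nome 1 z" by simp
    finally have "nome 1 w = nome 1 z" .
    then obtain k where "w = z + of_int k" unfolding nome_1_eq_iff by auto
    moreover have "\<phi> (nome 1 z) = f w" by (simp add: \<phi>_def w_def)
    ultimately show ?thesis using Tk[OF that, of k] by simp
  qed
  have "\<phi> holomorphic_on (ball 0 1 - {0})"
    unfolding holomorphic_on_def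
  proof
    fix w0 :: complex assume w0: "w0 \<in> ball 0 1 - {0}"
    then obtain z0 where z0: "w0 = nome 1 z0" using nome_surj[of 1 w0] by auto
    have Im_z0: "Im z0 > 0" using w0 z0 by (intro Im_pos) auto
    \<comment> \<open>The principal branch in \<open>\<phi>\<close> jumps across the negative axis.
      Near \<open>w0\<close> it is replaced by a branch of the logarithm centred at
      \<open>w0\<close>; periodicity of \<open>f\<close> makes the two agree after composition with
      \<open>f\<close>.\<close>
    define \<psi> where "\<psi> = (\<lambda>w. z0 + Ln (w / w0) / (2 * of_real pi * \<i>))"
    have nome_\<psi>: "nome 1 (\<psi> w) = w" if "w \<noteq> 0" for w
    proof -
      have "nome 1 (\<psi> w) = nome 1 z0 * exp (Ln (w / w0))"
        unfolding \<psi>_def nome_add by (simp add: nome_def)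
      also have "\<dots> = w" using that w0 z0 by simp
      finally show ?thesis .
    qed
    have "\<psi> analytic_on {w0}" unfolding \<psi>_def using w0 by (intro analytic_intros) auto
    moreover have "f analytic_on {\<psi> w0}"
      using holo open_upper_half_plane Im_z0 w0 unfolding \<psi>_def
      by (auto simp: analytic_at upper_half_plane_def)
    ultimately have "(\<lambda>w. f (\<psi> w)) analytic_on {w0}"
      using analytic_on_compose[of \<psi> "{w0}" f] by (simp add: o_def)
    hence "(\<lambda>w. f (\<psi> w)) field_differentiable at w0"
      by (simp add: analytic_at_imp_isCont analytic_on_imp_differentiable_at)
    moreover have "eventually (\<lambda>w. f (\<psi> w) = \<phi> w) (nhds w0)"
    proof -
      have "eventually (\<lambda>w. w \<in> ball 0 1 - {0}) (nhds w0)"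
        using w0 by (intro eventually_nhds_in_open) auto
      thus ?thesis
      proof eventually_elim
        case (elim w)
        have "Im (\<psi> w) > 0" using nome_\<psi>[of w] elim by (intro Im_pos) auto
        thus ?case using \<phi>_nome[of "\<psi> w"] nome_\<psi>[of w] elim by simp
      qed
    qed
    ultimately have "\<phi> field_differentiable at w0"
      unfolding field_differentiable_def using DERIV_cong_ev[OF refl _ refl] by metis
    thus "\<phi> field_differentiable at w0 within ball 0 1 - {0}"
      by (rule field_differentiable_at_within)
  qed
  hence holo: "\<phi> holomorphic_on eball 0 1 - {0}" by (simp add: eball_def one_ereal_def ball_def)
  have "eventually (\<lambda>z. eval_fls F (nome 1 z) = \<phi> (nome 1 z)) i_infinity"
    using has_q_expansion_eventually(2)[OF exp] eventually_Im_gt_i_infinity[of 0]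
    by eventually_elim (use \<phi>_nome in metis)
  hence "eventually (\<lambda>w. eval_fls F w = \<phi> w) (at 0)"
    by (subst (asm) eventually_nome_iff) auto
  hence lau: "\<phi> has_laurent_expansion F"
    using has_q_expansion_eventually(1)[OF exp] by (auto simp: has_laurent_expansion_def)
  show "fls_conv_radius F \<ge> 1" by (rule fls_conv_radius_ge[OF lau holo])
  show "f z = eval_fls F (nome 1 z)" if "Im z > 0"
    using eval_fls_eqI[OF lau holo, of "nome 1 z"] \<phi>_nome[OF that] nome_1_lt_1[OF that]
    by (simp add: one_ereal_def)
qed

text \<open>The unordered sum over all integers is the form in which coefficients can be averaged
  over \<open>b\<close> and reindexed by multiples.\<close>

lemma has_sum_eval_fls:
  fixes F :: "complex fls"
  assumes "ereal (norm q) < fls_conv_radius F" "q \<noteq> 0"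
  shows "((\<lambda>n. fls_nth F n * q powi n) has_sum eval_fls F q) (UNIV :: int set)"
proof -
  define d where "d = fls_subdegree F"
  have "summable (\<lambda>n. norm (q powi d) * norm (fls_nth F (int n + d) * q ^ n))"
    using norm_summable_fls'[OF assms(1)] unfolding d_def by (rule summable_mult)
  moreover have "norm (q powi d) * norm (fls_nth F (int n + d) * q ^ n) =
      norm (fls_nth F (int n + d) * q powi (int n + d))" for n
    using assms(2) by (simp add: norm_mult power_int_add mult_ac)
  ultimately have "summable (\<lambda>n. norm (fls_nth F (int n + d) * q powi (int n + d)))" by simp
  hence "((\<lambda>n. fls_nth F (int n + d) * q powi (int n + d)) has_sum eval_fls F q) UNIV"
    using sums_eval_fls[of q F] assms unfolding d_def
    by (intro norm_summable_imp_has_sum) auto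
  also have "?this \<longleftrightarrow> ((\<lambda>n. fls_nth F n * q powi n) has_sum eval_fls F q) {d..}"
    by (rule has_sum_reindex_bij_witness[of _ "\<lambda>n. nat (n - d)" "\<lambda>n. int n + d"]) auto
  also have "\<dots> \<longleftrightarrow> ((\<lambda>n. fls_nth F n * q powi n) has_sum eval_fls F q) UNIV"
    by (rule has_sum_cong_neutral) (auto simp: d_def)
  finally show ?thesis .
qed

lemma equals_q_seriesI:
  assumes "\<And>z. Im z > 0 \<Longrightarrow> ((\<lambda>n. fls_nth F n * nome 1 z powi n) has_sum f z) (UNIV :: int set)"
  shows "equals_q_series f F"
proof -
  have summ: "summable (\<lambda>n. fls_nth F (int n + d) * nome 1 z powi (int n + d))"
    and sums: "d \<le> fls_subdegree F \<Longrightarrow> (\<lambda>n. fls_nth F (int n + d) * nome 1 z powi (int n + d)) sums f z"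
    if z: "Im z > 0" for z d
  proof -
    have "(\<lambda>n. fls_nth F n * nome 1 z powi n) summable_on {d..}"
      using assms[OF z] has_sum_imp_summable summable_on_subset by blast
    also have "?this \<longleftrightarrow> (\<lambda>n. fls_nth F (int n + d) * nome 1 z powi (int n + d)) summable_on UNIV"
      by (rule summable_on_reindex_bij_witness[of _ "\<lambda>n. int n + d" "\<lambda>n. nat (n - d)"]) auto
    finally show "summable (\<lambda>n. fls_nth F (int n + d) * nome 1 z powi (int n + d))"
      by (rule summable_on_imp_summable)
    assume d: "d \<le> fls_subdegree F"
    have "((\<lambda>n. fls_nth F n * nome 1 z powi n) has_sum f z) {d..} \<longleftrightarrow>
        ((\<lambda>n. fls_nth F n * nome 1 z powi n) has_sum f z) UNIV"
      by (rule has_sum_cong_neutral) (use d in auto)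
    hence "((\<lambda>n. fls_nth F n * nome 1 z powi n) has_sum f z) {d..}" using assms[OF z] by simp
    also have "?this \<longleftrightarrow> ((\<lambda>n. fls_nth F (int n + d) * nome 1 z powi (int n + d)) has_sum f z) UNIV"
      by (rule has_sum_reindex_bij_witness[of _ "\<lambda>n. int n + d" "\<lambda>n. nat (n - d)"]) auto
    finally show "(\<lambda>n. fls_nth F (int n + d) * nome 1 z powi (int n + d)) sums f z"
      by (rule has_sum_imp_sums)
  qed
  have "conv_radius (\<lambda>n. fls_nth F (int n)) \<ge> 1"
  proof (rule conv_radius_geI_ex)
    fix r :: real assume r: "0 < r" "ereal r < 1"
    obtain z where z: "of_real r = nome 1 z" using nome_surj[of 1 "of_real r"] r by auto
    have "Im z > 0"
      using arg_cong[OF z, of norm] r by (simp add: norm_nome one_ereal_def zero_less_mult_iff)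
    from summ[OF this, of 0] have "summable (\<lambda>n. fls_nth F (int n) * of_real r ^ n)"
      unfolding z by simp
    thus "\<exists>z. norm z = r \<and> summable (\<lambda>n. fls_nth F (int n) * z ^ n)"
      using r by (intro exI[of _ "of_real r"]) simp
  qed
  hence "fls_conv_radius F \<ge> 1"
    by (simp add: fls_conv_radius_def fps_conv_radius_def fls_regpart_def)
  moreover have "f z = eval_fls F (nome 1 z)" if "Im z > 0" for z
    using eval_fls_eq[OF order_refl _ sums[OF that order_refl]] by simp
  ultimately show ?thesis by (simp add: equals_q_series_def upper_half_plane_def)
qed

subsection \<open>Properties of Hauptmoduln\<close>

lemma hauptmodul_invariant:
  "hauptmodul M f \<Longrightarrow> \<gamma> \<in> Gamma0 M \<Longrightarrow> Im z > 0 \<Longrightarrow> f (moebius_act \<gamma> z) = f z"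
  by (auto simp: hauptmodul_def modular_function_def upper_half_plane_def)

lemma hauptmodul_holomorphic: "hauptmodul M f \<Longrightarrow> f holomorphic_on upper_half_plane"
  by (simp add: hauptmodul_def)

lemma hauptmodul_expansion:
  assumes "hauptmodul M f"
  defines "F \<equiv> q_expansion f"
  shows "has_q_expansion 1 f F" "fls_subdegree F = -1" "fls_nth F (-1) = 1"
    "fls_conv_radius F \<ge> 1" "Im z > 0 \<Longrightarrow> f z = eval_fls F (nome 1 z)"
proof -
  obtain G where "has_q_expansion 1 f G" "fls_subdegree G = -1 \<and> fls_nth G (-1) = 1"
    using assms(1) by (auto simp: hauptmodul_def)
  thus F: "has_q_expansion 1 f F" "fls_subdegree F = -1" "fls_nth F (-1) = 1"
    using q_expansion_eqI[of f G] by (simp_all add: F_def)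
  have T: "f (z + 1) = f z" if "Im z > 0" for z
    using hauptmodul_invariant[OF assms(1), of "(1, 1, 0, 1)" z] that
    by (simp add: Gamma0_def SL2Z_def)
  show "fls_conv_radius F \<ge> 1" "Im z > 0 \<Longrightarrow> f z = eval_fls F (nome 1 z)"
    using periodic_q_expansion_upper_half_plane[OF hauptmodul_holomorphic[OF assms(1)] T F(1)] by auto
qed

lemma normalized_hauptmodul_nth_0:
  assumes "normalized_hauptmodul M f"
  shows "fls_nth (q_expansion f) 0 = 0"
  using assms q_expansion_eqI by (auto simp: normalized_hauptmodul_def)

lemma hauptmodul_minus_pole:
  assumes "hauptmodul M f"
  defines "a \<equiv> fls_nth (q_expansion f) 0"
  shows "regular_at_infinity (\<lambda>z. f z - inverse (nome 1 z))"
    "((\<lambda>z. f z - inverse (nome 1 z)) \<longlongrightarrow> a) i_infinity"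
proof -
  define F where "F = q_expansion f"
  note F = hauptmodul_expansion[OF assms(1), folded F_def]
  define G where "G = F - fls_X_inv"
  have r: "fls_conv_radius G \<ge> 1"
    unfolding G_def using F(4) by (intro fls_conv_radius_diff_ge) auto
  have "fls_nth G n = 0" if "n < 0" for n
    using that F(2,3) by (cases "n = -1") (auto simp: G_def)
  hence sub: "fls_subdegree G \<ge> 0"
    by (cases "G = 0") (auto intro!: fls_subdegree_geI)
  have ev: "eventually (\<lambda>z. f z - inverse (nome 1 z) = eval_fls G (nome 1 z)) i_infinity"
    using eventually_Im_gt_i_infinity[of 0]
  proof eventually_elim
    case (elim z)
    have "ereal (norm (nome 1 z)) < 1" using nome_1_lt_1[OF elim] by (simp add: one_ereal_def)
    hence "ereal (norm (nome 1 z)) < fls_conv_radius F" using F(4) by (rule less_le_trans)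
    hence "eval_fls G (nome 1 z) = eval_fls F (nome 1 z) - eval_fls fls_X_inv (nome 1 z)"
      unfolding G_def by (intro eval_fls_diff) auto
    also have "eval_fls fls_X_inv (nome 1 z) = inverse (nome 1 z)"
      by (simp add: fls_X_inv_conv_shift_1 eval_fls_shift)
    finally show ?case using F(5)[OF elim] by simp
  qed
  have "fls_conv_radius G > 0" using r by (rule less_le_trans[rotated]) simp
  moreover have "fls_nth G 0 = a" by (simp add: G_def a_def F_def)
  ultimately show "regular_at_infinity (\<lambda>z. f z - inverse (nome 1 z))"
    "((\<lambda>z. f z - inverse (nome 1 z)) \<longlongrightarrow> a) i_infinity"
    using eval_fls_power_series_regular[OF _ _ sub ev] by auto
qed

text \<open>If \<open>a/c\<close> is equivalent to infinity, then \<open>a c' = a' c\<close> with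
  \<open>M\<close> dividing \<open>c'\<close> and coprime to \<open>a'\<close>, whence
  \<open>M\<close> divides \<open>c\<close>. Divisibility of the lower left entry thus decides the
  type of the cusp.\<close>

lemma hauptmodul_regular_at_other_cusps:
  assumes "hauptmodul M f" "(a, b, c, d) \<in> SL2Z" "\<not> int M dvd c"
  shows "regular_at_infinity (\<lambda>z. f (moebius_act (a, b, c, d) z))"
proof -
  have "\<not> cusp_equiv_infinity M (a, b, c, d)"
  proof
    assume "cusp_equiv_infinity M (a, b, c, d)"
    then obtain a' b' c' d' where *: "(a', b', c', d') \<in> Gamma0 M" "a * c' = a' * c"
      by (auto simp: cusp_equiv_infinity_def)
    have "int M dvd a * c'" using *(1) by (auto simp: Gamma0_def)
    hence "int M dvd a' * c" by (simp add: *(2))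
    moreover have "coprime (int M) a'"
    proof (rule coprimeI)
      fix l assume "l dvd int M" "l dvd a'"
      moreover from this have "l dvd c'" using *(1) by (auto simp: Gamma0_def intro: dvd_trans)
      ultimately have "l dvd a' * d' - b' * c'" by (intro dvd_diff dvd_mult2 dvd_mult)
      thus "is_unit l" using *(1) by (simp add: Gamma0_def SL2Z_def)
    qed
    ultimately have "int M dvd c" by (simp add: coprime_dvd_mult_right_iff)
    with assms(3) show False by simp
  qed
  thus ?thesis using assms(1,2) regular_if_holomorphic_at_cusp by (auto simp: hauptmodul_def)
qed

subsection \<open>Hermite normal forms\<close>

text \<open>The triple stands for the matrix with rows \<open>(a, b)\<close> and
  \<open>(0, e)\<close>. For positive \<open>n\<close> these represent the cosets
  \<open>SL2Z A\<close> of integer matrices of determinant \<open>n\<close>.\<close>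

definition hermite :: "nat \<Rightarrow> (nat \<times> nat \<times> nat) set" where
  "hermite n = {(a, b, e). a * e = n \<and> b < e}"

fun hmat :: "nat \<times> nat \<times> nat \<Rightarrow> mat2" where
  "hmat (a, b, e) = (int a, int b, 0, int e)"

lemma moebius_act_hmat: "moebius_act (hmat (a, b, e)) z = (of_nat a * z + of_nat b) / of_nat e"
  by simp

text \<open>The first column is divided by its gcd \<open>g\<close>. Bezout coefficients
  \<open>u\<close>, \<open>v\<close> complete \<open>(p', r')\<close> to a unimodular matrix, whose
  second column is then shifted by \<open>k\<close> times the first so that \<open>b\<close> becomes
  a residue modulo \<open>e\<close>.\<close>

lemma hermite_decomposition:
  assumes det: "mat_det A = int n" and n: "n > 0"
  obtains \<gamma> K where "\<gamma> \<in> SL2Z" "K \<in> hermite n" "A = mat_mul \<gamma> (hmat K)"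
proof -
  obtain p q r s where A: "A = (p, q, r, s)" by (cases A) auto
  define g where "g = gcd p r"
  have pr: "p \<noteq> 0 \<or> r \<noteq> 0" using det n by (auto simp: A)
  hence g: "g > 0" by (simp add: g_def)
  obtain u v where uv: "u * p + v * r = g" using bezout_int[of p r] by (auto simp: g_def)
  define p' r' where "p' = p div g" and "r' = r div g"
  have p': "p = p' * g" and r': "r = r' * g" by (simp_all add: p'_def r'_def g_def)
  have "(u * p' + v * r') * g = 1 * g" using uv by (simp add: p' r' algebra_simps)
  hence uv': "u * p' + v * r' = 1" using g by simp
  define e where "e = p' * s - r' * q"
  have ge: "g * e = int n" using det by (simp add: A e_def p' r' algebra_simps)
  hence e: "e > 0" using g n by (metis of_nat_0_less_iff zero_less_mult_pos)
  define k where "k = (u * q + v * s) div e"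
  define b where "b = (u * q + v * s) mod e"
  have kb: "u * q + v * s = k * e + b" by (simp add: k_def b_def)
  have b: "0 \<le> b" "b < e" using e by (simp_all add: b_def)
  define \<gamma> :: mat2 where "\<gamma> = (p', p' * k - v, r', r' * k + u)"
  have "mat_det \<gamma> = u * p' + v * r'" by (simp add: \<gamma>_def algebra_simps)
  hence "\<gamma> \<in> SL2Z" using uv' by (simp add: SL2Z_iff)
  moreover have "(nat g, nat b, nat e) \<in> hermite n"
    using g e b ge by (auto simp: hermite_def nat_mult_distrib[symmetric])
  moreover have "A = mat_mul \<gamma> (hmat (nat g, nat b, nat e))"
  proof -
    have "p' * b + (p' * k - v) * e = p' * (u * q + v * s) - v * e"
      unfolding kb by (simp add: algebra_simps)
    also have "\<dots> = (u * p' + v * r') * q" by (simp add: e_def algebra_simps)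
    finally have 1: "p' * b + (p' * k - v) * e = q" using uv' by simp
    have "r' * b + (r' * k + u) * e = r' * (u * q + v * s) + u * e"
      unfolding kb by (simp add: algebra_simps)
    also have "\<dots> = (u * p' + v * r') * s" by (simp add: e_def algebra_simps)
    finally have 2: "r' * b + (r' * k + u) * e = s" using uv' by simp
    show ?thesis using g e b 1 2 by (simp add: A \<gamma>_def p'[symmetric] r'[symmetric])
  qed
  ultimately show ?thesis by (rule that)
qed

lemma hermite_unique:
  assumes "\<gamma> \<in> SL2Z" "mat_mul \<gamma> (hmat K) = hmat L" "K \<in> hermite n" "L \<in> hermite n" "n > 0"
  shows "K = L"
proof -
  obtain a b e where K: "K = (a, b, e)" by (cases K) auto
  obtain a' b' e' where L: "L = (a', b', e')" by (cases L) auto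
  obtain p q r s where \<gamma>: "\<gamma> = (p, q, r, s)" by (cases \<gamma>) auto
  have pos: "a > 0" "e > 0" "a' > 0" "e' > 0"
    using assms(3-5) by (auto simp: hermite_def K L intro!: Nat.gr0I)
  have eqs: "p * int a = int a'" "p * int b + q * int e = int b'" "r * int a = 0"
      "r * int b + s * int e = int e'"
    using assms(2) by (auto simp: K L \<gamma>)
  have r: "r = 0" using eqs(3) pos by simp
  have "p * s = 1" using assms(1) by (simp add: \<gamma> SL2Z_iff r)
  moreover have "p > 0" using eqs(1) pos by (metis of_nat_0_less_iff zero_less_mult_pos2)
  ultimately have ps: "p = 1" "s = 1" by (auto simp: zmult_eq_1_iff)
  have ee: "e = e'" and aa: "a = a'" using eqs ps r by auto
  have bq: "int b + q * int e = int b'" using eqs(2) ps by simp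
  have "b < e" "b' < e" using assms(3,4) by (auto simp: hermite_def K L ee)
  hence "int b = (int b + q * int e) mod int e" "int b' = int b' mod int e" by simp_all
  hence "b = b'" using bq by simp
  thus ?thesis by (simp add: K L ee aa)
qed

lemma hermite_subset: "n > 0 \<Longrightarrow> hermite n \<subseteq> {..n} \<times> {..n} \<times> {..n}"
proof
  fix K assume "n > 0" "K \<in> hermite n"
  moreover obtain a b e where K: "K = (a, b, e)" by (cases K) auto
  ultimately have *: "a * e = n" "b < e" "a > 0" "e > 0" by (auto simp: hermite_def intro!: Nat.gr0I)
  have "a * 1 \<le> a * e" "1 * e \<le> a * e" using * by (intro mult_mono; simp)+
  thus "K \<in> {..n} \<times> {..n} \<times> {..n}" using * K by auto
qed

lemma finite_hermite: "n > 0 \<Longrightarrow> finite (hermite n)"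
  by (rule finite_subset[OF hermite_subset]) auto

text \<open>Right multiplication by \<open>\<gamma>\<close> permutes the cosets
  \<open>SL2Z A\<close>. Here \<open>\<tau>\<close> is the permutation of the representatives and
  \<open>\<sigma>\<close> the unimodular correction on the left; injectivity is enough because
  \<open>hermite n\<close> is finite.\<close>

lemma hermite_permutation:
  assumes \<gamma>: "\<gamma> \<in> SL2Z" and n: "n > 0"
  obtains \<tau> \<sigma> where "bij_betw \<tau> (hermite n) (hermite n)" "\<And>K. K \<in> hermite n \<Longrightarrow> \<sigma> K \<in> SL2Z"
    "\<And>K. K \<in> hermite n \<Longrightarrow> mat_mul (hmat K) \<gamma> = mat_mul (\<sigma> K) (hmat (\<tau> K))"
proof -
  have "\<forall>K\<in>hermite n. \<exists>\<sigma> L. \<sigma> \<in> SL2Z \<and> L \<in> hermite n \<and> mat_mul (hmat K) \<gamma> = mat_mul \<sigma> (hmat L)"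
  proof
    fix K assume K: "K \<in> hermite n"
    hence "mat_det (mat_mul (hmat K) \<gamma>) = int n"
      using \<gamma> by (cases K) (auto simp: mat_det_mul SL2Z_iff hermite_def)
    from hermite_decomposition[OF this n]
    show "\<exists>\<sigma> L. \<sigma> \<in> SL2Z \<and> L \<in> hermite n \<and> mat_mul (hmat K) \<gamma> = mat_mul \<sigma> (hmat L)" by metis
  qed
  then obtain \<sigma> \<tau> where *: "\<And>K. K \<in> hermite n \<Longrightarrow> \<sigma> K \<in> SL2Z" "\<And>K. K \<in> hermite n \<Longrightarrow> \<tau> K \<in> hermite n"
    "\<And>K. K \<in> hermite n \<Longrightarrow> mat_mul (hmat K) \<gamma> = mat_mul (\<sigma> K) (hmat (\<tau> K))"
    by metis
  have "inj_on \<tau> (hermite n)"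
  proof (rule inj_onI)
    fix K L assume KL: "K \<in> hermite n" "L \<in> hermite n" "\<tau> K = \<tau> L"
    define \<delta> where "\<delta> = mat_mul (\<sigma> L) (mat_adj (\<sigma> K))"
    have d: "mat_det (\<sigma> K) = 1" "mat_det (\<sigma> L) = 1" "mat_det \<gamma> = 1"
      using *(1) KL \<gamma> by (auto simp: SL2Z_iff)
    have "mat_mul \<delta> (hmat K) = mat_mul \<delta> (mat_mul (mat_mul (hmat K) \<gamma>) (mat_adj \<gamma>))"
      using d by (simp add: mat_mul_assoc mat_adj_SL2Z)
    also have "\<dots> = mat_mul (mat_mul (\<sigma> L) (mat_mul (mat_adj (\<sigma> K)) (\<sigma> K))) (mat_mul (hmat (\<tau> K)) (mat_adj \<gamma>))"
      by (simp add: \<delta>_def *(3)[OF KL(1)] mat_mul_assoc)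
    also have "\<dots> = mat_mul (mat_mul (\<sigma> L) (hmat (\<tau> L))) (mat_adj \<gamma>)"
      using d KL(3) by (simp add: mat_adj_SL2Z mat_mul_assoc)
    also have "\<dots> = hmat L"
      unfolding *(3)[OF KL(2), symmetric] using d by (simp add: mat_mul_assoc mat_adj_SL2Z)
    finally have "mat_mul \<delta> (hmat K) = hmat L" .
    moreover have "\<delta> \<in> SL2Z" using d by (simp add: \<delta>_def SL2Z_iff mat_det_mul)
    ultimately show "K = L" using hermite_unique KL n by blast
  qed
  moreover have "\<tau> ` hermite n \<subseteq> hermite n" using *(2) by blast
  ultimately have "bij_betw \<tau> (hermite n) (hermite n)"
    using finite_hermite[OF n] by (simp add: bij_betw_def endo_inj_surj)
  thus ?thesis using that * by blast
qed

subsection \<open>The replication sum\<close>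

text \<open>The divisor \<open>d\<close> of the theorem is \<open>gcd a N\<close>, and the sum over \<open>b\<close> produces the coefficients of the
  Hecke operator.\<close>

definition replication_sum :: "nat \<Rightarrow> nat \<Rightarrow> (nat \<Rightarrow> complex \<Rightarrow> complex) \<Rightarrow> complex \<Rightarrow> complex" where
  "replication_sum N n J z = (\<Sum>(a, b, e)\<in>hermite n. J (N div gcd a N) (moebius_act (hmat (a, b, e)) z))"

lemma sum_roots_of_unity:
  assumes "e > 0"
  shows "(\<Sum>b<e. nome e (of_int (k * int b))) = (if int e dvd k then of_nat e else 0)"
proof (cases "int e dvd k")
  case True
  then obtain l where k: "k = int e * l" by auto
  have "nome e (of_int (k * int b)) = 1" for b
  proof -
    have "nome e (of_int (k * int b)) = nome 1 (of_int (l * int b))"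
      using assms by (simp add: nome_def k mult_ac)
    thus ?thesis by (simp only: nome_1_of_int)
  qed
  thus ?thesis using True by simp
next
  case False
  define x where "x = nome e (of_int k)"
  have x: "nome e (of_int (k * int b)) = x ^ b" for b
    by (simp add: x_def nome_power mult_ac)
  have "x ^ e = nome 1 (of_int k)"
    unfolding x_def using nome_mult_power[of e 1 "of_int k"] assms by simp
  hence xe: "x ^ e = 1" by (simp only: nome_1_of_int)
  have "x \<noteq> 1"
  proof
    assume "x = 1"
    hence "nome 1 (of_int k / of_nat e) = nome 1 0" by (simp add: x_def nome_divide) (simp add: nome_def)
    then obtain l :: int where "of_int k / of_nat e = (of_int l :: complex)" unfolding nome_1_eq_iff by auto
    hence "of_int k = (of_int (l * int e) :: complex)" using assms by (simp add: field_simps)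
    hence "k = l * int e" by (simp only: of_int_eq_iff)
    with False show False by simp
  qed
  thus ?thesis unfolding x using False xe by (simp add: sum_gp_strict)
qed

text \<open>Equality of the determinants gives \<open>a r = e' c\<close>, and
  \<open>N div gcd a N\<close> divides \<open>r\<close> exactly if \<open>N\<close> divides
  \<open>a r\<close>, since the gcd is an integer combination of \<open>a\<close> and
  \<open>N\<close>. In the application \<open>r\<close> is the lower left entry of
  \<open>\<sigma> K\<close>; whether \<open>\<sigma> K\<close> belongs to the group of level
  \<open>N div gcd a N\<close> is thereby expressed through \<open>e'\<close> and \<open>c\<close>
  alone.\<close>

lemma replication_level_dvd_iff:
  fixes a e a' e' N :: nat and c r :: int
  assumes "a * e = a' * e'" "a' > 0" "N > 0" "r * int a' = int e * c"
  shows "int (N div gcd a N) dvd r \<longleftrightarrow> int N dvd int e' * c"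
proof -
  define g where "g = gcd a N"
  have g: "g > 0" using assms(3) by (simp add: g_def)
  obtain M where M: "N = M * g" by (metis dvd_mult_div_cancel g_def gcd_dvd2 mult.commute)
  have ar: "int a * r = int e' * c"
  proof -
    have "int a' * (int a * r) = int a * (r * int a')" by (simp add: mult_ac)
    also have "\<dots> = int (a * e) * c" by (simp add: assms(4) mult_ac)
    also have "\<dots> = int a' * (int e' * c)" by (simp add: assms(1) mult_ac)
    finally show ?thesis using assms(2) by simp
  qed
  have "int (N div g) dvd r \<longleftrightarrow> int M dvd r" using g by (simp add: M)
  also have "\<dots> \<longleftrightarrow> int N dvd int g * r" using g by (simp add: M mult.commute)
  also have "\<dots> \<longleftrightarrow> int N dvd int a * r"
  proof
    assume "int N dvd int g * r"
    moreover have "int g * r dvd int a * r" by (intro mult_dvd_mono) (auto simp: g_def)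
    ultimately show "int N dvd int a * r" by (rule dvd_trans)
  next
    assume *: "int N dvd int a * r"
    have "int g = gcd (int a) (int N)" by (simp add: g_def)
    then obtain u v where uv: "u * int a + v * int N = int g" using bezout_int[of "int a" "int N"] by auto
    have "int g * r = u * (int a * r) + int N * (v * r)" by (simp add: uv[symmetric] algebra_simps)
    thus "int N dvd int g * r" using * by simp
  qed
  finally show ?thesis by (simp add: ar g_def)
qed

text \<open>Modulo a divisor of \<open>N\<close>, hence of \<open>c\<close>, the first columns read
  \<open>p a' = a \<alpha>\<close> and \<open>r a' = 0\<close>. The two determinant conditions make
  \<open>p\<close>, \<open>r\<close> and \<open>\<alpha>\<close>, \<open>c\<close> coprime pairs, so
  the divisor divides \<open>a\<close> if and only if it divides \<open>a'\<close>.\<close>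

lemma replication_level_invariant:
  fixes a e a' N :: nat and c r :: int
  assumes "int N dvd c" "\<alpha> * \<delta> - \<beta> * c = 1" "p * s - q * r = 1"
    "p * int a' = int a * \<alpha> + b * c" "r * int a' = int e * c"
  shows "gcd a N = gcd a' N"
proof (rule dvd_antisym)
  define l where "l = int (gcd a N)"
  have l: "l dvd int a" "l dvd c" using assms(1) by (auto simp: l_def intro: dvd_trans[of _ "int N"])
  have "l dvd p * int a'" "l dvd r * int a'"
    using l unfolding assms(4,5) by simp_all
  hence "l dvd s * (p * int a') - q * (r * int a')" by (metis dvd_diff dvd_mult)
  also have "s * (p * int a') - q * (r * int a') = (p * s - q * r) * int a'" by (simp add: algebra_simps)
  finally have "l dvd int a'" using assms(3) by simp
  thus "gcd a N dvd gcd a' N" by (simp add: l_def)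
next
  define l where "l = int (gcd a' N)"
  have l: "l dvd int a'" "l dvd c" using assms(1) by (auto simp: l_def intro: dvd_trans[of _ "int N"])
  have "l dvd p * int a' - b * c" using l by simp
  hence 1: "l dvd int a * \<alpha>" using assms(4) by simp
  have "l dvd int a * \<alpha> * \<delta> - int a * \<beta> * c"
    using 1 l by simp
  also have "int a * \<alpha> * \<delta> - int a * \<beta> * c = int a * (\<alpha> * \<delta> - \<beta> * c)" by (simp add: algebra_simps)
  finally have "l dvd int a" using assms(2) by simp
  thus "gcd a' N dvd gcd a N" by (simp add: l_def)
qed

context
  fixes N n :: nat and J :: "nat \<Rightarrow> complex \<Rightarrow> complex"
  assumes N: "N > 0" and n: "n > 0" and J: "\<And>M. M dvd N \<Longrightarrow> normalized_hauptmodul M (J M)"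
begin

lemma level_hauptmodul: "hauptmodul (N div gcd a N) (J (N div gcd a N))"
proof -
  have "N div gcd a N dvd N" by (metis dvd_div_mult_self dvd_triv_left gcd_dvd2)
  thus ?thesis using J by (auto simp: normalized_hauptmodul_def)
qed

lemma hermite_pos:
  assumes "(a, b, e) \<in> hermite n"
  shows "a > 0" "e > 0" "b < e" "a * e = n"
  using assms n by (auto simp: hermite_def intro!: Nat.gr0I)

lemma holomorphic_replication_sum: "replication_sum N n J holomorphic_on upper_half_plane"
  unfolding replication_sum_def
proof (intro holomorphic_on_sum)
  fix K assume "K \<in> hermite n"
  then obtain a b e where K: "K = (a, b, e)" "(a, b, e) \<in> hermite n" by (cases K) auto
  thus "(\<lambda>z. case K of (a, b, e) \<Rightarrow> J (N div gcd a N) (moebius_act (hmat (a, b, e)) z))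
      holomorphic_on upper_half_plane"
    using holomorphic_on_compose_moebius[OF hauptmodul_holomorphic[OF level_hauptmodul], of "hmat (a, b, e)"]
      hermite_pos[OF K(2)] by simp
qed

text \<open>The first column of the matrix identity is recorded separately, since the level
  arguments use nothing else of it.\<close>

lemma replication_sum_moebius:
  assumes \<gamma>: "(\<alpha>, \<beta>, c, \<delta>) \<in> SL2Z"
  obtains \<tau> \<sigma> where "bij_betw \<tau> (hermite n) (hermite n)" "\<And>K. K \<in> hermite n \<Longrightarrow> \<sigma> K \<in> SL2Z"
    "\<And>a b e p q r s a' b' e'. (a, b, e) \<in> hermite n \<Longrightarrow> \<sigma> (a, b, e) = (p, q, r, s) \<Longrightarrow>
       \<tau> (a, b, e) = (a', b', e') \<Longrightarrow> p * int a' = int a * \<alpha> + int b * c \<and> r * int a' = int e * c"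
    "\<And>z. Im z > 0 \<Longrightarrow> replication_sum N n J (moebius_act (\<alpha>, \<beta>, c, \<delta>) z) =
       (\<Sum>K\<in>hermite n. J (N div gcd (fst K) N) (moebius_act (\<sigma> K) (moebius_act (hmat (\<tau> K)) z)))"
proof -
  obtain \<tau> \<sigma> where *: "bij_betw \<tau> (hermite n) (hermite n)" "\<And>K. K \<in> hermite n \<Longrightarrow> \<sigma> K \<in> SL2Z"
    "\<And>K. K \<in> hermite n \<Longrightarrow> mat_mul (hmat K) (\<alpha>, \<beta>, c, \<delta>) = mat_mul (\<sigma> K) (hmat (\<tau> K))"
    using hermite_permutation[OF \<gamma> n] by blast
  show ?thesis
  proof (rule that[OF *(1,2)])
    fix a b e p q r s a' b' e'
    assume "(a, b, e) \<in> hermite n" "\<sigma> (a, b, e) = (p, q, r, s)" "\<tau> (a, b, e) = (a', b', e')"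
    thus "p * int a' = int a * \<alpha> + int b * c \<and> r * int a' = int e * c"
      using *(3)[of "(a, b, e)"] by auto
  next
    fix z :: complex assume z: "Im z > 0"
    have "moebius_act (hmat K) (moebius_act (\<alpha>, \<beta>, c, \<delta>) z) =
        moebius_act (\<sigma> K) (moebius_act (hmat (\<tau> K)) z)" if K: "K \<in> hermite n" for K
    proof -
      have "\<tau> K \<in> hermite n" using *(1) K by (auto simp: bij_betw_def)
      hence "mat_det (hmat K) > 0" "mat_det (hmat (\<tau> K)) > 0"
        using K hermite_pos by (cases K; cases "\<tau> K"; auto)+
      moreover have "mat_det (\<sigma> K) > 0" using *(2)[OF K] by (simp add: SL2Z_iff)
      moreover have "mat_det (\<alpha>, \<beta>, c, \<delta>) > 0" using \<gamma> by (simp add: SL2Z_def)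
      ultimately show ?thesis
        using z *(3)[OF K] by (simp only: moebius_act_mul[symmetric])
    qed
    thus "replication_sum N n J (moebius_act (\<alpha>, \<beta>, c, \<delta>) z) =
       (\<Sum>K\<in>hermite n. J (N div gcd (fst K) N) (moebius_act (\<sigma> K) (moebius_act (hmat (\<tau> K)) z)))"
      unfolding replication_sum_def by (intro sum.cong) (auto simp del: moebius_act.simps hmat.simps)
  qed (use * in auto)
qed

lemma replication_sum_invariant:
  assumes "\<gamma> \<in> Gamma0 N" "Im z > 0"
  shows "replication_sum N n J (moebius_act \<gamma> z) = replication_sum N n J z"
proof -
  obtain \<alpha> \<beta> c \<delta> where \<gamma>: "\<gamma> = (\<alpha>, \<beta>, c, \<delta>)" by (cases \<gamma>) auto
  have c: "int N dvd c" "(\<alpha>, \<beta>, c, \<delta>) \<in> SL2Z" using assms(1) by (auto simp: \<gamma> Gamma0_def)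
  obtain \<tau> \<sigma> where *: "bij_betw \<tau> (hermite n) (hermite n)" "\<And>K. K \<in> hermite n \<Longrightarrow> \<sigma> K \<in> SL2Z"
    "\<And>a b e p q r s a' b' e'. (a, b, e) \<in> hermite n \<Longrightarrow> \<sigma> (a, b, e) = (p, q, r, s) \<Longrightarrow>
       \<tau> (a, b, e) = (a', b', e') \<Longrightarrow> p * int a' = int a * \<alpha> + int b * c \<and> r * int a' = int e * c"
    "\<And>z. Im z > 0 \<Longrightarrow> replication_sum N n J (moebius_act (\<alpha>, \<beta>, c, \<delta>) z) =
       (\<Sum>K\<in>hermite n. J (N div gcd (fst K) N) (moebius_act (\<sigma> K) (moebius_act (hmat (\<tau> K)) z)))"
    using replication_sum_moebius[OF c(2)] by blast
  have "replication_sum N n J (moebius_act \<gamma> z) =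
      (\<Sum>K\<in>hermite n. J (N div gcd (fst K) N) (moebius_act (\<sigma> K) (moebius_act (hmat (\<tau> K)) z)))"
    unfolding \<gamma> by (rule *(4)[OF assms(2)])
  also have "\<dots> = (\<Sum>K\<in>hermite n. J (N div gcd (fst (\<tau> K)) N) (moebius_act (hmat (\<tau> K)) z))"
  proof (intro sum.cong refl)
    fix K assume K: "K \<in> hermite n"
    obtain a b e where K': "K = (a, b, e)" by (cases K) auto
    obtain a' b' e' where \<tau>K: "\<tau> K = (a', b', e')" by (cases "\<tau> K") auto
    obtain p q r s where \<sigma>K: "\<sigma> K = (p, q, r, s)" by (cases "\<sigma> K") auto
    have \<tau>in: "(a', b', e') \<in> hermite n" using *(1) K by (auto simp: bij_betw_def \<tau>K[symmetric])
    have pr: "p * int a' = int a * \<alpha> + int b * c" "r * int a' = int e * c"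
      using *(3) K K' \<tau>K \<sigma>K by blast+
    have det: "p * s - q * r = 1" "\<alpha> * \<delta> - \<beta> * c = 1"
      using *(2)[OF K] c(2) by (auto simp: \<sigma>K SL2Z_def)
    have "gcd a N = gcd a' N"
      using replication_level_invariant[OF c(1) det(2,1) pr] .
    moreover have "int (N div gcd a N) dvd r"
      using replication_level_dvd_iff[of a e a' e' N r c] hermite_pos[OF \<tau>in] hermite_pos[of a b e] K K' N pr c(1)
      by simp
    hence "\<sigma> K \<in> Gamma0 (N div gcd a N)"
      using *(2)[OF K] by (simp add: \<sigma>K Gamma0_def)
    moreover have "Im (moebius_act (hmat (\<tau> K)) z) > 0"
      using assms(2) hermite_pos[OF \<tau>in] by (intro moebius_act_upper) (auto simp: \<tau>K)
    ultimately show "J (N div gcd (fst K) N) (moebius_act (\<sigma> K) (moebius_act (hmat (\<tau> K)) z)) =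
        J (N div gcd (fst (\<tau> K)) N) (moebius_act (hmat (\<tau> K)) z)"
      using hauptmodul_invariant[OF level_hauptmodul, of "\<sigma> K" a] by (simp add: K' \<tau>K[unfolded K'])
  qed
  also have "\<dots> = (\<Sum>K\<in>hermite n. J (N div gcd (fst K) N) (moebius_act (hmat K) z))"
    using sum.reindex_bij_betw[OF *(1), of "\<lambda>K. J (N div gcd (fst K) N) (moebius_act (hmat K) z)"] .
  also have "\<dots> = replication_sum N n J z"
    unfolding replication_sum_def by (intro sum.cong) (auto simp del: moebius_act.simps hmat.simps)
  finally show ?thesis .
qed

text \<open>A summand has a pole iff \<open>N\<close> divides \<open>e' c\<close>. This condition does not involve \<open>b'\<close>, and it
  forces \<open>e' > 1\<close>; so the polar parts cancel in the sum over \<open>b'\<close>.\<close>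

lemma replication_sum_regular:
  assumes \<gamma>: "(\<alpha>, \<beta>, c, \<delta>) \<in> SL2Z" and c: "\<not> int N dvd c"
  shows "regular_at_infinity (\<lambda>z. replication_sum N n J (moebius_act (\<alpha>, \<beta>, c, \<delta>) z))"
proof -
  obtain \<tau> \<sigma> where *: "bij_betw \<tau> (hermite n) (hermite n)" "\<And>K. K \<in> hermite n \<Longrightarrow> \<sigma> K \<in> SL2Z"
    "\<And>a b e p q r s a' b' e'. (a, b, e) \<in> hermite n \<Longrightarrow> \<sigma> (a, b, e) = (p, q, r, s) \<Longrightarrow>
       \<tau> (a, b, e) = (a', b', e') \<Longrightarrow> p * int a' = int a * \<alpha> + int b * c \<and> r * int a' = int e * c"
    "\<And>z. Im z > 0 \<Longrightarrow> replication_sum N n J (moebius_act (\<alpha>, \<beta>, c, \<delta>) z) =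
       (\<Sum>K\<in>hermite n. J (N div gcd (fst K) N) (moebius_act (\<sigma> K) (moebius_act (hmat (\<tau> K)) z)))"
    using replication_sum_moebius[OF \<gamma>] by blast
  \<comment> \<open>The polar part is attached to the permuted triple \<open>\<tau> K\<close>, so
    that after reindexing by \<open>\<tau>\<close> the last matrix index runs through a complete
    residue system modulo \<open>e\<close>.\<close>
  define pole where "pole = (\<lambda>K z. case K of (a, b, e) \<Rightarrow>
      if int N dvd int e * c then inverse (nome 1 (moebius_act (hmat (a, b, e)) z)) else 0)"
  have term_reg: "regular_at_infinity (\<lambda>z. J (N div gcd (fst K) N)
      (moebius_act (\<sigma> K) (moebius_act (hmat (\<tau> K)) z)) - pole (\<tau> K) z)" if K: "K \<in> hermite n" for K
  proof -
    obtain a b e where K': "K = (a, b, e)" by (cases K) auto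
    obtain a' b' e' where \<tau>K: "\<tau> K = (a', b', e')" by (cases "\<tau> K") auto
    obtain p q r s where \<sigma>K: "\<sigma> K = (p, q, r, s)" by (cases "\<sigma> K") auto
    have \<tau>in: "(a', b', e') \<in> hermite n" using *(1) K by (auto simp: bij_betw_def \<tau>K[symmetric])
    have pr: "p * int a' = int a * \<alpha> + int b * c" "r * int a' = int e * c"
      using *(3) K K' \<tau>K \<sigma>K by blast+
    define M where "M = N div gcd a N"
    have hM: "hauptmodul M (J M)" unfolding M_def by (rule level_hauptmodul)
    have iff: "int M dvd r \<longleftrightarrow> int N dvd int e' * c" unfolding M_def
      using replication_level_dvd_iff[of a e a' e' N r c] hermite_pos[OF \<tau>in] hermite_pos[of a b e] K K' N pr
      by simp
    show ?thesis
    proof (cases "int N dvd int e' * c")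
      case False
      have "regular_at_infinity (\<lambda>z. J M (moebius_act (\<sigma> K) z))"
        using hauptmodul_regular_at_other_cusps[OF hM, of p q r s] *(2)[OF K] False iff by (simp add: \<sigma>K)
      from regular_at_infinity_affine[OF this, of a' e' "int b'"] hermite_pos[OF \<tau>in]
      show ?thesis using False by (simp add: K' \<tau>K[unfolded K'] M_def pole_def)
    next
      case True
      have \<sigma>\<Gamma>: "\<sigma> K \<in> Gamma0 M" using *(2)[OF K] True iff by (simp add: \<sigma>K Gamma0_def)
      have "eventually (\<lambda>z. J M (moebius_act (\<sigma> K) z) - inverse (nome 1 z) =
          J M z - inverse (nome 1 z)) i_infinity"
        using eventually_Im_gt_i_infinity[of 0]
        by eventually_elim (simp add: hauptmodul_invariant[OF hM \<sigma>\<Gamma>] del: moebius_act.simps)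
      hence "regular_at_infinity (\<lambda>z. J M (moebius_act (\<sigma> K) z) - inverse (nome 1 z))"
        using hauptmodul_minus_pole(1)[OF hM] by (subst regular_at_infinity_cong)
      from regular_at_infinity_affine[OF this, of a' e' "int b'"] hermite_pos[OF \<tau>in]
      show ?thesis using True by (simp add: K' \<tau>K[unfolded K'] M_def pole_def)
    qed
  qed
  have pole_sum: "(\<Sum>K\<in>hermite n. pole K z) = 0" for z
  proof -
    define D where "D = {(a, e). a * e = n}"
    have herm: "hermite n = (\<lambda>((a, e), b). (a, b, e)) ` (SIGMA x:D. {..<snd x})"
      by (force simp: hermite_def D_def)
    have "finite D"
      by (rule finite_subset[of _ "{..n} \<times> {..n}"]) (use n in \<open>auto simp: D_def\<close>)
    have "(\<Sum>K\<in>hermite n. pole K z) = (\<Sum>((a, e), b)\<in>(SIGMA x:D. {..<snd x}). pole (a, b, e) z)"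
      unfolding herm by (subst sum.reindex) (auto simp: inj_on_def case_prod_unfold)
    also have "\<dots> = (\<Sum>x\<in>D. \<Sum>b<snd x. pole (fst x, b, snd x) z)"
      using \<open>finite D\<close> by (subst sum.Sigma) (auto simp: case_prod_unfold)
    also have "\<dots> = 0"
    proof (rule sum.neutral, rule ballI)
      fix x assume "x \<in> D"
      then obtain a e where x: "x = (a, e)" "a * e = n" by (auto simp: D_def)
      have e: "e > 0" using x n by (auto intro!: Nat.gr0I)
      show "(\<Sum>b<snd x. pole (fst x, b, snd x) z) = 0"
      proof (cases "int N dvd int e * c")
        case True
        have "e \<noteq> 1" using True c by auto
        hence "\<not> int e dvd -1" by auto
        have "pole (a, b, e) z = inverse (nome e z ^ a) * nome e (of_int (-1 * int b))" for b
          using True nome_affine[OF e, of 1 a z "int b"]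
          by (simp add: pole_def nome_uminus)
        hence "(\<Sum>b<e. pole (a, b, e) z) =
            inverse (nome e z ^ a) * (\<Sum>b<e. nome e (of_int (-1 * int b)))"
          by (simp only: sum_distrib_left)
        thus ?thesis using sum_roots_of_unity[OF e, of "-1"] \<open>\<not> int e dvd -1\<close> x by simp
      qed (simp add: x pole_def)
    qed
    finally show ?thesis .
  qed
  have "regular_at_infinity (\<lambda>z. \<Sum>K\<in>hermite n. J (N div gcd (fst K) N)
      (moebius_act (\<sigma> K) (moebius_act (hmat (\<tau> K)) z)) - pole (\<tau> K) z)"
    by (intro regular_at_infinity_sum term_reg)
  also have "?this \<longleftrightarrow> ?thesis"
  proof (rule regular_at_infinity_cong)
    show "eventually (\<lambda>z. (\<Sum>K\<in>hermite n. J (N div gcd (fst K) N)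
        (moebius_act (\<sigma> K) (moebius_act (hmat (\<tau> K)) z)) - pole (\<tau> K) z) =
        replication_sum N n J (moebius_act (\<alpha>, \<beta>, c, \<delta>) z)) i_infinity"
      using eventually_Im_gt_i_infinity[of 0]
    proof eventually_elim
      case (elim z)
      have "(\<Sum>K\<in>hermite n. pole (\<tau> K) z) = 0"
        using sum.reindex_bij_betw[OF *(1), of "\<lambda>K. pole K z"] pole_sum by simp
      thus ?case unfolding *(4)[OF elim] sum_subtractf by simp
    qed
  qed
  finally show ?thesis .
qed

end

subsection \<open>The \<open>q\<close>-expansion of the replication sum\<close>

lemma has_sum_finite_sum:
  fixes f :: "'i \<Rightarrow> 'a \<Rightarrow> 'b :: {topological_comm_monoid_add}"
  assumes "\<And>i. i \<in> I \<Longrightarrow> (f i has_sum s i) A"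
  shows "((\<lambda>x. \<Sum>i\<in>I. f i x) has_sum (\<Sum>i\<in>I. s i)) A"
  using assms by (induction I rule: infinite_finite_induct) (auto intro!: has_sum_add)

lemma sum_hermite:
  assumes "n > 0"
  shows "(\<Sum>K\<in>hermite n. f K) = (\<Sum>a | a dvd n. \<Sum>b<n div a. f (a, b, n div a))"
proof -
  have fin: "finite {a. a dvd n}" using assms by simp
  have "(\<Sum>a | a dvd n. \<Sum>b<n div a. f (a, b, n div a)) =
      (\<Sum>(a, b)\<in>(SIGMA a:{a. a dvd n}. {..<n div a}). f (a, b, n div a))"
    using fin by (subst sum.Sigma) auto
  also have "\<dots> = (\<Sum>K\<in>hermite n. f K)"
    by (rule sum.reindex_bij_witness[of _ "\<lambda>(a, b, e). (a, b)" "\<lambda>(a, b). (a, b, n div a)"])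
       (use assms in \<open>auto simp: hermite_def\<close>)
  finally show ?thesis by simp
qed

lemma nome_1_affine_powi:
  assumes "e > 0"
  shows "nome 1 ((of_nat a * z + of_nat b) / of_nat e) powi m =
    nome e (of_nat a * z) powi m * nome e (of_int (m * int b))"
proof -
  have "nome 1 ((of_nat a * z + of_nat b) / of_nat e) = nome e (of_nat a * z) * nome e (of_nat b)"
    using assms by (simp add: nome_divide nome_add)
  moreover have "nome e (of_nat b) powi m = nome e (of_int (m * int b))"
    by (cases m rule: int_cases2)
       (simp_all add: nome_power power_int_minus nome_uminus[symmetric])
  ultimately show ?thesis by (simp add: power_int_mult_distrib)
qed

lemma nome_powi_multiple:
  assumes "e > 0"
  shows "nome e (of_nat a * z) powi (int e * l) = nome 1 z powi (int a * l)"
proof -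
  have "nome e (of_nat a * z) ^ e = nome 1 (of_nat a * z)"
    using nome_mult_power[of e 1] assms by simp
  thus ?thesis by (simp add: power_int_mult nome_power)
qed

text \<open>Summation over \<open>b\<close> kills every exponent \<open>m\<close> not divisible by
  \<open>e\<close> and multiplies the others by \<open>e\<close>. An exponent \<open>m = e l\<close>
  becomes \<open>a l\<close> in \<open>nome 1 z\<close>, so the result is \<open>e\<close> times the
  series obtained by \<open>U_e\<close> followed by \<open>V_a\<close>.\<close>

lemma has_sum_average:
  assumes F: "\<And>z. Im z > 0 \<Longrightarrow> ((\<lambda>m. fls_nth F m * nome 1 z powi m) has_sum f z) UNIV"
    and a: "a > 0" and e: "e > 0" and z: "Im z > 0"
  shows "((\<lambda>k. (if int a dvd k then of_nat e * fls_nth F (int e * (k div int a)) else 0) * nome 1 z powi k)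
    has_sum (\<Sum>b<e. f (moebius_act (hmat (a, b, e)) z))) UNIV"
proof -
  define w where "w = nome e (of_nat a * z)"
  have "((\<lambda>m. fls_nth F m * (w powi m * nome e (of_int (m * int b))))
      has_sum f (moebius_act (hmat (a, b, e)) z)) UNIV" for b
    using F[of "moebius_act (hmat (a, b, e)) z"] a e z
    unfolding moebius_act_hmat nome_1_affine_powi[OF e] w_def by simp
  hence "((\<lambda>m. \<Sum>b<e. fls_nth F m * (w powi m * nome e (of_int (m * int b))))
      has_sum (\<Sum>b<e. f (moebius_act (hmat (a, b, e)) z))) UNIV"
    by (intro has_sum_finite_sum)
  also have "(\<lambda>m. \<Sum>b<e. fls_nth F m * (w powi m * nome e (of_int (m * int b)))) =
      (\<lambda>m. fls_nth F m * (w powi m * (if int e dvd m then of_nat e else 0)))"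
    by (simp only: sum_distrib_left[symmetric] sum_roots_of_unity[OF e])
  also have "(\<dots> has_sum (\<Sum>b<e. f (moebius_act (hmat (a, b, e)) z))) UNIV \<longleftrightarrow>
      ((\<lambda>m. fls_nth F m * (w powi m * of_nat e)) has_sum (\<Sum>b<e. f (moebius_act (hmat (a, b, e)) z))) {m. int e dvd m}"
    by (rule has_sum_cong_neutral) auto
  also have "\<dots> \<longleftrightarrow> ((\<lambda>k. of_nat e * fls_nth F (int e * (k div int a)) * nome 1 z powi k)
      has_sum (\<Sum>b<e. f (moebius_act (hmat (a, b, e)) z))) {k. int a dvd k}"
    by (rule has_sum_reindex_bij_witness[of _ "\<lambda>k. int e * (k div int a)" "\<lambda>m. int a * (m div int e)"])
       (use a e in \<open>auto simp: w_def nome_powi_multiple\<close>)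
  also have "\<dots> \<longleftrightarrow> ((\<lambda>k. (if int a dvd k then of_nat e * fls_nth F (int e * (k div int a)) else 0) * nome 1 z powi k)
      has_sum (\<Sum>b<e. f (moebius_act (hmat (a, b, e)) z))) UNIV"
    by (rule has_sum_cong_neutral) auto
  finally show ?thesis .
qed

definition replication_series :: "nat \<Rightarrow> nat \<Rightarrow> (nat \<Rightarrow> complex \<Rightarrow> complex) \<Rightarrow> complex fls" where
  "replication_series N n J = (\<Sum>d | d dvd gcd n N. of_nat (n div d) *
     fls_compose_power (hecke_T (N div d) (n div d) (q_expansion (J (N div d)))) d)"

text \<open>The pairs \<open>(d, e)\<close> of the double sum correspond to \<open>a = d e\<close>, where \<open>d = gcd a N\<close>.\<close>

lemma fls_nth_replication_series:
  assumes n: "n > 0" and N: "N > 0"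
  shows "fls_nth (replication_series N n J) k = (\<Sum>a | a dvd n \<and> int a dvd k. of_nat (n div a) *
    fls_nth (q_expansion (J (N div gcd a N))) (int (n div a) * (k div int a)))"
proof -
  define D where "D = {d. d dvd gcd n N \<and> int d dvd k}"
  define E where "E = (\<lambda>d. {e. e dvd n div d \<and> int e dvd k div int d \<and> coprime e (N div d)})"
  define G where "G = (\<lambda>d. (\<Sum>e\<in>E d. fls_nth (q_expansion (J (N div d))) (int (n div d) * (k div int d) div (int e)\<^sup>2) / of_nat e))"
  have finD: "finite D" 
  proof (rule finite_subset)
    show "D \<subseteq> {d. d dvd n}" by (auto simp: D_def)
  qed (use n in simp)
  have div_pos: "n div d > 0" if "d dvd n" for d using that n by (auto elim!: dvdE)
  have finE: "finite (E d)" if "d \<in> D" for d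

  proof (rule finite_subset)
    show "E d \<subseteq> {e. e dvd n div d}" by (auto simp: E_def)
    show "finite {e. e dvd n div d}" using div_pos[of d] that by (simp add: D_def)
  qed
  have "fls_nth (replication_series N n J) k =
      (\<Sum>d | d dvd gcd n N. of_nat (n div d) * (if int d dvd k then
G d else 0))"
    unfolding replication_series_def fls_nth_sum
  proof (intro sum.cong refl, goal_cases)
    case (1 d)
    have "d > 0" "n div d > 0" using 1 n div_pos[of d] by (auto intro!: Nat.gr0I)
    thus ?case by (simp add: fls_mult_of_nat_nth fls_nth_compose_power fls_nth_hecke_T E_def G_def)
  qed
  also have "\<dots> = (\<Sum>d\<in>D. of_nat (n div d) * G d)"
    by (rule sum.mono_neutral_cong_right) (use n in \<open>auto simp: D_def\<close>)
  also have "\<dots> = (\<Sum>(d, e)\<in>(SIGMA d:D. E d). of_nat (n div d) *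
         (fls_nth (q_expansion (J (N div d))) (int (n div d) * (k div int d) div (int e)\<^sup>2) / of_nat e))"
    unfolding G_def sum_distrib_left using finD finE by (subst sum.Sigma) auto
  also have "\<dots> = (\<Sum>a | a dvd n \<and> int a dvd k. of_nat (n div a) *
    fls_nth (q_expansion (J (N div gcd a N))) (int (n div a) * (k div int a)))"
  proof (rule sum.reindex_bij_witness[of _ "\<lambda>a. (gcd a N, a div gcd a N)" "\<lambda>(d, e). d * e"], goal_cases)
    case (1 x)
    then obtain d e where x: "x = (d, e)" "d \<in> D" "e \<in> E d" by auto
    have "d > 0" using x(2) n by (auto simp: D_def intro!: Nat.gr0I)
    obtain M where M: "N = d * M" using x(2) by (auto simp: D_def elim!: dvdE)
    have "coprime e M" using x(3) \<open>d > 0\<close> by (simp add: E_def M)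
    hence "gcd (d * e) N = d" by (simp add: M gcd_mult_distrib_nat[symmetric])
    thus ?case using \<open>d > 0\<close> by (simp add: x)
  next
    case (2 x)
    then obtain d e where x: "x = (d, e)" "d \<in> D" "e \<in> E d" by auto
    have "d > 0" using x(2) n by (auto simp: D_def intro!: Nat.gr0I)
    obtain n' where n': "n = d * n'" using x(2) by (auto simp: D_def elim!: dvdE)
    obtain k' where k': "k = int d * k'" using x(2) by (auto simp: D_def elim!: dvdE)
    show ?case using x(3) \<open>d > 0\<close> by (simp add: x E_def n' k')
  next
    case (3 a)
    have "a > 0" using 3 n by (auto intro!: Nat.gr0I)
    thus ?case by simp
  next
    case (4 a)
    define d where "d = gcd a N"
    have "a > 0" using 4 n by (auto intro!: Nat.gr0I)
    hence d: "d > 0" by (simp add: d_def)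
    obtain e where e: "a = d * e" by (metis d_def dvdE gcd_dvd1)
    obtain M where M: "N = d * M" by (metis d_def dvdE gcd_dvd2)
    have "d * gcd e M = gcd a N" by (simp only: e M gcd_mult_distrib_nat)
    also have "\<dots> = d" by (simp only: d_def)
    finally have "coprime e M" using d by (simp add: coprime_iff_gcd_eq_1)
    obtain n' where n': "n = d * e * n'" using 4 by (auto simp: e elim!: dvdE)
    obtain k' where k': "k = int d * int e * k'" using 4 by (auto simp: e elim!: dvdE)
    have "int d * int e * k' div int d = int e * k'" using d by (simp add: mult.assoc)
    thus ?case using d \<open>coprime e M\<close> unfolding d_def[symmetric]
      by (simp add: D_def E_def e n' k' M mult.assoc)
  next
    case (5 x)
    then obtain d e where x: "x = (d, e)" "d \<in> D" "e \<in> E d" by auto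
    have "d > 0" using x(2) n by (auto simp: D_def intro!: Nat.gr0I)
    obtain M where M: "N = d * M" using x(2) by (auto simp: D_def elim!: dvdE)
    have "coprime e M" using x(3) \<open>d > 0\<close> by (simp add: E_def M)
    hence gcd_eq: "gcd (d * e) N = d" by (simp add: M gcd_mult_distrib_nat[symmetric])
    obtain m where m: "n = d * m" using x(2) by (auto simp: D_def elim!: dvdE)
    obtain l where l: "k = int d * l" using x(2) by (auto simp: D_def elim!: dvdE)
    obtain n' where n': "m = e * n'" using x(3) \<open>d > 0\<close> by (auto simp: E_def m elim!: dvdE)
    obtain k' where k': "l = int e * k'" using x(3) \<open>d > 0\<close> by (auto simp: E_def l elim!: dvdE)
    have "e > 0" using n by (auto simp: m n' intro!: Nat.gr0I)
    have 1: "int (n div d) * (k div int d) div (int e)\<^sup>2 = int n' * k'"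
    proof -
      have "int (n div d) * (k div int d) = (int e)\<^sup>2 * (int n' * k')"
        using \<open>d > 0\<close> by (simp add: m l n' k' power2_eq_square)
      thus ?thesis using \<open>e > 0\<close> by simp
    qed
    have 2: "n div (d * e) = n'" using \<open>d > 0\<close> \<open>e > 0\<close> by (simp add: m n')
    have "k = int (d * e) * k'" by (simp add: l k')
    hence 3: "k div int (d * e) = k'" using \<open>d > 0\<close> \<open>e > 0\<close> by (metis mult_pos_pos nonzero_mult_div_cancel_left of_nat_0_less_iff less_irrefl)
    \<comment> \<open>The denominator \<open>e\<close> of the Hecke operator reduces the weight
      \<open>n div d\<close> to \<open>n'\<close>, which is \<open>n div a\<close> for
      \<open>a = d e\<close>.\<close>
    have 4: "n div d = e * n'" using \<open>d > 0\<close> by (simp add: m n')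
    show ?case unfolding x(1) prod.case gcd_eq 1 2 3 unfolding 4 using \<open>e > 0\<close> by simp
  qed
  finally show ?thesis .
qed

context
  fixes N n :: nat and J :: "nat \<Rightarrow> complex \<Rightarrow> complex"
  assumes N: "N > 0" and n: "n > 0" and J: "\<And>M. M dvd N \<Longrightarrow> normalized_hauptmodul M (J M)"
begin

lemma replication_sum_q_series:
  "equals_q_series (replication_sum N n J) (replication_series N n J)"
proof (rule equals_q_seriesI)
  fix z :: complex assume z: "Im z > 0"
  have dvd_N: "N div gcd a N dvd N" for a by (metis dvd_div_mult_self dvd_triv_left gcd_dvd2)
  define c where "c = (\<lambda>a k. if int a dvd k then of_nat (n div a) *
    fls_nth (q_expansion (J (N div gcd a N))) (int (n div a) * (k div int a)) else 0)"
  have "((\<lambda>k. c a k * nome 1 z powi k) has_sum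
      (\<Sum>b<n div a. J (N div gcd a N) (moebius_act (hmat (a, b, n div a)) z))) UNIV"
    if "a dvd n" for a
    unfolding c_def
  proof (rule has_sum_average[OF _ _ _ z])
    fix w :: complex assume w: "Im w > 0"
    have "hauptmodul (N div gcd a N) (J (N div gcd a N))"
      using J[OF dvd_N] by (simp add: normalized_hauptmodul_def)
    note * = hauptmodul_expansion[OF this]
    have "ereal (norm (nome 1 w)) < fls_conv_radius (q_expansion (J (N div gcd a N)))"
      by (rule less_le_trans[OF _ *(4)]) (use nome_1_lt_1[OF w] in \<open>simp add: one_ereal_def\<close>)
    from has_sum_eval_fls[OF this nome_nonzero]
    show "((\<lambda>m. fls_nth (q_expansion (J (N div gcd a N))) m * nome 1 w powi m)
        has_sum J (N div gcd a N) w) UNIV"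
      unfolding *(5)[OF w] .
  next
    show "a > 0" "n div a > 0" using that n by (auto elim!: dvdE)
  qed
  hence "((\<lambda>k. \<Sum>a | a dvd n. c a k * nome 1 z powi k) has_sum
      (\<Sum>a | a dvd n. \<Sum>b<n div a. J (N div gcd a N) (moebius_act (hmat (a, b, n div a)) z))) UNIV"
    by (intro has_sum_finite_sum) auto
  also have "(\<Sum>a | a dvd n. \<Sum>b<n div a. J (N div gcd a N) (moebius_act (hmat (a, b, n div a)) z)) =
      replication_sum N n J z"
    unfolding replication_sum_def sum_hermite[OF n] by simp
  also have "(\<lambda>k. \<Sum>a | a dvd n. c a k * nome 1 z powi k) =
      (\<lambda>k. fls_nth (replication_series N n J) k * nome 1 z powi k)"
  proof
    fix k
    have "(\<Sum>a | a dvd n. c a k) = (\<Sum>a | a dvd n \<and> int a dvd k. of_nat (n div a) *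
        fls_nth (q_expansion (J (N div gcd a N))) (int (n div a) * (k div int a)))"
      by (rule sum.mono_neutral_cong_right) (use n in \<open>auto simp: c_def\<close>)
    thus "(\<Sum>a | a dvd n. c a k * nome 1 z powi k) =
        fls_nth (replication_series N n J) k * nome 1 z powi k"
      unfolding fls_nth_replication_series[OF n N] sum_distrib_right[symmetric] by simp
  qed
  finally show "((\<lambda>k. fls_nth (replication_series N n J) k * nome 1 z powi k) has_sum
      replication_sum N n J z) UNIV" .
qed

text \<open>For \<open>k \<le> 0\<close> a summand reads the coefficient of index
  \<open>(n div a) * (k div a)\<close>, which is nonpositive and equals -1 only for
  \<open>a = n\<close> and \<open>k = - n\<close>. At index 0 the normalization of the functions
  \<open>J M\<close> gives 0.\<close>

lemma replication_series_nonpos: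
  assumes "k \<le> 0"
  shows "fls_nth (replication_series N n J) k = (if k = - int n then 1 else 0)"
proof -
  have dvd_N: "N div gcd a N dvd N" for a by (metis dvd_div_mult_self dvd_triv_left gcd_dvd2)
  have coeff: "fls_nth (q_expansion (J (N div gcd a N))) m = (if m = -1 then 1 else 0)" if "m \<le> 0" for a m
  proof -
    have nh: "normalized_hauptmodul (N div gcd a N) (J (N div gcd a N))" using J[OF dvd_N] .
    hence "hauptmodul (N div gcd a N) (J (N div gcd a N))" by (simp add: normalized_hauptmodul_def)
    note * = hauptmodul_expansion[OF this] normalized_hauptmodul_nth_0[OF nh]
    show ?thesis
      using *(2,3,6) that by (cases "m = -1"; cases "m = 0") auto
  qed
  have summand: "of_nat (n div a) * fls_nth (q_expansion (J (N div gcd a N))) (int (n div a) * (k div int a)) =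
      (if k = - int n \<and> a = n then 1 else 0)" if a: "a dvd n" "int a dvd k" for a
  proof -
    obtain n' where n': "n = a * n'" using a by auto
    obtain k' where k': "k = int a * k'" using a by auto
    have pos: "a > 0" "n' > 0" using n by (auto simp: n')
    have "k' \<le> 0" using assms pos by (simp add: k' mult_le_0_iff)
    hence "int n' * k' \<le> 0" by (simp add: mult_le_0_iff)
    moreover have "int n' * k' = -1 \<longleftrightarrow> k = - int n \<and> a = n"
    proof
      assume "int n' * k' = -1"
      hence "int n' * (- k') = 1" by simp
      hence "int n' = 1 \<and> - k' = 1" using pos by (subst (asm) pos_zmult_eq_1_iff) auto
      thus "k = - int n \<and> a = n" by (simp add: n' k')
    next
      assume *: "k = - int n \<and> a = n"
      hence "n' = 1" using n' pos by simp
      moreover have "int n * (k' + 1) = 0" using * k' by (auto simp: algebra_simps)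
      hence "k' = -1" using n by simp
      ultimately show "int n' * k' = -1" by simp
    qed
    ultimately show ?thesis using coeff[of "int n' * k'" a] pos by (auto simp: n' k')
  qed
  have "fls_nth (replication_series N n J) k =
      (\<Sum>a | a dvd n \<and> int a dvd k. if k = - int n \<and> a = n then 1 else 0)"
    unfolding fls_nth_replication_series[OF n N] by (intro sum.cong) (auto simp: summand)
  also have "\<dots> = (\<Sum>a | a dvd n \<and> int a dvd k. if a = n then (if k = - int n then 1 else 0) else 0)"
    by (intro sum.cong) auto
  also have "\<dots> = (if k = - int n then 1 else 0)"
    using n by (subst sum.delta) auto
  finally show ?thesis .
qed

end

subsection \<open>Faber polynomials\<close>

context
  fixes F :: "complex fls" and P :: "nat \<Rightarrow> complex poly"
  assumes gen: "generates_polys F P" and sub: "fls_subdegree F = -1" and lead: "fls_nth F (-1) = 1"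
begin

text \<open>The recurrence satisfied by the generated polynomials, with the Laurent series
  \<open>F\<close> put in place of the variable.\<close>

fun faber_series :: "nat \<Rightarrow> complex fls" where
  "faber_series 0 = 1"
| "faber_series (Suc n) = F * faber_series n -
     (\<Sum>i\<le>n. fls_const (fls_nth F (int i)) * faber_series (n - i)) - fls_const (of_nat n * fls_nth F (int n))"

lemma F_decomp: "F = fls_X_inv + fps_to_fls (Abs_fps (\<lambda>i. fls_nth F (int i)))"
proof (rule fls_eqI)
  fix n :: int
  show "fls_nth F n = fls_nth (fls_X_inv + fps_to_fls (Abs_fps (\<lambda>i. fls_nth F (int i)))) n"
    using sub lead by (cases "n < -1"; cases "n = -1") auto
qed

text \<open>Coefficient comparison in \<open>q F' = (x - F) S\<close>, where \<open>S\<close> is the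
  generating series: the exponent -1 yields \<open>P 0\<close>, the exponent \<open>n\<close> yields
  \<open>P (Suc n)\<close>.\<close>

lemma generated_poly_recurrence:
  "P 0 = 1"
  "P (Suc n) = [:0, 1:] * P n - (\<Sum>i\<le>n. smult (fls_nth F (int i)) (P (n - i))) - [:of_nat n * fls_nth F (int n):]"
proof -
  define A where "A = Abs_fps (\<lambda>i. fls_nth F (int i))"
  define S where "S = (\<lambda>x. Abs_fps (\<lambda>\<nu>. poly (P \<nu>) x))"
  \<comment> \<open>Division of Laurent series is total, so the identity can be multiplied out only
    once the denominator is known to be nonzero; its coefficient at exponent -1 is -1 for every
    \<open>x\<close>.\<close>
  have nz: "fls_const x - F \<noteq> 0" for x
  proof
    assume "fls_const x - F = 0"
    hence "fls_nth (fls_const x - F) (-1) = 0" by simp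
    thus False using lead by simp
  qed
  have F: "F = fls_X_inv + fps_to_fls A" unfolding A_def by (rule F_decomp)
  have "fls_X * fls_deriv F = fls_const x * fps_to_fls (S x) - fls_X_inv * fps_to_fls (S x) -
      fps_to_fls (A * S x)" for x
  proof -
    have "fls_X * fls_deriv F = fps_to_fls (S x) * (fls_const x - F)"
      using gen nz[of x] unfolding generates_polys_def S_def by (metis nonzero_divide_eq_eq)
    also have "\<dots> = fls_const x * fps_to_fls (S x) - fls_X_inv * fps_to_fls (S x) - fps_to_fls (A * S x)"
      unfolding fls_times_fps_to_fls by (subst F) (simp only: algebra_simps)
    finally show ?thesis .
  qed
  hence "fls_nth (fls_X * fls_deriv F) k = fls_nth (fls_const x * fps_to_fls (S x) -
      fls_X_inv * fps_to_fls (S x) - fps_to_fls (A * S x)) k" for x k by simp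
  hence eq: "of_int k * fls_nth F k = x * fls_nth (fps_to_fls (S x)) k -
      fls_nth (fps_to_fls (S x)) (k + 1) - fls_nth (fps_to_fls (A * S x)) k" for x k
    unfolding fls_minus_nth fls_X_times_conv_shift fls_X_inv_times_conv_shift by simp
  show "P 0 = 1"
    using eq[of "-1"] lead by (intro poly_ext) (simp add: S_def)
  show "P (Suc n) = [:0, 1:] * P n - (\<Sum>i\<le>n. smult (fls_nth F (int i)) (P (n - i))) -
      [:of_nat n * fls_nth F (int n):]"
  proof (rule poly_ext)
    fix x
    have "nat (int n + 1) = Suc n" by simp
    hence "of_nat n * fls_nth F (int n) = x * poly (P n) x - poly (P (Suc n)) x -
        (\<Sum>i\<le>n. fls_nth F (int i) * poly (P (n - i)) x)"
      using eq[of "int n" x] by (simp add: S_def A_def fps_mult_nth atLeast0AtMost)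
    thus "poly (P (Suc n)) x = poly ([:0, 1:] * P n - (\<Sum>i\<le>n. smult (fls_nth F (int i)) (P (n - i))) -
        [:of_nat n * fls_nth F (int n):]) x"
      by (simp add: poly_sum algebra_simps)
  qed
qed

lemma faber_series_expansion:
  assumes "fls_conv_radius F > 0"
  shows "(\<lambda>w. poly (P n) (eval_fls F w)) has_laurent_expansion faber_series n"
proof (induction n rule: less_induct)
  case (less n)
  show ?case
  proof (cases n)
    case 0
    thus ?thesis by (simp add: generated_poly_recurrence(1))
  next
    case (Suc m)
    have "(\<lambda>w. eval_fls F w * poly (P m) (eval_fls F w) -
        (\<Sum>i\<le>m. fls_nth F (int i) * poly (P (m - i)) (eval_fls F w)) - of_nat m * fls_nth F (int m))
      has_laurent_expansion faber_series (Suc m)"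
      unfolding faber_series.simps
      by (intro laurent_expansion_intros assms less) (auto simp: Suc)
    thus ?thesis unfolding Suc generated_poly_recurrence(2) by (simp add: poly_sum)
  qed
qed

text \<open>\<open>F\<^sup>k F'\<close> is a derivative, hence has no residue.\<close>

lemma faber_series_residue: "fls_nth (faber_series n * F ^ k * fls_deriv F) (-1) = 0"
proof (induction n arbitrary: k rule: less_induct)
  case (less n)
  have pow: "fls_nth (F ^ k * fls_deriv F) (-1) = 0" for k
  proof -
    have "fls_nth (fls_deriv (F ^ Suc k)) (-1) = 0" by (simp only: fls_deriv_nth) simp
    also have "fls_deriv (F ^ Suc k) = of_nat (Suc k) * (F ^ k * fls_deriv F)"
      unfolding fls_deriv_power by (simp only: diff_Suc_1 mult.assoc)
    finally show ?thesis by (simp only: fls_mult_of_nat_nth mult_eq_0_iff of_nat_eq_0_iff nat.distinct simp_thms)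
  qed
  show ?case
  proof (cases n)
    case 0
    thus ?thesis using pow by simp
  next
    case (Suc m)
    have "faber_series n * F ^ k * fls_deriv F = faber_series m * F ^ Suc k * fls_deriv F -
        (\<Sum>i\<le>m. fls_const (fls_nth F (int i)) * (faber_series (m - i) * F ^ k * fls_deriv F)) -
        fls_const (of_nat m * fls_nth F (int m)) * (F ^ k * fls_deriv F)"
      unfolding Suc faber_series.simps by (simp add: algebra_simps sum_distrib_left)
    moreover have "fls_nth (faber_series (m - i) * F ^ k * fls_deriv F) (-1) = 0" for i
      by (rule less) (simp add: Suc)
    moreover have "fls_nth (faber_series m * F ^ Suc k * fls_deriv F) (-1) = 0"
      by (rule less) (simp add: Suc)
    ultimately show ?thesis by (simp add: fls_nth_sum pow del: power_Suc)
  qed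
qed

text \<open>Write \<open>faber_series m = q^-m + R\<close> and \<open>F = q^-1 + A\<close>. The
  product contains \<open>A q^-m\<close>, whose part with nonpositive exponents is removed by the
  subtracted sum. Besides the shifted leading term there remains, at exponent 0, the coefficient of
  \<open>q\<close> in \<open>faber_series m\<close>; the vanishing residue identifies it with
  \<open>m * a m\<close>, which the last term of the recurrence subtracts.\<close>

lemma faber_series_nonpos:
  assumes "k \<le> 0"
  shows "fls_nth (faber_series n) k = (if k = - int n then 1 else 0)"
  using assms
proof (induction n arbitrary: k rule: less_induct)
  case (less n)
  show ?case
  proof (cases n)
    case 0
    thus ?thesis by simp
  next
    case (Suc m)
    define a where "a = (\<lambda>i. fls_nth F (int i))"
    have a_eq: "fls_nth F (int i) = a i" for i by (simp add: a_def)
    define R where "R = Abs_fps (\<lambda>i. if i = 0 then 0 else fls_nth (faber_series m) (int i) - (if m = 0 \<and> i = 0 then 1 else 0))"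
    have IH: "fls_nth (faber_series (m - i)) k = (if k = - int (m - i) then 1 else 0)" if "k \<le> 0" for i k
      by (rule less.IH) (use that Suc in auto)
    have Q: "faber_series m = fls_X_intpow (- int m) + fps_to_fls R"
    proof (rule fls_eqI)
      fix k :: int
      show "fls_nth (faber_series m) k = fls_nth (fls_X_intpow (- int m) + fps_to_fls R) k"
        using IH[of k 0] by (cases "k \<le> 0") (auto simp: R_def)
    qed
    define A where "A = Abs_fps a"
    have F: "F = fls_X_inv + fps_to_fls A" unfolding A_def a_def by (rule F_decomp)
    \<comment> \<open>The residue of \<open>faber_series m * F'\<close> is 0. The part
      \<open>q^-m F'\<close> contributes \<open>m * a m\<close>, and \<open>R F'\<close> contributes
      minus the first coefficient of \<open>R\<close> through the term \<open>- q^-2\<close> of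
      \<open>F'\<close>.\<close>
    have h: "fls_nth (faber_series m) 1 = of_nat m * a m"
    proof -
      have "fls_deriv F = fls_deriv fls_X_inv + fps_to_fls (fps_deriv A)"
        by (subst F) (simp add: fls_deriv_fps_to_fls)
      also have "fls_deriv fls_X_inv = - fls_X_intpow (-2 :: int)"
        by (rule fls_eqI) auto
      finally have F': "fls_deriv F = - fls_X_intpow (-2) + fps_to_fls (fps_deriv A)" .
      have "faber_series m * F ^ 0 * fls_deriv F =
          fls_X_intpow (- int m) * fls_deriv F + fps_to_fls R * fls_deriv F"
        by (subst Q) (simp add: algebra_simps)
      also have "fps_to_fls R * fls_deriv F = fps_to_fls (R * fps_deriv A) - fls_X_intpow (-2) * fps_to_fls R"
        unfolding F' fls_times_fps_to_fls by (simp add: algebra_simps)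
      finally have "fls_nth (fls_X_intpow (- int m) * fls_deriv F + (fps_to_fls (R * fps_deriv A) -
          fls_X_intpow (-2) * fps_to_fls R)) (-1) = 0"
        using faber_series_residue[of m 0] by simp
      hence "of_nat m * a m = fps_nth R 1"
        unfolding fls_X_intpow_times_conv_shift by (simp add: a_def)
      thus ?thesis by (simp add: R_def)
    qed
    have prod: "fls_nth (F * faber_series m) k =
        fls_nth (faber_series m) (k + 1) + (if k + int m \<ge> 0 then a (nat (k + int m)) else 0)"
    proof -
      have "F * faber_series m = fls_X_inv * faber_series m + fps_to_fls A * faber_series m"
        by (subst F) (simp only: ring_distribs)
      also have "fps_to_fls A * faber_series m = fls_X_intpow (- int m) * fps_to_fls A + fps_to_fls (A * R)"
        unfolding fls_times_fps_to_fls by (subst Q) (simp only: ring_distribs mult.commute)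
      finally have "F * faber_series m = fls_X_inv * faber_series m +
          (fls_X_intpow (- int m) * fps_to_fls A + fps_to_fls (A * R))" .
      moreover have "fls_nth (fps_to_fls (A * R)) k = 0"
        using less.prems by (cases "k = 0") (auto simp: R_def)
      ultimately show ?thesis
        unfolding fls_X_inv_times_conv_shift fls_X_intpow_times_conv_shift by (simp add: A_def)
    qed
    have "(\<Sum>i\<le>m. a i * fls_nth (faber_series (m - i)) k) =
        (\<Sum>i\<le>m. if int i = k + int m then a i else 0)"
      using less.prems by (intro sum.cong) (auto simp: IH of_nat_diff)
    also have "\<dots> = (\<Sum>i\<le>m. if i = nat (k + int m) \<and> k + int m \<ge> 0 then a i else 0)"
      by (intro sum.cong) auto
    also have "\<dots> = (if k + int m \<ge> 0 then a (nat (k + int m)) else 0)"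
      using less.prems by (cases "k + int m \<ge> 0") (auto simp: sum.delta')
    finally have "fls_nth (faber_series n) k = fls_nth (faber_series m) (k + 1) -
        (if k = 0 then of_nat m * a m else 0)"
      using prod by (simp add: Suc fls_nth_sum a_eq)
    also have "\<dots> = (if k = - int n then 1 else 0)"
    proof (cases "k = 0")
      case False
      thus ?thesis using IH[of "k + 1" 0] less.prems by (auto simp: Suc)
    qed (simp add: h Suc)
    finally show ?thesis .
  qed
qed

end

subsection \<open>The replication formula for a shifted Hauptmodul\<close>

lemma replication_formula:
  assumes N: "N > 0" and n: "n > 0" and J: "\<And>M. M dvd N \<Longrightarrow> normalized_hauptmodul M (J M)"
    and j: "\<And>z. Im z > 0 \<Longrightarrow> j z = J N z + c"
    and gen: "generates_polys (q_expansion j) P"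
  shows "equals_q_series (\<lambda>z. poly (P n) (j z)) (replication_series N n J)"
proof -
  have hN: "hauptmodul N (J N)" using J[of N] by (simp add: normalized_hauptmodul_def)
  define F0 where "F0 = q_expansion (J N)"
  note F0 = hauptmodul_expansion[OF hN, folded F0_def]
  define F where "F = F0 + fls_const c"
  have rad: "fls_conv_radius F \<ge> 1" unfolding F_def using F0(4) by (intro fls_conv_radius_add_ge) auto
  hence rad0: "fls_conv_radius F > 0" by (rule less_le_trans[rotated]) simp
  have "eventually (\<lambda>z. j z = eval_fls F (nome 1 z)) i_infinity"
    using eventually_Im_gt_i_infinity[of 0]
  proof eventually_elim
    case (elim z)
    have "ereal (norm (nome 1 z)) < 1" using nome_1_lt_1[OF elim] by (simp add: one_ereal_def)
    hence "ereal (norm (nome 1 z)) < fls_conv_radius F0" using F0(4) by (rule less_le_trans)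
    hence "eval_fls F (nome 1 z) = eval_fls F0 (nome 1 z) + eval_fls (fls_const c) (nome 1 z)"
      unfolding F_def by (intro eval_fls_add) auto
    thus ?case using j[OF elim] F0(5)[OF elim] by simp
  qed
  hence F_exp: "has_q_expansion 1 j F" using rad0 by (intro has_q_expansionI)
  hence gen': "generates_polys F P" using gen q_expansion_eqI by simp
  have lead: "fls_nth F (-1) = 1" using F0(3) by (simp add: F_def)
  have sub: "fls_subdegree F = -1"
    using lead F0(2) by (intro fls_subdegree_eqI) (auto simp: F_def)
  define Q where "Q = faber_series F n"
  have "(\<lambda>w. poly (P n) (eval_fls F w)) has_laurent_expansion Q"
    unfolding Q_def by (rule faber_series_expansion[OF gen' sub lead rad0])
  hence Q: "fls_conv_radius Q > 0" "eventually (\<lambda>w. eval_fls Q w = poly (P n) (eval_fls F w)) (at 0)"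
    by (auto simp: has_laurent_expansion_def)
  have Q_ev: "eventually (\<lambda>z. eval_fls Q (nome 1 z) = poly (P n) (j z)) i_infinity"
    using Q(2)[folded eventually_nome_iff[OF zero_less_one]] has_q_expansion_eventually(2)[OF F_exp]
    by eventually_elim simp
  define S where "S = replication_series N n J"
  have S: "fls_conv_radius S \<ge> 1" "\<And>z. Im z > 0 \<Longrightarrow> replication_sum N n J z = eval_fls S (nome 1 z)"
    using replication_sum_q_series[OF N n J] by (auto simp: equals_q_series_def S_def upper_half_plane_def)
  define g where "g = (\<lambda>z. replication_sum N n J z - poly (P n) (J N z + c))"
  have "fls_nth (S - Q) k = 0" if "k \<le> 0" for k
    using faber_series_nonpos[OF gen' sub lead that, of n] replication_series_nonpos[OF N n J that]
    by (simp add: S_def Q_def)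
  hence SQ: "fls_subdegree (S - Q) \<ge> 0" "fls_nth (S - Q) 0 = 0"
    by (cases "S - Q = 0"; auto intro!: fls_subdegree_geI)+
  have rS: "fls_conv_radius S > 0" using S(1) by (rule less_le_trans[rotated]) simp
  have rSQ: "fls_conv_radius (S - Q) > 0"
    using rS Q(1) by (intro less_le_trans[OF _ fls_conv_radius_diff]) auto
  \<comment> \<open>The radius of convergence of \<open>Q\<close> is only known to be positive. A
    small disc is enough, as the expansion of \<open>g\<close> is wanted near infinity only.\<close>
  obtain \<rho> where \<rho>: "\<rho> > 0" "ereal \<rho> < fls_conv_radius Q"
    using ereal_dense2[OF Q(1)] by (auto simp: zero_ereal_def)
  have "eventually (\<lambda>w. w \<in> ball 0 \<rho>) (at (0 :: complex))"
    using \<rho>(1) by (intro eventually_at_in_open') auto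
  hence "eventually (\<lambda>z. nome 1 z \<in> ball 0 \<rho>) i_infinity" by (subst eventually_nome_iff) auto
  hence g_ev: "eventually (\<lambda>z. g z = eval_fls (S - Q) (nome 1 z)) i_infinity"
    using Q_ev eventually_Im_gt_i_infinity[of 0]
  proof eventually_elim
    case (elim z)
    have "ereal (norm (nome 1 z)) < 1" using nome_1_lt_1[OF elim(3)] by (simp add: one_ereal_def)
    hence 1: "ereal (norm (nome 1 z)) < fls_conv_radius S" using S(1) by (rule less_le_trans)
    have 2: "ereal (norm (nome 1 z)) < fls_conv_radius Q"
      using elim(1) by (intro less_trans[OF _ \<rho>(2)]) simp
    show ?case using S(2)[OF elim(3)] elim(2) j[OF elim(3)]
      by (subst eval_fls_diff[OF 1 2]) (auto simp: g_def)
  qed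
  have g_reg: "regular_at_infinity g" and g_lim: "(g \<longlongrightarrow> 0) i_infinity"
    using eval_fls_power_series_regular[OF zero_less_one rSQ SQ(1) g_ev] SQ(2) by simp_all
  have g_inv: "g (moebius_act \<gamma> z) = g z" if "\<gamma> \<in> Gamma0 N" "Im z > 0" for \<gamma> z
    using replication_sum_invariant[OF N n J that] hauptmodul_invariant[OF hN that] by (simp add: g_def)
  have "\<exists>C. \<forall>z. Im z > 0 \<longrightarrow> g z = C"
  proof (rule constant_if_regular_at_cusps[OF N, of g])
    show "g holomorphic_on upper_half_plane"
      unfolding g_def poly_altdef using holomorphic_replication_sum[OF N n J] hauptmodul_holomorphic[OF hN]
      by (intro holomorphic_intros)
  next
    fix \<gamma> assume \<gamma>: "\<gamma> \<in> SL2Z"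
    obtain p q r s where eq: "\<gamma> = (p, q, r, s)" by (cases \<gamma>) auto
    show "regular_at_infinity (\<lambda>z. g (moebius_act \<gamma> z))"
    proof (cases "int N dvd r")
      case True
      have \<gamma>N: "\<gamma> \<in> Gamma0 N" using \<gamma> True by (simp add: eq Gamma0_def)
      have "eventually (\<lambda>z. g (moebius_act \<gamma> z) = g z) i_infinity"
        using eventually_Im_gt_i_infinity[of 0] by eventually_elim (rule g_inv[OF \<gamma>N])
      thus ?thesis using g_reg by (subst regular_at_infinity_cong)
    next
      case False
      show ?thesis unfolding g_def eq
        using replication_sum_regular[OF N n J _ False] hauptmodul_regular_at_other_cusps[OF hN _ False] \<gamma>
        by (intro regular_at_infinity_diff regular_at_infinity_poly regular_at_infinity_add
              regular_at_infinity_const) (auto simp: eq)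
    qed
  next
    fix C assume "\<And>z. Im z > 0 \<Longrightarrow> g z = C"
    thus ?thesis by blast
  qed (simp add: g_inv)
  then obtain C where C: "\<And>z. Im z > 0 \<Longrightarrow> g z = C" by blast
  have "eventually (\<lambda>z. g z = C) i_infinity"
    using eventually_Im_gt_i_infinity[of 0] by eventually_elim (rule C)
  hence "(g \<longlongrightarrow> C) i_infinity" by (rule tendsto_eventually)
  hence "C = 0" using g_lim tendsto_unique[OF i_infinity_neq_bot] by blast
  hence "poly (P n) (j z) = eval_fls S (nome 1 z)" if "Im z > 0" for z
    using C[OF that] S(2)[OF that] j[OF that] by (simp add: g_def)
  thus ?thesis using S(1) by (simp add: equals_q_series_def S_def upper_half_plane_def)
qed

subsection \<open>Partial fractions\<close>

lemma derivative_eq_if_eq_on_open: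
  assumes "open S" "u \<in> S" "\<And>z. z \<in> S \<Longrightarrow> f z = g z"
    "(f has_field_derivative f') (at u)" "(g has_field_derivative g') (at u)"
  shows "f' = g'"
  using has_field_derivative_transform_within_open[OF assms(4,1,2,3)] assms(5) DERIV_unique by blast

lemma sin_pi_nonzero: "u \<notin> \<int> \<Longrightarrow> sin (of_real pi * u :: complex) \<noteq> 0"
  by (auto simp: sin_eq_0)

lemma not_Ints_one_minus: "u \<notin> \<int> \<Longrightarrow> 1 - u \<notin> (\<int> :: complex set)"
  using Ints_diff[OF Ints_1, of "1 - u"] by auto

lemma not_nonpos_Ints: "u \<notin> \<int> \<Longrightarrow> u \<notin> \<int>\<^sub>\<le>\<^sub>0"
  using nonpos_Ints_subset_Ints by blast

lemma open_non_Ints: "open (- \<int> :: complex set)"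
  using closed_Ints by (rule open_Compl)

text \<open>Written as a polynomial in the cotangent itself, the derivative keeps all higher ones
  polynomial in the cotangent.\<close>

lemma has_field_derivative_cot_pi:
  assumes "u \<notin> \<int>"
  shows "((\<lambda>u. cot (of_real pi * u)) has_field_derivative
    - of_real pi * (1 + cot (of_real pi * u) ^ 2)) (at (u :: complex))"
proof -
  have s: "sin (of_real pi * u) \<noteq> 0" using assms by (rule sin_pi_nonzero)
  have "((\<lambda>u. cot (of_real pi * u)) has_field_derivative
      - inverse (sin (of_real pi * u) ^ 2) * of_real pi) (at u)"
    by (rule DERIV_chain2[where f = cot and g = "\<lambda>u. of_real pi * u", OF DERIV_cot[OF s]])
       (auto intro!: derivative_eq_intros)
  also have "inverse (sin (of_real pi * u) ^ 2) = 1 + cot (of_real pi * u) ^ 2"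
    using s sin_cos_squared_add[of "of_real pi * u"] by (simp add: cot_def field_simps)
  also have "- (1 + cot (of_real pi * u) ^ 2) * of_real pi = - of_real pi * (1 + cot (of_real pi * u) ^ 2)"
    by (simp only: mult_minus_left mult_minus_right mult.commute)
  finally show ?thesis .
qed

text \<open>Logarithmic differentiation of
  \<open>Gamma u * Gamma (1 - u) * sin (pi u) = pi\<close>.\<close>

lemma Digamma_reflection:
  fixes u :: complex
  assumes u: "u \<notin> \<int>"
  shows "Digamma u - Digamma (1 - u) = - of_real pi * cot (of_real pi * u)"
proof -
  define s where "s = sin (of_real pi * u)"
  have nz: "u \<notin> \<int>\<^sub>\<le>\<^sub>0" "1 - u \<notin> \<int>\<^sub>\<le>\<^sub>0" "s \<noteq> 0"
    using u sin_pi_nonzero not_nonpos_Ints not_Ints_one_minus by (auto simp: s_def)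
  define G where "G = Gamma u * Gamma (1 - u)"
  have "((\<lambda>z. Gamma z * Gamma (1 - z) * sin (of_real pi * z)) has_field_derivative
      (G * (Digamma u - Digamma (1 - u)) * s + G * (of_real pi * cos (of_real pi * u)))) (at u)"
    using nz by (auto intro!: derivative_eq_intros simp: G_def s_def algebra_simps)
  moreover have "((\<lambda>_. of_real pi) has_field_derivative 0) (at u)" by simp
  ultimately have "G * (Digamma u - Digamma (1 - u)) * s + G * (of_real pi * cos (of_real pi * u)) = 0"
    by (rule derivative_eq_if_eq_on_open[OF open_non_Ints, rotated 2])
       (use u sin_pi_nonzero in \<open>auto simp: Gamma_reflection_complex\<close>)
  hence "G * ((Digamma u - Digamma (1 - u)) * s + of_real pi * cos (of_real pi * u)) = 0"
    by (simp add: algebra_simps)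
  moreover have "G \<noteq> 0" using nz by (simp add: G_def Gamma_eq_zero_iff)
  ultimately have "(Digamma u - Digamma (1 - u)) * s = - of_real pi * cos (of_real pi * u)"
    by (simp add: add_eq_0_iff2)
  thus ?thesis using nz(3) unfolding cot_def s_def by (simp add: field_simps)
qed

text \<open>Three successive derivatives of the Digamma reflection formula. Up to sign and
  factorial, \<open>Polygamma k u\<close> is the sum of \<open>1 / (u + n)^(k + 1)\<close> over
  natural \<open>n\<close>, so the first and third identities evaluate the full integer sums of
  exponents 2 and 4.\<close>

lemma Polygamma_reflection:
  fixes u :: complex
  assumes u: "u \<notin> \<int>"
  defines "C \<equiv> cot (of_real pi * u)"
  shows "Polygamma 1 u + Polygamma 1 (1 - u) = of_real pi ^ 2 * (1 + C ^ 2)"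
    and "Polygamma 2 u - Polygamma 2 (1 - u) = - 2 * of_real pi ^ 3 * C * (1 + C ^ 2)"
    and "Polygamma 3 u + Polygamma 3 (1 - u) = 2 * of_real pi ^ 4 * (1 + C ^ 2) * (1 + 3 * C ^ 2)"
proof -
  have D: "((\<lambda>u. Polygamma n u) has_field_derivative Polygamma (Suc n) u) (at u)"
    "((\<lambda>u. Polygamma n (1 - u)) has_field_derivative - Polygamma (Suc n) (1 - u)) (at u)"
    if "u \<notin> \<int>" for n and u :: complex
    using that not_nonpos_Ints not_Ints_one_minus
    by (auto intro!: derivative_eq_intros)
  have 1: "Polygamma 1 u + Polygamma 1 (1 - u) = of_real pi ^ 2 * (1 + cot (of_real pi * u) ^ 2)"
    if u: "u \<notin> \<int>" for u :: complex
  proof (rule derivative_eq_if_eq_on_open[OF open_non_Ints])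
    show "((\<lambda>u. Digamma u - Digamma (1 - u)) has_field_derivative Polygamma 1 u + Polygamma 1 (1 - u)) (at u)"
      using DERIV_diff[OF D(1)[OF u, of 0] D(2)[OF u, of 0]] by simp
    show "((\<lambda>u. - of_real pi * cot (of_real pi * u)) has_field_derivative
        of_real pi ^ 2 * (1 + cot (of_real pi * u) ^ 2)) (at u)"
      by (rule derivative_eq_intros has_field_derivative_cot_pi u refl)+ (simp add: power2_eq_square)
  qed (use u Digamma_reflection in auto)
  have 2: "Polygamma 2 u - Polygamma 2 (1 - u) =
      - 2 * of_real pi ^ 3 * cot (of_real pi * u) * (1 + cot (of_real pi * u) ^ 2)"
    if u: "u \<notin> \<int>" for u :: complex
  proof (rule derivative_eq_if_eq_on_open[OF open_non_Ints])
    show "((\<lambda>u. Polygamma 1 u + Polygamma 1 (1 - u)) has_field_derivative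
        Polygamma 2 u - Polygamma 2 (1 - u)) (at u)"
      using DERIV_add[OF D(1)[OF u, of 1] D(2)[OF u, of 1]] by (simp add: numeral_2_eq_2)
    show "((\<lambda>u. of_real pi ^ 2 * (1 + cot (of_real pi * u) ^ 2)) has_field_derivative
        - 2 * of_real pi ^ 3 * cot (of_real pi * u) * (1 + cot (of_real pi * u) ^ 2)) (at u)"
      by (rule derivative_eq_intros has_field_derivative_cot_pi u refl)+
         (simp add: power2_eq_square power3_eq_cube algebra_simps)
  qed (use u 1 in auto)
  have 3: "Polygamma 3 u + Polygamma 3 (1 - u) =
      2 * of_real pi ^ 4 * (1 + cot (of_real pi * u) ^ 2) * (1 + 3 * cot (of_real pi * u) ^ 2)"
    if u: "u \<notin> \<int>" for u :: complex
  proof (rule derivative_eq_if_eq_on_open[OF open_non_Ints])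
    show "((\<lambda>u. Polygamma 2 u - Polygamma 2 (1 - u)) has_field_derivative
        Polygamma 3 u + Polygamma 3 (1 - u)) (at u)"
      using DERIV_diff[OF D(1)[OF u, of 2] D(2)[OF u, of 2]] by (simp add: numeral_3_eq_3 numeral_2_eq_2)
    show "((\<lambda>u. - 2 * of_real pi ^ 3 * cot (of_real pi * u) * (1 + cot (of_real pi * u) ^ 2))
        has_field_derivative 2 * of_real pi ^ 4 * (1 + cot (of_real pi * u) ^ 2) *
          (1 + 3 * cot (of_real pi * u) ^ 2)) (at u)"
      by (rule derivative_eq_intros has_field_derivative_cot_pi u refl)+
         (simp add: power2_eq_square power3_eq_cube power4_eq_xxxx algebra_simps)
  qed (use u 2 in auto)
  show "Polygamma 1 u + Polygamma 1 (1 - u) = of_real pi ^ 2 * (1 + C ^ 2)"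
    "Polygamma 2 u - Polygamma 2 (1 - u) = - 2 * of_real pi ^ 3 * C * (1 + C ^ 2)"
    "Polygamma 3 u + Polygamma 3 (1 - u) = 2 * of_real pi ^ 4 * (1 + C ^ 2) * (1 + 3 * C ^ 2)"
    using 1 2 3 u by (simp_all add: C_def)
qed

lemma cot_pi_upper:
  assumes "Im w > 0"
  shows "cot (of_real pi * w) = - \<i> * (1 + nome 1 w) / (1 - nome 1 w)"
proof -
  define t where "t = exp (\<i> * (of_real pi * w))"
  have t: "t \<noteq> 0" by (simp add: t_def)
  have q: "nome 1 w = t ^ 2"
    by (simp add: nome_def t_def power2_eq_square exp_add[symmetric] mult_ac)
  have "nome 1 w \<noteq> 1" using nome_1_lt_1[OF assms] by auto
  hence "t ^ 2 \<noteq> 1" using q by metis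
  hence t2: "1 - t ^ 2 \<noteq> 0" by simp
  have inv: "exp (- (\<i> * (of_real pi * w))) = inverse t" by (simp add: t_def exp_minus)
  have "cot (of_real pi * w) = ((t + inverse t) / 2) / ((t - inverse t) / (2 * \<i>))"
    unfolding cot_def sin_exp_eq cos_exp_eq by (simp add: t_def exp_minus)
  also have "\<dots> = - \<i> * (1 + t ^ 2) / (1 - t ^ 2)"
  proof -
    have "t - inverse t = - ((1 - t ^ 2) / t)" using t by (simp add: field_simps power2_eq_square)
    moreover have "t + inverse t = (1 + t ^ 2) / t" using t by (simp add: field_simps power2_eq_square)
    ultimately show ?thesis using t t2 by (simp add: field_simps)
  qed
  finally show ?thesis unfolding q .
qed

lemma upper_not_Ints: "Im w \<noteq> 0 \<Longrightarrow> w \<notin> \<int>"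
  by (auto elim!: Ints_cases)

text \<open>Up to constants the right-hand sides are the closed forms of the sums of
  \<open>k q^k\<close> and of \<open>k^3 q^k\<close>; this is how divisor sums enter.\<close>

lemma cot_square_identities:
  fixes q :: complex
  assumes "q \<noteq> 1"
  defines "C \<equiv> - \<i> * (1 + q) / (1 - q)"
  shows "1 + C ^ 2 = - 4 * q / (1 - q) ^ 2"
    "(1 + C ^ 2) * (1 + 3 * C ^ 2) = 8 * (q * (1 + 4 * q + q ^ 2) / (1 - q) ^ 4)"
proof -
  have nz: "1 - q \<noteq> 0" using assms by simp
  have C2: "C ^ 2 = - ((1 + q) ^ 2 / (1 - q) ^ 2)"
    by (simp add: C_def power_divide power_mult_distrib)
  have "1 + C ^ 2 = ((1 - q) ^ 2 - (1 + q) ^ 2) / (1 - q) ^ 2"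
    using nz by (simp add: C2 diff_divide_distrib)
  also have "(1 - q) ^ 2 - (1 + q) ^ 2 = - 4 * q" by (simp add: power2_eq_square algebra_simps)
  finally show 1: "1 + C ^ 2 = - 4 * q / (1 - q) ^ 2" .
  have "1 + 3 * C ^ 2 = ((1 - q) ^ 2 - 3 * (1 + q) ^ 2) / (1 - q) ^ 2"
    using nz by (simp add: C2 diff_divide_distrib)
  also have "(1 - q) ^ 2 - 3 * (1 + q) ^ 2 = - 2 * (1 + 4 * q + q ^ 2)"
    by (simp add: power2_eq_square algebra_simps)
  finally have 2: "1 + 3 * C ^ 2 = - 2 * (1 + 4 * q + q ^ 2) / (1 - q) ^ 2" .
  have 3: "(1 - q) ^ 4 = (1 - q) ^ 2 * (1 - q) ^ 2" by (simp add: power_add[symmetric])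
  have 4: "- 4 * q * (- 2 * (1 + 4 * q + q ^ 2)) = 8 * (q * (1 + 4 * q + q ^ 2))"
    by (simp add: algebra_simps)
  show "(1 + C ^ 2) * (1 + 3 * C ^ 2) = 8 * (q * (1 + 4 * q + q ^ 2) / (1 - q) ^ 4)"
    unfolding 1 2 3 4 times_divide_times_eq by simp
qed

subsection \<open>Lattice sums\<close>

text \<open>The imaginary part bounds \<open>m\<close>. For \<open>n\<close> there are two cases: if
  \<open>\<bar>n\<bar> \<ge> 2 \<bar>m\<bar> norm z\<close>, half of \<open>n\<close> survives the
  triangle inequality, and otherwise \<open>n\<close> is itself controlled by \<open>m\<close>. The
  constant \<open>c\<close> is the minimum of the three factors that arise.\<close>

lemma lattice_norm_ge:
  assumes z: "Im z > 0"
  obtains c where "c > 0" "\<And>m n :: int. c * max \<bar>of_int m\<bar> \<bar>of_int n\<bar> \<le> norm (of_int m * z + of_int n)"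
proof -
  have nz: "norm z > 0" using z by auto
  define c where "c = min (Im z) (min (1 / 2) (Im z / (2 * norm z)))"
  have c: "c > 0" "c \<le> Im z" "c \<le> 1 / 2" "c \<le> Im z / (2 * norm z)"
    using z nz by (auto simp: c_def)
  show ?thesis
  proof (rule that[OF c(1)])
    fix m n :: int
    have Im: "\<bar>of_int m\<bar> * Im z \<le> norm (of_int m * z + of_int n)"
      using abs_Im_le_cmod[of "of_int m * z + of_int n"] z by (simp add: abs_mult)
    have "c * \<bar>of_int m\<bar> \<le> norm (of_int m * z + of_int n)"
      using mult_right_mono[OF c(2), of "\<bar>of_int m\<bar>"] Im by (simp add: mult.commute)
    moreover have "c * \<bar>of_int n\<bar> \<le> norm (of_int m * z + of_int n)"
    proof (cases "\<bar>of_int n\<bar> \<ge> 2 * \<bar>of_int m\<bar> * norm z")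
      case True
      have "\<bar>of_int n\<bar> - \<bar>of_int m\<bar> * norm z \<le> norm (of_int m * z + of_int n)"
        using norm_triangle_ineq2[of "of_int n" "- (of_int m * z)"]
        by (simp add: norm_mult add.commute)
      moreover have "c * \<bar>of_int n\<bar> \<le> 1 / 2 * \<bar>of_int n\<bar>" using c(3) by (intro mult_right_mono) auto
      ultimately show ?thesis using True by simp
    next
      case False
      have "c * \<bar>of_int n\<bar> \<le> Im z / (2 * norm z) * \<bar>of_int n\<bar>" using c(4) by (intro mult_right_mono) auto
      also have "\<dots> \<le> Im z / (2 * norm z) * (2 * \<bar>of_int m\<bar> * norm z)"
        using False z nz by (intro mult_left_mono) auto
      also have "\<dots> = \<bar>of_int m\<bar> * Im z" using nz by simp
      finally show ?thesis using Im by linarith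
    qed
    ultimately show "c * max \<bar>of_int m\<bar> \<bar>of_int n\<bar> \<le> norm (of_int m * z + of_int n)"
      by (simp add: max_def)
  qed
qed

text \<open>A maximum dominates a geometric mean, and the product form separates a double sum into
  two single sums. Cubing the bound produces the exponent 3/2 in each variable, which is
  summable.\<close>

lemma lattice_norm_ge_product:
  assumes z: "Im z > 0"
  obtains c where "c > 0" "\<And>m n :: int. (m, n) \<noteq> (0, 0) \<Longrightarrow>
    c * ((1 + \<bar>of_int m\<bar>) powr (1 / 2) * (1 + \<bar>of_int n\<bar>) powr (1 / 2)) \<le> norm (of_int m * z + of_int n)"
proof -
  obtain c where c: "c > 0" "\<And>m n :: int. c * max \<bar>of_int m\<bar> \<bar>of_int n\<bar> \<le> norm (of_int m * z + of_int n)"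
    using lattice_norm_ge[OF z] by blast
  show ?thesis
  proof (rule that[of "c / 2"])
    fix m n :: int assume mn: "(m, n) \<noteq> (0, 0)"
    define M where "M = max \<bar>real_of_int m\<bar> \<bar>real_of_int n\<bar>"
    have M1: "M \<ge> 1"
    proof -
      have "\<bar>m\<bar> \<ge> 1 \<or> \<bar>n\<bar> \<ge> 1" using mn by auto
      thus ?thesis unfolding M_def by (auto simp: le_max_iff_disj simp flip: of_int_abs)
    qed
    have "(1 + \<bar>real_of_int m\<bar>) powr (1 / 2) \<le> (2 * M) powr (1 / 2)"
      "(1 + \<bar>real_of_int n\<bar>) powr (1 / 2) \<le> (2 * M) powr (1 / 2)"
      using M1 by (intro powr_mono2; simp add: M_def)+
    hence "(1 + \<bar>real_of_int m\<bar>) powr (1 / 2) * (1 + \<bar>real_of_int n\<bar>) powr (1 / 2) \<le>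
        (2 * M) powr (1 / 2) * (2 * M) powr (1 / 2)"
      by (intro mult_mono) auto
    also have "\<dots> = 2 * M" using M1 by (simp add: powr_add[symmetric])
    finally have "c / 2 * ((1 + \<bar>real_of_int m\<bar>) powr (1 / 2) * (1 + \<bar>real_of_int n\<bar>) powr (1 / 2)) \<le> c * M"
      using c(1) by simp
    also have "\<dots> \<le> norm (of_int m * z + of_int n)" using c(2) by (simp add: M_def)
    finally show "c / 2 * ((1 + \<bar>of_int m\<bar>) powr (1 / 2) * (1 + \<bar>of_int n\<bar>) powr (1 / 2)) \<le>
        norm (of_int m * z + of_int n)" .
  qed (use c in auto)
qed

lemma summable_on_int_iff:
  fixes f :: "int \<Rightarrow> 'a :: banach"
  assumes "(\<lambda>k. f (int k)) summable_on UNIV" "(\<lambda>k. f (- 1 - int k)) summable_on UNIV"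
  shows "f summable_on UNIV"
proof -
  have "f summable_on {0..}"
    using assms(1) by (subst summable_on_reindex_bij_witness[of _ int nat]) auto
  moreover have "f summable_on {..<0}"
    using assms(2) by (subst summable_on_reindex_bij_witness[of _ "\<lambda>k. - 1 - int k" "\<lambda>n. nat (- 1 - n)"]) auto
  ultimately have "f summable_on ({0..} \<union> {..<0})" by (rule summable_on_Un_disjoint) auto
  moreover have "{0..} \<union> {..<0} = (UNIV :: int set)" by auto
  ultimately show ?thesis by simp
qed

lemma has_sum_int_split:
  fixes f :: "int \<Rightarrow> complex"
  assumes "f summable_on UNIV" "(\<lambda>k. f (int k)) sums a" "(\<lambda>k. f (- 1 - int k)) sums b"
  shows "(f has_sum (a + b)) UNIV"
proof -
  have s: "f summable_on {0..}" "f summable_on {..<0}"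
    using assms(1) summable_on_subset by blast+
  have "((\<lambda>k. f (int k)) has_sum infsum f {0..}) UNIV"
    using has_sum_infsum[OF s(1)] by (subst has_sum_reindex_bij_witness[of _ nat int]) auto
  hence "infsum f {0..} = a" using has_sum_imp_sums assms(2) sums_unique2 by blast
  moreover have "((\<lambda>k. f (- 1 - int k)) has_sum infsum f {..<0}) UNIV"
    using has_sum_infsum[OF s(2)]
    by (subst has_sum_reindex_bij_witness[of _ "\<lambda>n. nat (- 1 - n)" "\<lambda>k. - 1 - int k"]) auto
  hence "infsum f {..<0} = b" using has_sum_imp_sums assms(3) sums_unique2 by blast
  moreover have "(f has_sum (infsum f {0..} + infsum f {..<0})) ({0..} \<union> {..<0})"
    using s by (intro has_sum_Un_disjoint has_sum_infsum) auto
  moreover have "{0..} \<union> {..<0} = (UNIV :: int set)" by auto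
  ultimately show ?thesis by simp
qed

lemma summable_on_int_powr: "(\<lambda>n :: int. (1 + \<bar>real_of_int n\<bar>) powr (- 3 / 2)) summable_on UNIV"
proof (rule summable_on_int_iff)
  have s: "summable (\<lambda>k. real k powr (- 3 / 2))" by (simp add: summable_real_powr_iff)
  note 1 = summable_ignore_initial_segment[OF s, of 1] summable_ignore_initial_segment[OF s, of 2]
  have eq: "real (k + 1) = 1 + \<bar>real_of_int (int k)\<bar>"
    "real (k + 2) = 1 + \<bar>real_of_int (- 1 - int k)\<bar>" for k by simp_all
  show "(\<lambda>k. (1 + \<bar>real_of_int (int k)\<bar>) powr (- 3 / 2)) summable_on UNIV"
    "(\<lambda>k. (1 + \<bar>real_of_int (- 1 - int k)\<bar>) powr (- 3 / 2)) summable_on UNIV"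
    unfolding eq[symmetric] using 1 by (auto intro!: summable_nonneg_imp_summable_on simp del: of_nat_add)
qed

lemma summable_on_int2_powr:
  "(\<lambda>(m :: int, n :: int). (1 + \<bar>real_of_int m\<bar>) powr (- 3 / 2) * (1 + \<bar>real_of_int n\<bar>) powr (- 3 / 2))
     summable_on UNIV"
proof -
  have "(\<lambda>(m :: int, n :: int). (1 + \<bar>real_of_int m\<bar>) powr (- 3 / 2) * (1 + \<bar>real_of_int n\<bar>) powr (- 3 / 2))
     summable_on UNIV \<times> UNIV"
  proof (rule summable_on_SigmaI)
    fix m :: int
    show "((\<lambda>n. case (m, n) of (m, n) \<Rightarrow> (1 + \<bar>real_of_int m\<bar>) powr (- 3 / 2) * (1 + \<bar>real_of_int n\<bar>) powr (- 3 / 2))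
        has_sum (1 + \<bar>real_of_int m\<bar>) powr (- 3 / 2) * (\<Sum>\<^sub>\<infinity>n :: int. (1 + \<bar>real_of_int n\<bar>) powr (- 3 / 2))) UNIV"
      unfolding prod.case by (intro has_sum_cmult_right has_sum_infsum summable_on_int_powr)
    show "(\<lambda>m. (1 + \<bar>real_of_int m\<bar>) powr (- 3 / 2) * (\<Sum>\<^sub>\<infinity>n :: int. (1 + \<bar>real_of_int n\<bar>) powr (- 3 / 2)))
        summable_on UNIV"
      by (intro summable_on_cmult_left summable_on_int_powr)
  qed auto
  thus ?thesis by simp
qed

lemma lattice_sum_summable:
  assumes z: "Im z > 0" and k: "k \<ge> 3"
  shows "(\<lambda>(m :: int, n :: int). 1 / (of_int m * z + of_int n) ^ k) summable_on (UNIV - {(0, 0)})"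
proof -
  obtain c where c: "c > 0" "\<And>m n :: int. (m, n) \<noteq> (0, 0) \<Longrightarrow>
      c * ((1 + \<bar>of_int m\<bar>) powr (1 / 2) * (1 + \<bar>of_int n\<bar>) powr (1 / 2)) \<le> norm (of_int m * z + of_int n)"
    using lattice_norm_ge_product[OF z] by blast
  show ?thesis
  proof (rule Infinite_Sum.abs_summable_summable, rule Infinite_Sum.abs_summable_on_comparison_test')
    show "(\<lambda>x. inverse c ^ k * (case x of (m :: int, n :: int) \<Rightarrow>
        (1 + \<bar>real_of_int m\<bar>) powr (- 3 / 2) * (1 + \<bar>real_of_int n\<bar>) powr (- 3 / 2))) summable_on (UNIV - {(0, 0)})"
      using summable_on_int2_powr by (intro summable_on_cmult_right) (rule summable_on_subset, auto)
  next
    fix x :: "int \<times> int" assume "x \<in> UNIV - {(0, 0)}"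
    then obtain m n where x: "x = (m, n)" "(m, n) \<noteq> (0, 0)" by (cases x) auto
    define B where "B = (1 + \<bar>real_of_int m\<bar>) powr (1 / 2) * (1 + \<bar>real_of_int n\<bar>) powr (1 / 2)"
    have B: "B \<ge> 1" unfolding B_def
      using mult_mono[of 1 "(1 + \<bar>real_of_int m\<bar>) powr (1 / 2)" 1 "(1 + \<bar>real_of_int n\<bar>) powr (1 / 2)"]
      by (simp add: ge_one_powr_ge_zero)
    have cB: "0 < c * B" "c * B \<le> norm (of_int m * z + of_int n)"
      using c(2)[OF x(2)] c(1) B by (simp_all add: B_def)
    have "norm (1 / (of_int m * z + of_int n) ^ k) \<le> 1 / (c * B) ^ k"
      unfolding norm_divide norm_power norm_one
      by (intro frac_le power_mono zero_less_power cB less_imp_le[OF cB(1)]) auto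
    also have "\<dots> = inverse c ^ k * (1 / B ^ k)" by (simp add: power_mult_distrib divide_simps)
    also have "1 / B ^ k \<le> 1 / B ^ 3"
      using B k by (intro divide_left_mono power_increasing) auto
    also have "1 / B ^ 3 = (1 + \<bar>real_of_int m\<bar>) powr (- 3 / 2) * (1 + \<bar>real_of_int n\<bar>) powr (- 3 / 2)"
      unfolding B_def power_mult_distrib
      by (simp add: powr_power powr_minus_divide powr_minus field_simps)
    finally show "norm (case x of (m, n) \<Rightarrow> 1 / (of_int m * z + of_int n) ^ k) \<le> inverse c ^ k *
        (case x of (m, n) \<Rightarrow> (1 + \<bar>real_of_int m\<bar>) powr (- 3 / 2) * (1 + \<bar>real_of_int n\<bar>) powr (- 3 / 2))"
      using c(1) by (simp add: x mult_left_mono)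
  qed
qed

lemma row_summable:
  assumes z: "Im z > 0" and k: "k \<ge> 2"
  shows "(\<lambda>n :: int. 1 / (z + of_int n) ^ k) summable_on UNIV"
proof -
  obtain c where c: "c > 0" "\<And>m n :: int. c * max \<bar>of_int m\<bar> \<bar>of_int n\<bar> \<le> norm (of_int m * z + of_int n)"
    using lattice_norm_ge[OF z] by blast
  show ?thesis
  proof (rule Infinite_Sum.abs_summable_summable, rule Infinite_Sum.abs_summable_on_comparison_test')
    show "(\<lambda>n :: int. (2 / c) ^ k * (1 + \<bar>real_of_int n\<bar>) powr (- 3 / 2)) summable_on UNIV"
      by (intro summable_on_cmult_right summable_on_int_powr)
  next
    fix n :: int
    have "1 + \<bar>x\<bar> \<le> 2 * max 1 \<bar>x\<bar>" for x :: real by (simp add: max_def)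
    hence "c / 2 * (1 + \<bar>real_of_int n\<bar>) \<le> c / 2 * (2 * max 1 \<bar>real_of_int n\<bar>)"
      using c(1) by (intro mult_left_mono) auto
    hence "c / 2 * (1 + \<bar>real_of_int n\<bar>) \<le> c * max 1 \<bar>real_of_int n\<bar>" by simp
    also have "\<dots> \<le> norm (z + of_int n)" using c(2)[of 1 n] by simp
    finally have *: "c / 2 * (1 + \<bar>real_of_int n\<bar>) \<le> norm (z + of_int n)" .
    have "norm (1 / (z + of_int n) ^ k) \<le> 1 / (c / 2 * (1 + \<bar>real_of_int n\<bar>)) ^ k"
      unfolding norm_divide norm_power norm_one
      by (rule divide_left_mono[OF power_mono[OF *]])
         (use c(1) * in \<open>auto intro!: mult_pos_pos zero_less_power add_pos_nonneg less_le_trans[OF _ *]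
            simp del: zero_less_norm_iff\<close>)
    also have "\<dots> = (2 / c) ^ k * (1 / (1 + \<bar>real_of_int n\<bar>) ^ k)"
      by (simp add: power_mult_distrib power_divide divide_simps)
    also have "1 / (1 + \<bar>real_of_int n\<bar>) ^ k \<le> (1 + \<bar>real_of_int n\<bar>) powr (- 3 / 2)"
    proof -
      have "1 / (1 + \<bar>real_of_int n\<bar>) ^ k = (1 + \<bar>real_of_int n\<bar>) powr (- real k)"
        by (simp add: powr_minus powr_realpow add_pos_nonneg divide_inverse)
      also have "\<dots> \<le> (1 + \<bar>real_of_int n\<bar>) powr (- 3 / 2)" using k by (intro powr_mono) auto
      finally show ?thesis .
    qed
    finally show "norm (1 / (z + of_int n) ^ k) \<le> (2 / c) ^ k * (1 + \<bar>real_of_int n\<bar>) powr (- 3 / 2)"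
      using c(1) by (simp add: mult_left_mono)
  qed
qed

text \<open>The indices \<open>n \<ge> 0\<close> give \<open>Polygamma k z\<close>. The negative
  ones, written \<open>- 1 - n\<close>, give \<open>Polygamma k (1 - z)\<close>, since
  \<open>z - 1 - n = - (1 - z + n)\<close>.\<close>

lemma row_sum_Polygamma:
  assumes z: "Im z > 0" and k: "k \<ge> 1"
  shows "((\<lambda>n :: int. 1 / (z + of_int n) ^ Suc k) has_sum
    ((-1) ^ Suc k * Polygamma k z / fact k + Polygamma k (1 - z) / fact k)) UNIV"
proof (rule has_sum_int_split)
  have nz: "z \<noteq> 0" "1 - z \<noteq> 0" using z by (auto simp: complex_eq_iff)
  show "(\<lambda>n :: int. 1 / (z + of_int n) ^ Suc k) summable_on UNIV" using z k by (intro row_summable) auto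
  show "(\<lambda>n. 1 / (z + of_int (int n)) ^ Suc k) sums ((-1) ^ Suc k * Polygamma k z / fact k)"
    using Polygamma_LIMSEQ[of z k] nz k by (simp add: divide_inverse)
  have "(\<lambda>n. (-1) ^ Suc k * inverse ((1 - z + of_nat n) ^ Suc k)) sums
      ((-1) ^ Suc k * ((-1) ^ Suc k * Polygamma k (1 - z) / fact k))"
    using Polygamma_LIMSEQ[of "1 - z" k] nz k by (intro sums_mult) auto
  also have "(\<lambda>n. (-1) ^ Suc k * inverse ((1 - z + of_nat n) ^ Suc k)) =
      (\<lambda>n. 1 / (z + of_int (- 1 - int n)) ^ Suc k)"
  proof
    fix n
    have "z + of_int (- 1 - int n) = (-1) * (1 - z + of_nat n)" by simp
    hence "(z + of_int (- 1 - int n)) ^ Suc k = (-1) ^ Suc k * (1 - z + of_nat n) ^ Suc k"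
      by (simp only: power_mult_distrib)
    moreover have "inverse ((-1) ^ Suc k :: complex) = (-1) ^ Suc k" by (cases "even k") auto
    ultimately show "(-1) ^ Suc k * inverse ((1 - z + of_nat n) ^ Suc k) =
        1 / (z + of_int (- 1 - int n)) ^ Suc k"
      by (simp only: divide_inverse inverse_mult_distrib mult_1_left)
  qed
  also have "(-1) ^ Suc k * ((-1) ^ Suc k * Polygamma k (1 - z) / fact k) = Polygamma k (1 - z) / fact k"
    by (simp add: power_mult_distrib[symmetric] flip: mult.assoc)
  finally show "(\<lambda>n. 1 / (z + of_int (- 1 - int n)) ^ Suc k) sums (Polygamma k (1 - z) / fact k)" .
qed

section \<open>Lipschitz formulas for the exponents two and four\<close>

lemma lipschitz_formula_2:
  assumes z: "Im z > 0"
  defines "q \<equiv> nome 1 z"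
  shows "((\<lambda>n :: int. 1 / (z + of_int n) ^ 2) has_sum (- 4 * of_real pi ^ 2 * (q / (1 - q) ^ 2))) UNIV"
proof -
  have q1: "q \<noteq> 1" using nome_1_lt_1[OF z] by (auto simp: q_def)
  have "Polygamma 1 z + Polygamma 1 (1 - z) = - 4 * of_real pi ^ 2 * (q / (1 - q) ^ 2)"
    using Polygamma_reflection(1)[OF upper_not_Ints[of z]] z cot_square_identities(1)[OF q1]
    by (simp add: cot_pi_upper[OF z] q_def)
  thus ?thesis using row_sum_Polygamma[OF z, of 1] by (simp add: numeral_2_eq_2)
qed

text \<open>The constants follow the pattern \<open>(- 2 pi i)^k / (k - 1)!\<close> : this is
  \<open>- 4 pi^2\<close> for exponent 2, and \<open>16 pi^4 / 6\<close> for exponent 4.\<close>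

lemma lipschitz_formula_4:
  assumes z: "Im z > 0"
  defines "q \<equiv> nome 1 z"
  shows "((\<lambda>n :: int. 1 / (z + of_int n) ^ 4) has_sum
    (8 / 3 * of_real pi ^ 4 * (q * (1 + 4 * q + q ^ 2) / (1 - q) ^ 4))) UNIV"
proof -
  have q1: "q \<noteq> 1" using nome_1_lt_1[OF z] by (auto simp: q_def)
  have "Polygamma 3 z + Polygamma 3 (1 - z) = 2 * of_real pi ^ 4 * ((1 + cot (of_real pi * z) ^ 2) * (1 + 3 * cot (of_real pi * z) ^ 2))"
    using Polygamma_reflection(3)[OF upper_not_Ints[of z]] z by (simp add: mult_ac)
  also have "\<dots> = 16 * of_real pi ^ 4 * (q * (1 + 4 * q + q ^ 2) / (1 - q) ^ 4)"
    using cot_square_identities(2)[OF q1] by (simp add: cot_pi_upper[OF z] q_def)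
  finally have sum: "Polygamma 3 z + Polygamma 3 (1 - z) = \<dots>" .
  have "Polygamma 3 z / 6 + Polygamma 3 (1 - z) / 6 = (Polygamma 3 z + Polygamma 3 (1 - z)) / 6"
    by (simp only: add_divide_distrib)
  also have "\<dots> = 8 / 3 * of_real pi ^ 4 * (q * (1 + 4 * q + q ^ 2) / (1 - q) ^ 4)"
    unfolding sum by simp
  finally have "Polygamma 3 z / 6 + Polygamma 3 (1 - z) / 6 =
      8 / 3 * of_real pi ^ 4 * (q * (1 + 4 * q + q ^ 2) / (1 - q) ^ 4)" .
  thus ?thesis using row_sum_Polygamma[OF z, of 3] by (simp add: fact_numeral numeral_eq_Suc)
qed

text \<open>The half-open windows fit the telescoping of
  \<open>1 / (m z + n) - 1 / (m z + n + 1)\<close>, whose ends then lie symmetrically at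
  \<open>- L\<close> and \<open>L\<close>.\<close>

lemma sums_pair_int:
  fixes f :: "int \<Rightarrow> complex"
  assumes "(f has_sum S) UNIV"
  shows "(\<lambda>L. \<Sum>n\<in>{- int L..<int L}. f n) \<longlonglongrightarrow> S"
proof -
  have "filterlim (\<lambda>L. {- int L..<int L}) (finite_subsets_at_top UNIV) sequentially"
    unfolding filterlim_finite_subsets_at_top
  proof safe
    fix X :: "int set" assume X: "finite X"
    define M where "M = nat (Max (insert 0 (abs ` X))) + 1"
    have M: "\<bar>x\<bar> < int M" if "x \<in> X" for x
    proof -
      have "\<bar>x\<bar> \<le> Max (insert 0 (abs ` X))" using X that by (intro Max_ge) auto
      moreover have "0 \<le> Max (insert 0 (abs ` X))" using X by (intro Max_ge) auto
      ultimately show ?thesis by (simp add: M_def)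
    qed
    show "\<forall>\<^sub>F L in sequentially. finite {- int L..<int L} \<and> X \<subseteq> {- int L..<int L} \<and> {- int L..<int L} \<subseteq> UNIV"
      using eventually_ge_at_top[of M] by eventually_elim (use M in \<open>force simp: abs_less_iff\<close>)
  qed
  thus ?thesis using assms unfolding has_sum_def by (rule filterlim_compose[rotated])
qed

lemma has_sum_diff:
  fixes f g :: "'a \<Rightarrow> complex"
  assumes "(f has_sum a) A" "(g has_sum b) A"
  shows "((\<lambda>x. f x - g x) has_sum (a - b)) A"
  using has_sum_add[OF assms(1) has_sum_uminusI[OF assms(2)]] by simp

lemma has_sum_int_nonzero:
  fixes f :: "int \<Rightarrow> complex"
  assumes "f summable_on UNIV - {0}" "(\<lambda>k. f (int (Suc k))) sums a" "(\<lambda>k. f (- int (Suc k))) sums b"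
  shows "(f has_sum (a + b)) (UNIV - {0})"
proof -
  define g where "g = (\<lambda>n. if n = 0 then 0 else f n)"
  have "g summable_on UNIV \<longleftrightarrow> f summable_on UNIV - {0}"
    by (rule summable_on_cong_neutral) (auto simp: g_def)
  moreover have "(\<lambda>k. g (int k)) sums a"
    using assms(2) sums_Suc_iff[of "\<lambda>k. g (int k)" a] by (simp add: g_def)
  moreover have "(\<lambda>k. g (- 1 - int k)) sums b"
    using assms(3) by (simp add: g_def add.commute)
  ultimately have "(g has_sum (a + b)) UNIV" using assms(1) by (intro has_sum_int_split) auto
  also have "(g has_sum (a + b)) UNIV \<longleftrightarrow> (f has_sum (a + b)) (UNIV - {0})"
    by (rule has_sum_cong_neutral) (auto simp: g_def)
  finally show ?thesis .
qed

section \<open>Zeta values at two and four\<close>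

lemma zeta_2_has_sum: "((\<lambda>n :: int. 1 / of_int n ^ 2 :: complex) has_sum (of_real pi ^ 2 / 3)) (UNIV - {0})"
proof -
  have s: "(\<lambda>k. 1 / of_nat (Suc k) ^ 2 :: complex) sums (of_real pi ^ 2 / 6)"
    using sums_of_real[OF inverse_squares_sums, where 'a = complex] by simp
  have summ: "(\<lambda>k. 1 / of_nat (Suc k) ^ 2 :: complex) summable_on UNIV"
    using inverse_squares_sums
    by (intro norm_summable_imp_summable_on) (simp add: sums_iff norm_divide norm_power add.commute del: of_nat_Suc)
  have "(\<lambda>n :: int. 1 / of_int n ^ 2 :: complex) summable_on ({1..} \<union> {..-1})"
  proof (rule summable_on_Un_disjoint)
    show "(\<lambda>n :: int. 1 / of_int n ^ 2 :: complex) summable_on {1..}"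
      using summ by (subst summable_on_reindex_bij_witness[of _ "\<lambda>k. int (Suc k)" "\<lambda>n. nat (n - 1)"]) auto
    show "(\<lambda>n :: int. 1 / of_int n ^ 2 :: complex) summable_on {..-1}"
      using summ by (subst summable_on_reindex_bij_witness[of _ "\<lambda>k. - int (Suc k)" "\<lambda>n. nat (- n - 1)"])
        (auto simp: power2_eq_square)
  qed auto
  also have "{1..} \<union> {..-1} = UNIV - {0 :: int}" by auto
  finally have "((\<lambda>n :: int. 1 / of_int n ^ 2 :: complex) has_sum (of_real pi ^ 2 / 6 + of_real pi ^ 2 / 6)) (UNIV - {0})"
  proof (rule has_sum_int_nonzero)
    have "of_int (- int (Suc k)) ^ 2 = (of_nat (Suc k) ^ 2 :: complex)" for k
      by (simp only: of_int_minus power2_minus of_int_of_nat_eq)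
    thus "(\<lambda>k. 1 / of_int (- int (Suc k)) ^ 2 :: complex) sums (of_real pi ^ 2 / 6)" using s by (simp only:)
  qed (use s in simp)
  thus ?thesis by simp
qed

text \<open>At \<open>u = 1/2\<close> the cotangent vanishes and the reflection formula gives
  \<open>pi^4 / 96\<close> for the sum over odd integers. The even ones contribute a sixteenth of
  the whole sum, which leaves a linear equation for it.\<close>

lemma zeta_4_sums: "(\<lambda>k. 1 / of_nat (Suc k) ^ 4 :: complex) sums (of_real pi ^ 4 / 90)"
proof -
  have half: "(1 / 2 :: complex) \<notin> \<int>" using fraction_not_in_Ints[of 2 1, where 'a = complex] by simp
  have "cot (of_real pi * (1 / 2) :: complex) = of_real (cot (pi / 2))"
    using cot_of_real[of "pi / 2", where 'a = complex] by simp
  hence "Polygamma 3 (1 / 2 :: complex) = of_real pi ^ 4"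
    using Polygamma_reflection(3)[OF half] by (simp add: cot_def)
  hence P: "(\<lambda>k. inverse ((1 / 2 + of_nat k) ^ 4)) sums (of_real pi ^ 4 / 6 :: complex)"
    using Polygamma_LIMSEQ[of "1 / 2 :: complex" 3] by (simp add: fact_numeral numeral_eq_Suc)
  have "(\<lambda>k. inverse ((1 / 2 + of_nat k) ^ 4) / 16) sums (of_real pi ^ 4 / 6 / 16 :: complex)"
    using P by (rule sums_divide)
  moreover have "inverse ((1 / 2 + of_nat k) ^ 4) / 16 = (1 / of_nat (2 * k + 1) ^ 4 :: complex)" for k
  proof -
    have "(of_nat (2 * k + 1) :: complex) = 2 * (1 / 2 + of_nat k)" by simp
    moreover have "inverse (x ^ 4) / 16 = 1 / (2 * x) ^ 4" for x :: complex
      unfolding power_mult_distrib by (simp add: inverse_eq_divide)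
    ultimately show ?thesis by (simp only:)
  qed
  ultimately have odd: "(\<lambda>k. 1 / of_nat (2 * k + 1) ^ 4 :: complex) sums (of_real pi ^ 4 / 96)" by simp
  have "summable (\<lambda>k. 1 / of_nat (Suc k) ^ 4 :: complex)"
  proof -
    have "Suc 3 = 4" by simp
    thus ?thesis using sums_summable[OF Polygamma_LIMSEQ[of "1 :: complex" 3]] by (simp add: inverse_eq_divide)
  qed
  then obtain Z where Z: "(\<lambda>k. 1 / of_nat (Suc k) ^ 4 :: complex) sums Z" by blast
  have "(\<lambda>n. \<Sum>k\<in>{n * 2..<n * 2 + 2}. 1 / of_nat (Suc k) ^ 4 :: complex) sums Z"
    using sums_group[OF Z, of 2] by simp
  also have "(\<lambda>n. \<Sum>k\<in>{n * 2..<n * 2 + 2}. 1 / of_nat (Suc k) ^ 4 :: complex) =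
      (\<lambda>n. 1 / of_nat (2 * n + 1) ^ 4 + 1 / of_nat (Suc n) ^ 4 / 16)"
  proof
    fix n :: nat
    have "{n * 2..<n * 2 + 2} = {2 * n, 2 * n + 1}" by auto
    moreover have "(of_nat (Suc (2 * n + 1)) :: complex) = 2 * of_nat (Suc n)" by simp
    hence "1 / of_nat (Suc (2 * n + 1)) ^ 4 = (1 / of_nat (Suc n) ^ 4 / 16 :: complex)"
      by (simp only: power_mult_distrib) simp
    ultimately show "(\<Sum>k\<in>{n * 2..<n * 2 + 2}. 1 / of_nat (Suc k) ^ 4 :: complex) =
        1 / of_nat (2 * n + 1) ^ 4 + 1 / of_nat (Suc n) ^ 4 / 16"
      by (simp del: of_nat_Suc of_nat_add add: Suc_eq_plus1[symmetric] del: Suc_eq_plus1)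
  qed
  finally have "(\<lambda>n. 1 / of_nat (2 * n + 1) ^ 4 + 1 / of_nat (Suc n) ^ 4 / 16 :: complex) sums Z" .
  moreover have "(\<lambda>n. 1 / of_nat (2 * n + 1) ^ 4 + 1 / of_nat (Suc n) ^ 4 / 16 :: complex) sums
      (of_real pi ^ 4 / 96 + Z / 16)"
    by (intro sums_add odd sums_divide Z)
  ultimately have "Z = of_real pi ^ 4 / 96 + Z / 16" by (rule sums_unique2)
  hence "Z = of_real pi ^ 4 / 90" by (simp add: field_simps)
  thus ?thesis using Z by (simp only:)
qed

text \<open>With \<open>q = nome 1 z\<close> and \<open>Im z > 0\<close> this is the sum of
  \<open>k q^k\<close>; \<open>lam4\<close> is that of \<open>k^3 q^k\<close>. Evaluated at
  \<open>\<bar>m\<bar> z\<close> they give the rows of the lattice sums of weights two and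
  four.\<close>

definition lam2 :: "complex \<Rightarrow> complex" where
  "lam2 z = nome 1 z / (1 - nome 1 z) ^ 2"

definition lam4 :: "complex \<Rightarrow> complex" where
  "lam4 z = nome 1 z * (1 + 4 * nome 1 z + nome 1 z ^ 2) / (1 - nome 1 z) ^ 4"

lemma row_has_sum:
  assumes z: "Im z > 0" and m: "m \<noteq> (0 :: int)"
  shows "((\<lambda>n :: int. 1 / (of_int m * z + of_int n) ^ 2) has_sum
      (- 4 * of_real pi ^ 2 * lam2 (of_int \<bar>m\<bar> * z))) UNIV"
    "((\<lambda>n :: int. 1 / (of_int m * z + of_int n) ^ 4) has_sum
      (8 / 3 * of_real pi ^ 4 * lam4 (of_int \<bar>m\<bar> * z))) UNIV"
proof -
  have Im: "Im (of_int \<bar>m\<bar> * z) > 0" using z m by simp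
  have *: "((\<lambda>n :: int. 1 / (of_int m * z + of_int n) ^ k) has_sum S) UNIV"
    if S: "((\<lambda>n :: int. 1 / (of_int \<bar>m\<bar> * z + of_int n) ^ k) has_sum S) UNIV" and k: "even k" for S k
  proof (cases "m > 0")
    case True
    thus ?thesis using S by simp
  next
    case False
    have "((\<lambda>n :: int. 1 / (of_int m * z + of_int n) ^ k) has_sum S) UNIV \<longleftrightarrow>
        ((\<lambda>n :: int. 1 / (of_int \<bar>m\<bar> * z + of_int n) ^ k) has_sum S) UNIV"
    proof (rule has_sum_reindex_bij_witness[of _ uminus uminus])
      fix n :: int
      have "of_int \<bar>m\<bar> * z + of_int (- n) = - (of_int m * z + of_int n)"
        using False m by (simp add: abs_if algebra_simps)
      thus "1 / (of_int \<bar>m\<bar> * z + of_int (- n)) ^ k = 1 / (of_int m * z + of_int n) ^ k"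
        using k by (simp only: power_minus_even)
    qed auto
    thus ?thesis using S by simp
  qed
  show "((\<lambda>n :: int. 1 / (of_int m * z + of_int n) ^ 2) has_sum
      (- 4 * of_real pi ^ 2 * lam2 (of_int \<bar>m\<bar> * z))) UNIV"
    "((\<lambda>n :: int. 1 / (of_int m * z + of_int n) ^ 4) has_sum
      (8 / 3 * of_real pi ^ 4 * lam4 (of_int \<bar>m\<bar> * z))) UNIV"
    using lipschitz_formula_2[OF Im] lipschitz_formula_4[OF Im] by (intro *; simp add: lam2_def lam4_def)+
qed

section \<open>The conditionally convergent sum of weight two\<close>

lemma tendsto_inverse_of_nat_add: "(\<lambda>n. 1 / (w + of_nat n) :: complex) \<longlonglongrightarrow> 0"
  "(\<lambda>n. 1 / (w - of_nat n) :: complex) \<longlonglongrightarrow> 0"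
proof -
  have "filterlim (\<lambda>n. w + of_nat n) at_infinity sequentially" for w :: complex
    by (rule tendsto_add_filterlim_at_infinity[OF tendsto_const tendsto_of_nat])
  hence *: "(\<lambda>n. inverse (w + of_nat n) :: complex) \<longlonglongrightarrow> 0" for w
    by (rule filterlim_compose[OF tendsto_inverse_0])
  show "(\<lambda>n. 1 / (w + of_nat n) :: complex) \<longlonglongrightarrow> 0" using *[of w] by (simp add: divide_inverse)
  have "(\<lambda>n. - inverse (- w + of_nat n) :: complex) \<longlonglongrightarrow> 0" using tendsto_minus[OF *[of "- w"]] by simp
  also have "(\<lambda>n. - inverse (- w + of_nat n) :: complex) = (\<lambda>n. 1 / (w - of_nat n))"
    by (simp add: divide_inverse inverse_minus_eq[symmetric] del: inverse_minus_eq)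
  finally show "(\<lambda>n. 1 / (w - of_nat n) :: complex) \<longlonglongrightarrow> 0" .
qed

text \<open>The difference of the Digamma series at \<open>1 + u\<close> and \<open>1 - u\<close>,
  evaluated by the functional equation and the reflection formula. The order of the terms is fixed
  by pairing opposite poles.\<close>

lemma cot_partial_fractions:
  fixes u :: complex
  assumes "u \<notin> \<int>"
  shows "(\<lambda>k. 1 / (of_nat (Suc k) - u) - 1 / (of_nat (Suc k) + u)) sums (1 / u - of_real pi * cot (of_real pi * u))"
proof -
  have nz: "u \<noteq> 0" using assms by auto
  have D: "(\<lambda>k. inverse (of_nat (Suc k)) - inverse (z + of_nat k)) sums (Digamma z + euler_mascheroni)"
    if "z \<notin> \<int>" for z :: complex
  proof -
    have "z \<noteq> 0" using that by auto
    from summable_sums[OF summable_Digamma[OF this]] show ?thesis by (simp add: Digamma_def)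
  qed
  have "1 + u \<notin> \<int>" "1 - u \<notin> \<int>"
    using assms not_Ints_one_minus[of u] not_Ints_one_minus[of "- u"] by (auto simp: minus_in_Ints_iff)
  from sums_diff[OF D[OF this(1)] D[OF this(2)]]
  have "(\<lambda>k. 1 / (of_nat (Suc k) - u) - 1 / (of_nat (Suc k) + u)) sums (Digamma (1 + u) - Digamma (1 - u))"
    by (simp add: divide_inverse algebra_simps)
  also have "Digamma (1 + u) - Digamma (1 - u) = 1 / u + (Digamma u - Digamma (1 - u))"
    using Digamma_plus1[OF nz] by (simp add: add.commute)
  also have "\<dots> = 1 / u - of_real pi * cot (of_real pi * u)"
    unfolding Digamma_reflection[OF assms] by simp
  finally show ?thesis .
qed

lemma lattice_denominator_nonzero:
  "Im z > 0 \<Longrightarrow> m \<noteq> 0 \<Longrightarrow> of_int m * z + of_int n \<noteq> (0 :: complex)"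
  by (rule moebius_denominator_nonzero) auto

text \<open>The conditionally convergent double sum of \<open>1 / (m z + n)\<^sup>2\<close> is compared with the telescoping one of
  \<open>1 / (m z + n) - 1 / (m z + n + 1)\<close>; the difference converges absolutely.\<close>

lemma lattice_difference_summable:
  assumes z: "Im z > 0"
  shows "(\<lambda>(m :: int, n :: int). 1 / ((of_int m * z + of_int n) ^ 2 * (of_int m * z + of_int n + 1)))
    summable_on ((UNIV - {0}) \<times> UNIV)"
proof -
  define w where "w = (\<lambda>m n :: int. of_int m * z + of_int n)"
  define B where "B = (\<lambda>m n :: int. (1 + \<bar>real_of_int m\<bar>) powr (1 / 2) * (1 + \<bar>real_of_int n\<bar>) powr (1 / 2))"
  obtain c where c: "c > 0" "\<And>m n :: int. (m, n) \<noteq> (0, 0) \<Longrightarrow> c * B m n \<le> norm (w m n)"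
    using lattice_norm_ge_product[OF z] unfolding B_def w_def by blast
  have Bpos: "B m n > 0" for m n unfolding B_def by (intro mult_pos_pos) auto
  have shift: "B m n \<le> 2 * B m (n + 1)" for m n
  proof -
    have "\<bar>x\<bar> \<le> 3 + 4 * \<bar>x + 1\<bar>" for x :: real
      by (cases "x \<ge> 0"; cases "x + 1 \<ge> 0"; simp)
    from this[of "real_of_int n"]
    have "(1 + \<bar>real_of_int n\<bar>) powr (1 / 2) \<le> (4 * (1 + \<bar>real_of_int (n + 1)\<bar>)) powr (1 / 2)"
      by (intro powr_mono2) auto
    also have "\<dots> = 4 powr (1 / 2) * (1 + \<bar>real_of_int (n + 1)\<bar>) powr (1 / 2)"
      by (simp only: powr_mult)
    also have "4 powr (1 / 2) = (2 :: real)" by (simp add: powr_half_sqrt)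
    finally have "(1 + \<bar>real_of_int n\<bar>) powr (1 / 2) \<le> 2 * (1 + \<bar>real_of_int (n + 1)\<bar>) powr (1 / 2)" .
    from mult_left_mono[OF this, of "(1 + \<bar>real_of_int m\<bar>) powr (1 / 2)"] show ?thesis
      unfolding B_def by (simp add: mult_ac)
  qed
  show ?thesis
  proof (rule Infinite_Sum.abs_summable_summable, rule Infinite_Sum.abs_summable_on_comparison_test')
    show "(\<lambda>x. 2 / c ^ 3 * (case x of (m :: int, n :: int) \<Rightarrow>
        (1 + \<bar>real_of_int m\<bar>) powr (- 3 / 2) * (1 + \<bar>real_of_int n\<bar>) powr (- 3 / 2))) summable_on ((UNIV - {0}) \<times> UNIV)"
      using summable_on_int2_powr by (intro summable_on_cmult_right) (rule summable_on_subset, auto)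
  next
    fix x :: "int \<times> int" assume "x \<in> (UNIV - {0}) \<times> UNIV"
    then obtain m n where x: "x = (m, n)" "m \<noteq> 0" by (cases x) auto
    have 1: "c * B m n \<le> norm (w m n)" using c(2)[of m n] x by simp
    have "c * (B m n / 2) \<le> c * B m (n + 1)" using shift[of m n] c(1) by (intro mult_left_mono) auto
    also have "\<dots> \<le> norm (w m n + 1)" using c(2)[of m "n + 1"] x by (simp add: w_def add.assoc)
    finally have 2: "c * B m n / 2 \<le> norm (w m n + 1)" by simp
    have "norm (1 / (w m n ^ 2 * (w m n + 1))) = 1 / (norm (w m n) ^ 2 * norm (w m n + 1))"
      by (simp add: norm_divide norm_mult norm_power)
    also have "\<dots> \<le> 1 / ((c * B m n) ^ 2 * (c * B m n / 2))"
      using c(1) Bpos[of m n] 1 2 by (intro frac_le mult_mono power_mono mult_pos_pos) auto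
    also have "\<dots> = 2 / c ^ 3 * (1 / B m n ^ 3)"
      by (simp add: power_mult_distrib power2_eq_square power3_eq_cube mult_ac)
    also have "1 / B m n ^ 3 = (1 + \<bar>real_of_int m\<bar>) powr (- 3 / 2) * (1 + \<bar>real_of_int n\<bar>) powr (- 3 / 2)"
      unfolding B_def power_mult_distrib
      by (simp add: powr_power powr_minus_divide powr_minus field_simps)
    finally show "norm (case x of (m, n) \<Rightarrow> 1 / ((of_int m * z + of_int n) ^ 2 * (of_int m * z + of_int n + 1))) \<le>
        2 / c ^ 3 * (case x of (m, n) \<Rightarrow> (1 + \<bar>real_of_int m\<bar>) powr (- 3 / 2) * (1 + \<bar>real_of_int n\<bar>) powr (- 3 / 2))"
      by (simp add: x w_def)
  qed
qed

lemma telescope_difference: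
  fixes x :: complex
  assumes "x \<noteq> 0" "x + 1 \<noteq> 0"
  shows "1 / x - 1 / (x + 1) = 1 / x ^ 2 - 1 / (x ^ 2 * (x + 1))"
  using assms by (simp add: divide_simps) (simp add: algebra_simps power2_eq_square)

lemma telescope_row_has_sum:
  assumes z: "Im z > 0" and m: "m \<noteq> (0 :: int)"
    and s: "(\<lambda>n :: int. 1 / (of_int m * z + of_int n) - 1 / (of_int m * z + of_int n + 1)) summable_on UNIV"
  shows "((\<lambda>n :: int. 1 / (of_int m * z + of_int n) - 1 / (of_int m * z + of_int n + 1)) has_sum 0) UNIV"
proof -
  define w where "w = of_int m * z"
  have "((\<lambda>n :: int. 1 / (w + of_int n) - 1 / (w + of_int n + 1)) has_sum (1 / w + (0 - 1 / w))) UNIV"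
  proof (rule has_sum_int_split)
    show "(\<lambda>k. 1 / (w + of_int (int k)) - 1 / (w + of_int (int k) + 1)) sums (1 / w)"
      using telescope_sums'[OF tendsto_inverse_of_nat_add(1)[of w]] by (simp add: add_ac)
    show "(\<lambda>k. 1 / (w + of_int (- 1 - int k)) - 1 / (w + of_int (- 1 - int k) + 1)) sums (0 - 1 / w)"
      using telescope_sums[OF tendsto_inverse_of_nat_add(2)[of w]] by (simp add: algebra_simps)
  qed (use s in \<open>simp add: w_def\<close>)
  thus ?thesis by (simp add: w_def)
qed

text \<open>Each row of the telescoping series sums to 0, so the rows of \<open>d\<close> have the
  same sums as the rows of \<open>1 / (m z + n)^2\<close>. The iterated sum of weight two, taken
  over \<open>n\<close> and then over \<open>m\<close>, is therefore an absolutely convergent double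
  sum.\<close>

lemma lattice_difference_row:
  assumes z: "Im z > 0"
  defines "d \<equiv> (\<lambda>(m :: int, n :: int). 1 / ((of_int m * z + of_int n) ^ 2 * (of_int m * z + of_int n + 1)))"
  defines "T \<equiv> (\<lambda>m :: int. - 4 * of_real pi ^ 2 * lam2 (of_int \<bar>m\<bar> * z))"
  shows "m \<noteq> 0 \<Longrightarrow> ((\<lambda>n. d (m, n)) has_sum T m) UNIV"
    "(T has_sum infsum d ((UNIV - {0}) \<times> UNIV)) (UNIV - {0})"
proof -
  have d_sum: "d summable_on ((UNIV - {0}) \<times> UNIV)"
    unfolding d_def by (rule lattice_difference_summable[OF z])
  show *: "((\<lambda>n. d (m, n)) has_sum T m) UNIV" if m: "m \<noteq> 0" for m
  proof -
    define w where "w = (\<lambda>n :: int. of_int m * z + of_int n)"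
    have nz: "w n \<noteq> 0" "w n + 1 \<noteq> 0" for n
      using lattice_denominator_nonzero[OF z m, of n] lattice_denominator_nonzero[OF z m, of "n + 1"]
      by (simp_all add: w_def add.assoc)
    have eq: "1 / w n - 1 / (w n + 1) = 1 / w n ^ 2 - d (m, n)" for n
      using telescope_difference[OF nz] by (simp add: d_def w_def)
    have t: "((\<lambda>n. 1 / w n ^ 2) has_sum T m) UNIV"
      using row_has_sum(1)[OF z m] by (simp add: w_def T_def)
    have "(\<lambda>n. d (m, n)) summable_on UNIV"
      using summable_on_SigmaD1[of "\<lambda>m n. d (m, n)" "UNIV - {0}" "\<lambda>_. UNIV" m] d_sum m by simp
    then obtain D where D: "((\<lambda>n. d (m, n)) has_sum D) UNIV" by (auto simp: summable_on_def)
    have "((\<lambda>n. 1 / w n ^ 2 - d (m, n)) has_sum (T m - D)) UNIV" by (intro has_sum_diff t D)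
    hence *: "((\<lambda>n. 1 / w n - 1 / (w n + 1)) has_sum (T m - D)) UNIV" by (simp only: eq)
    hence "((\<lambda>n. 1 / w n - 1 / (w n + 1)) has_sum 0) UNIV"
      unfolding w_def by (intro telescope_row_has_sum[OF z m]) (rule has_sum_imp_summable)
    with * have "T m - D = 0" by (rule has_sum_unique)
    thus ?thesis using D by simp
  qed
  show "(T has_sum infsum d ((UNIV - {0}) \<times> UNIV)) (UNIV - {0})"
    by (rule has_sum_SigmaD[OF has_sum_infsum[OF d_sum]]) (use * in auto)
qed

lemma Im_neg_inverse: "Im z > 0 \<Longrightarrow> Im (- 1 / z) > 0"
  using moebius_act_upper[of "(0, -1, 1, 0)" z] by simp

text \<open>These are the two ends that remain of a row after telescoping from \<open>- L\<close> to
  \<open>L\<close>. Opposite values of \<open>m\<close> contribute equally, and summation over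
  \<open>m\<close> is the cotangent expansion at \<open>u = L / z\<close>.\<close>

lemma symmetric_pole_has_sum:
  assumes z: "Im z > 0" and L: "L > 0"
    and s: "(\<lambda>m :: int. 1 / (of_int m * z - of_nat L) - 1 / (of_int m * z + of_nat L)) summable_on (UNIV - {0})"
  shows "((\<lambda>m :: int. 1 / (of_int m * z - of_nat L) - 1 / (of_int m * z + of_nat L)) has_sum
    (2 / z * (z / of_nat L - of_real pi * cot (of_real pi * (of_nat L / z))))) (UNIV - {0})"
proof -
  define u where "u = of_nat L / z"
  have z0: "z \<noteq> 0" using z by auto
  define v where "v = 1 / z"
  have "u = of_nat L * v" by (simp add: u_def v_def)
  hence "Im u = real L * Im v" by simp
  moreover have "Im v < 0" using Im_neg_inverse[OF z] by (simp add: v_def)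
  ultimately have "Im u < 0" using L by (simp add: mult_pos_neg)
  hence u: "u \<notin> \<int>" using upper_not_Ints[of u] by simp
  define e where "e = (\<lambda>m :: int. 1 / (of_int m * z - of_nat L) - 1 / (of_int m * z + of_nat L))"
  have Lu: "of_nat L = u * z" using z0 by (simp add: u_def)
  have e1: "e (int (Suc k)) = 1 / z * (1 / (of_nat (Suc k) - u) - 1 / (of_nat (Suc k) + u))" for k
  proof -
    have "of_int (int (Suc k)) * z - of_nat L = z * (of_nat (Suc k) - u)"
      "of_int (int (Suc k)) * z + of_nat L = z * (of_nat (Suc k) + u)"
      by (simp_all add: Lu algebra_simps)
    thus ?thesis unfolding e_def by (simp only:) (simp add: right_diff_distrib)
  qed
  have e2: "e (- m) = e m" for m
  proof -
    have "of_int (- m) * z - of_nat L = - (of_int m * z + of_nat L)"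
      "of_int (- m) * z + of_nat L = - (of_int m * z - of_nat L)" by simp_all
    thus ?thesis unfolding e_def by (simp only: divide_minus_right) simp
  qed
  have 1: "(\<lambda>k. e (int (Suc k))) sums (1 / z * (1 / u - of_real pi * cot (of_real pi * u)))"
    unfolding e1 by (intro sums_mult cot_partial_fractions u)
  have "(e has_sum (1 / z * (1 / u - of_real pi * cot (of_real pi * u)) +
      1 / z * (1 / u - of_real pi * cot (of_real pi * u)))) (UNIV - {0})"
    by (rule has_sum_int_nonzero) (use s 1 in \<open>simp_all add: e2 e_def[symmetric] del: of_nat_Suc\<close>)
  also have "1 / z * (1 / u - of_real pi * cot (of_real pi * u)) +
      1 / z * (1 / u - of_real pi * cot (of_real pi * u)) =
      2 / z * (1 / u - of_real pi * cot (of_real pi * u))" by simp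
  also have "1 / u = z / of_nat L" by (simp add: u_def)
  finally show ?thesis by (simp add: e_def u_def)
qed

text \<open>As \<open>L\<close> grows, \<open>L / z\<close> moves off to infinity in the lower
  half-plane, where the cotangent tends to \<open>\<i>\<close>. The limit is the source of the
  non-modular term in weight two.\<close>

lemma tendsto_cot_pole:
  assumes z: "Im z > 0"
  shows "(\<lambda>L. 2 / z * (z / of_nat L - of_real pi * cot (of_real pi * (of_nat L / z)))) \<longlonglongrightarrow> - 2 * of_real pi * \<i> / z"
proof -
  have z0: "z \<noteq> 0" using z by auto
  define q where "q = nome 1 (- 1 / z)"
  have q: "norm q < 1" using nome_1_lt_1[OF Im_neg_inverse[OF z]] by (simp add: q_def)
  have 1: "(\<lambda>L. 2 / z * (z / of_nat L - of_real pi * (\<i> * (1 + q ^ L) / (1 - q ^ L)))) \<longlonglongrightarrow>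
      2 / z * (0 - of_real pi * (\<i> * (1 + 0) / (1 - 0)))"
    by (intro tendsto_intros LIMSEQ_power_zero q lim_const_over_n) auto
  have 2: "eventually (\<lambda>L. 2 / z * (z / of_nat L - of_real pi * (\<i> * (1 + q ^ L) / (1 - q ^ L))) =
      2 / z * (z / of_nat L - of_real pi * cot (of_real pi * (of_nat L / z)))) sequentially"
    using eventually_gt_at_top[of 0]
  proof eventually_elim
    case (elim L)
    have "Im (of_nat L * v) = real L * Im v" for v by simp
    hence "Im (of_nat L * (- 1 / z)) > 0" using elim Im_neg_inverse[OF z] by (simp only: mult_pos_pos of_nat_0_less_iff)
    from cot_pi_upper[OF this]
    have "cot (of_real pi * (of_nat L * (- 1 / z))) = - \<i> * (1 + q ^ L) / (1 - q ^ L)"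
      by (simp add: q_def nome_power)
    moreover have "of_real pi * (of_nat L * (- 1 / z)) = - (of_real pi * (of_nat L / z))" by simp
    ultimately have "cot (of_real pi * (of_nat L / z)) = \<i> * (1 + q ^ L) / (1 - q ^ L)"
      by (simp only: cot_minus) simp
    thus ?case by simp
  qed
  show ?thesis using Lim_transform_eventually[OF 1 2] by (simp add: mult.assoc)
qed

text \<open>The absolutely convergent sum of \<open>d\<close> is taken in both orders. By rows it is
  \<open>D\<close>. By columns, the squares form rows of the lattice sum at \<open>- 1 / z\<close>
  and give \<open>D' / z^2\<close> with corrections from \<open>m = 0\<close> and
  \<open>n = 0\<close>, while the telescoping part, which is 0 by rows, now tends to
  \<open>- 2 pi i / z\<close>.\<close>

theorem lam2_sum_transformation:
  assumes z: "Im z > 0"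
  assumes D: "((\<lambda>m :: int. - 4 * of_real pi ^ 2 * lam2 (of_int \<bar>m\<bar> * z)) has_sum D) (UNIV - {0})"
    and D': "((\<lambda>m :: int. - 4 * of_real pi ^ 2 * lam2 (of_int \<bar>m\<bar> * (- 1 / z))) has_sum D') (UNIV - {0})"
  shows "D = D' / z ^ 2 - of_real pi ^ 2 / 3 + of_real pi ^ 2 / 3 / z ^ 2 + 2 * of_real pi * \<i> / z"
proof -
  define z' where "z' = - 1 / z"
  have z0: "z \<noteq> 0" using z by auto
  have z': "Im z' > 0" unfolding z'_def by (rule Im_neg_inverse[OF z])
  define T' where "T' = (\<lambda>m :: int. - 4 * of_real pi ^ 2 * lam2 (of_int \<bar>m\<bar> * z'))"
  define A where "A = (UNIV - {0 :: int})"
  define w where "w = (\<lambda>m n :: int. of_int m * z + of_int n)"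
  define d where "d = (\<lambda>(m, n). 1 / (w m n ^ 2 * (w m n + 1)))"
  define s where "s = (\<lambda>m n. 1 / w m n - 1 / (w m n + 1))"
  \<comment> \<open>The sum of \<open>1 / (m z + n)^2\<close> over nonzero \<open>m\<close>: for
    \<open>n = 0\<close> it is twice the zeta value at 2 divided by \<open>z^2\<close>, and
    otherwise the full column with its entry at \<open>m = 0\<close> taken out.\<close>
  define C where "C = (\<lambda>n :: int. if n = 0 then of_real pi ^ 2 / 3 / z ^ 2 else T' n / z ^ 2 - 1 / of_int n ^ 2)"
  have d_sum: "d summable_on (A \<times> UNIV)"
    using lattice_difference_summable[OF z] by (simp add: d_def w_def A_def)
  have "D = infsum d (A \<times> UNIV)"
    using has_sum_unique[OF D lattice_difference_row(2)[OF z]] by (simp add: d_def w_def A_def)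
  hence dD: "(d has_sum D) (A \<times> UNIV)" using d_sum by simp
  have t_col: "((\<lambda>m. 1 / w m n ^ 2) has_sum C n) A" for n
  proof (cases "n = 0")
    case True
    have "((\<lambda>m. 1 / z ^ 2 * (1 / of_int m ^ 2)) has_sum (1 / z ^ 2 * (of_real pi ^ 2 / 3))) A"
      unfolding A_def by (intro has_sum_cmult_right zeta_2_has_sum)
    thus ?thesis using True by (simp add: w_def C_def power_mult_distrib mult.commute)
  next
    case False
    have "((\<lambda>m :: int. 1 / (of_int n * z' + of_int m) ^ 2) has_sum T' n) UNIV"
      unfolding T'_def by (rule row_has_sum(1)[OF z' False])
    hence "((\<lambda>m :: int. 1 / (of_int n * z' + of_int (- m)) ^ 2) has_sum T' n) UNIV"
      by (subst has_sum_reindex_bij_witness[of _ uminus uminus]) auto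
    hence "((\<lambda>m :: int. 1 / z ^ 2 * (1 / (of_int n * z' + of_int (- m)) ^ 2)) has_sum (1 / z ^ 2 * T' n)) UNIV"
      by (rule has_sum_cmult_right)
    also have "(\<lambda>m :: int. 1 / z ^ 2 * (1 / (of_int n * z' + of_int (- m)) ^ 2)) = (\<lambda>m. 1 / w m n ^ 2)"
    proof
      fix m :: int
      have "z * (of_int n * z' + of_int (- m)) = - w m n" using z0 by (simp add: z'_def w_def algebra_simps)
      hence "(z * (of_int n * z' + of_int (- m))) ^ 2 = w m n ^ 2" by simp
      thus "1 / z ^ 2 * (1 / (of_int n * z' + of_int (- m)) ^ 2) = 1 / w m n ^ 2"
        by (simp add: power_mult_distrib)
    qed
    finally have "((\<lambda>m. 1 / w m n ^ 2) has_sum (1 / z ^ 2 * T' n)) UNIV" .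
    moreover have "((\<lambda>m. 1 / w m n ^ 2) has_sum (1 / w 0 n ^ 2)) {0}"
      using has_sum_finite[of "{0}" "\<lambda>m. 1 / w m n ^ 2"] by simp
    ultimately have "((\<lambda>m. 1 / w m n ^ 2) has_sum (1 / z ^ 2 * T' n - 1 / w 0 n ^ 2)) (UNIV - {0})"
      by (rule has_sum_Diff) auto
    thus ?thesis using False by (simp add: A_def C_def w_def)
  qed
  have "\<forall>n. \<exists>x. ((\<lambda>m. d (m, n)) has_sum x) A"
  proof
    fix n
    have "(\<lambda>(n, m). d (m, n)) summable_on (UNIV \<times> A)"
      using d_sum by (subst summable_on_swap) (simp add: case_prod_unfold)
    from summable_on_SigmaD1[OF this, of n]
    show "\<exists>x. ((\<lambda>m. d (m, n)) has_sum x) A" by (auto simp: summable_on_def)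
  qed
  then obtain dcol where dcol: "\<And>n. ((\<lambda>m. d (m, n)) has_sum dcol n) A" by metis
  have dcol_sum: "(dcol has_sum D) UNIV"
  proof (rule has_sum_SigmaD)
    show "((\<lambda>(n, m). d (m, n)) has_sum D) (UNIV \<times> A)"
      using dD by (subst has_sum_swap) (simp add: case_prod_unfold)
  qed (use dcol in auto)
  have eq: "s m n = 1 / w m n ^ 2 - d (m, n)" if "m \<in> A" for m n
  proof -
    have nz: "w m n \<noteq> 0" "w m n + 1 \<noteq> 0"
      using lattice_denominator_nonzero[OF z, of m n] lattice_denominator_nonzero[OF z, of m "n + 1"] that
      by (simp_all add: w_def A_def add.assoc)
    thus ?thesis using telescope_difference[OF nz] by (simp add: s_def d_def)
  qed
  have s_col: "((\<lambda>m. s m n) has_sum (C n - dcol n)) A" for n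
  proof -
    have "((\<lambda>m. 1 / w m n ^ 2 - d (m, n)) has_sum (C n - dcol n)) A" by (intro has_sum_diff t_col dcol)
    thus ?thesis by (rule has_sum_cong[THEN iffD1, rotated]) (simp add: eq)
  qed
  have C_sum: "(C has_sum (D' / z ^ 2 - of_real pi ^ 2 / 3 + of_real pi ^ 2 / 3 / z ^ 2)) UNIV"
  proof -
    have "((\<lambda>n. T' n * (1 / z ^ 2) - 1 / of_int n ^ 2) has_sum (D' * (1 / z ^ 2) - of_real pi ^ 2 / 3)) A"
      using D' unfolding A_def T'_def z'_def by (intro has_sum_diff has_sum_cmult_left zeta_2_has_sum)
    also have "((\<lambda>n. T' n * (1 / z ^ 2) - 1 / of_int n ^ 2) has_sum (D' * (1 / z ^ 2) - of_real pi ^ 2 / 3)) A \<longleftrightarrow>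
        (C has_sum (D' * (1 / z ^ 2) - of_real pi ^ 2 / 3)) A"
      by (rule has_sum_cong) (auto simp: C_def A_def)
    finally have "(C has_sum (D' / z ^ 2 - of_real pi ^ 2 / 3)) A" by simp
    hence "(C has_sum (C 0 + (D' / z ^ 2 - of_real pi ^ 2 / 3))) (insert 0 A)"
      by (intro has_sum_insert) (auto simp: A_def)
    moreover have "insert 0 A = UNIV" by (auto simp: A_def)
    ultimately show ?thesis by (simp add: C_def algebra_simps)
  qed
  have lim1: "(\<lambda>L. \<Sum>n\<in>{- int L..<int L}. C n - dcol n) \<longlonglongrightarrow>
      D' / z ^ 2 - of_real pi ^ 2 / 3 + of_real pi ^ 2 / 3 / z ^ 2 - D"
    by (intro sums_pair_int has_sum_diff C_sum dcol_sum)
  have "eventually (\<lambda>L. (\<Sum>n\<in>{- int L..<int L}. C n - dcol n) =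
      2 / z * (z / of_nat L - of_real pi * cot (of_real pi * (of_nat L / z)))) sequentially"
    using eventually_gt_at_top[of 0]
  proof eventually_elim
    case (elim L)
    have "((\<lambda>m. \<Sum>n\<in>{- int L..<int L}. s m n) has_sum (\<Sum>n\<in>{- int L..<int L}. C n - dcol n)) A"
      by (intro has_sum_finite_sum s_col)
    moreover have "(\<Sum>n\<in>{- int L..<int L}. s m n) = 1 / (of_int m * z - of_nat L) - 1 / (of_int m * z + of_nat L)" for m
    proof -
      have "(\<Sum>n\<in>{- int L..<int L}. s m n) = (\<Sum>k<2 * L. s m (int k - int L))"
        by (rule sum.reindex_bij_witness[of _ "\<lambda>k. int k - int L" "\<lambda>n. nat (n + int L)"]) auto
      also have "\<dots> = (\<Sum>k<2 * L. 1 / w m (int k - int L) - 1 / w m (int (Suc k) - int L))"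
        by (simp add: s_def w_def algebra_simps)
      also have "\<dots> = 1 / w m (int 0 - int L) - 1 / w m (int (2 * L) - int L)"
        by (rule sum_lessThan_telescope')
      finally show ?thesis by (simp add: w_def)
    qed
    ultimately have "((\<lambda>m. 1 / (of_int m * z - of_nat L) - 1 / (of_int m * z + of_nat L)) has_sum
        (\<Sum>n\<in>{- int L..<int L}. C n - dcol n)) A" by simp
    moreover from this have "((\<lambda>m. 1 / (of_int m * z - of_nat L) - 1 / (of_int m * z + of_nat L)) has_sum
        (2 / z * (z / of_nat L - of_real pi * cot (of_real pi * (of_nat L / z))))) A"
      unfolding A_def by (intro symmetric_pole_has_sum[OF z elim]) (rule has_sum_imp_summable)
    ultimately show ?case by (rule has_sum_unique)
  qed
  hence "(\<lambda>L. \<Sum>n\<in>{- int L..<int L}. C n - dcol n) \<longlonglongrightarrow> - 2 * of_real pi * \<i> / z"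
    by (rule Lim_transform_eventually[OF tendsto_cot_pole[OF z] eventually_mono]) simp
  from LIMSEQ_unique[OF lim1 this] show ?thesis by (simp add: algebra_simps)
qed

subsection \<open>Lambert series\<close>

text \<open>Induction on \<open>s\<close> by termwise differentiation, which turns the coefficients
  \<open>k^s\<close> into \<open>(k + 1)^(s + 1)\<close>.\<close>

lemma summable_power_times_geometric:
  fixes q :: "'a :: {real_normed_field, banach}"
  assumes "norm q < 1"
  shows "summable (\<lambda>k. of_nat (Suc k) ^ s * q ^ k)"
  using assms
proof (induction s arbitrary: q)
  case 0
  thus ?case by (simp add: summable_geometric)
next
  case (Suc s)
  have "summable (\<lambda>k. of_nat k ^ s * x ^ k)" if "norm x < 1" for x :: 'a
  proof -
    have "summable (\<lambda>k. x * (of_nat (Suc k) ^ s * x ^ k))" by (intro summable_mult Suc.IH that)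
    hence "summable (\<lambda>k. of_nat (Suc k) ^ s * x ^ Suc k)" by (simp add: mult_ac)
    thus ?thesis by (subst (asm) summable_Suc_iff)
  qed
  from termdiff_converges[OF Suc.prems this] show ?case
    by (simp add: diffs_def mult_ac)
qed

lemma double_geometric_summable:
  fixes q :: complex
  assumes q: "norm q < 1"
  shows "(\<lambda>(m, k). of_nat (Suc k) ^ s * q ^ (Suc m * Suc k)) summable_on UNIV"
proof (rule Infinite_Sum.abs_summable_summable, rule Infinite_Sum.abs_summable_on_comparison_test')
  define r where "r = norm q"
  have r: "0 \<le> r" "r < 1" using q by (auto simp: r_def)
  have s1: "(\<lambda>k. real (Suc k) ^ s * r ^ k) summable_on UNIV"
    using summable_power_times_geometric[of r s] r by (intro summable_nonneg_imp_summable_on) auto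
  have s2: "(\<lambda>k. r ^ k) summable_on UNIV"
    using r by (intro summable_nonneg_imp_summable_on summable_geometric) auto
  have "(\<lambda>(m, k). r ^ m * (real (Suc k) ^ s * r ^ k)) summable_on UNIV \<times> UNIV"
  proof (rule summable_on_SigmaI)
    fix m :: nat
    show "((\<lambda>k. case (m, k) of (m, k) \<Rightarrow> r ^ m * (real (Suc k) ^ s * r ^ k)) has_sum
        r ^ m * infsum (\<lambda>k. real (Suc k) ^ s * r ^ k) UNIV) UNIV"
      unfolding prod.case by (intro has_sum_cmult_right has_sum_infsum s1)
    show "(\<lambda>m. r ^ m * infsum (\<lambda>k. real (Suc k) ^ s * r ^ k) UNIV) summable_on UNIV"
      by (intro summable_on_cmult_left s2)
  qed (use r in auto)
  thus "(\<lambda>(m, k). r ^ m * (real (Suc k) ^ s * r ^ k)) summable_on UNIV" by simp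
  fix x :: "nat \<times> nat"
  obtain m k where x: "x = (m, k)" by (cases x)
  have "r ^ (Suc m * Suc k) \<le> r ^ (m + k)" using r by (intro power_decreasing) auto
  hence "real (Suc k) ^ s * r ^ (Suc m * Suc k) \<le> real (Suc k) ^ s * r ^ (m + k)"
    by (intro mult_left_mono) auto
  thus "norm (case x of (m, k) \<Rightarrow> of_nat (Suc k) ^ s * q ^ (Suc m * Suc k)) \<le>
      (case x of (m, k) \<Rightarrow> r ^ m * (real (Suc k) ^ s * r ^ k))"
    by (simp add: x norm_mult norm_power r_def[symmetric] power_add mult_ac del: of_nat_Suc power_Suc mult_Suc mult_Suc_right)
qed

lemma norm_summable_has_sum_geometric:
  fixes q :: complex
  assumes "norm q < 1" "(\<lambda>k. of_nat (Suc k) ^ s * q ^ k) sums S"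
  shows "((\<lambda>k. of_nat (Suc k) ^ s * q ^ Suc k) has_sum (q * S)) UNIV"
proof (rule norm_summable_imp_has_sum)
  have "summable (\<lambda>k. norm q * (of_nat (Suc k) ^ s * norm q ^ k))"
    using assms(1) by (intro summable_mult summable_power_times_geometric) auto
  thus "summable (\<lambda>k. norm (of_nat (Suc k) ^ s * q ^ Suc k))"
    by (simp add: norm_mult norm_power mult_ac del: of_nat_Suc)
  have "(\<lambda>k. q * (of_nat (Suc k) ^ s * q ^ k)) sums (q * S)" by (intro sums_mult assms(2))
  thus "(\<lambda>k. of_nat (Suc k) ^ s * q ^ Suc k) sums (q * S)" by (simp add: mult_ac)
qed

text \<open>An index shift gives \<open>A s - 1\<close> as \<open>q\<close> times the sum of
  \<open>(k + 2)^s q^k\<close>. Expanding \<open>(k + 2)^s\<close> in powers of \<open>k + 1\<close>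
  expresses \<open>A s\<close> through the lower ones, and the equations are solved for
  \<open>s = 2\<close> and \<open>s = 3\<close> in turn.\<close>

lemma cube_geometric_sums:
  fixes q :: complex
  assumes q: "norm q < 1"
  shows "(\<lambda>k. of_nat (Suc k) ^ 3 * q ^ k) sums ((1 + 4 * q + q ^ 2) / (1 - q) ^ 4)"
proof -
  define A where "A = (\<lambda>s. \<Sum>k. of_nat (Suc k) ^ s * q ^ k)"
  define t where "t = 1 - q"
  have t: "t \<noteq> 0" using q by (auto simp: t_def)
  have q_eq: "q = 1 - t" by (simp add: t_def)
  have A: "(\<lambda>k. of_nat (Suc k) ^ s * q ^ k) sums A s" for s
    unfolding A_def using summable_power_times_geometric[OF q] by (rule summable_sums)
  have shift: "(\<lambda>k. q * (of_nat (Suc (Suc k)) ^ s * q ^ k)) sums (A s - 1)" for s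
    using A[of s] sums_Suc_iff[of "\<lambda>k. of_nat (Suc k) ^ s * q ^ k" "A s - 1"] by (simp add: mult_ac)
  have A0: "A 0 = 1 / t"
    using sums_unique2[OF A[of 0]] geometric_sums[OF q] by (simp add: t_def)
  have A1: "A 1 = 1 / t ^ 2"
    using sums_unique2[OF A[of 1]] geometric_deriv_sums[OF q] by (simp add: t_def)
  have "(\<lambda>k. q * (of_nat (Suc k) ^ 2 * q ^ k + (2 * (of_nat (Suc k) ^ 1 * q ^ k) + of_nat (Suc k) ^ 0 * q ^ k)))
      sums (q * (A 2 + (2 * A 1 + A 0)))"
    by (intro sums_mult sums_add A)
  also have "(\<lambda>k. q * (of_nat (Suc k) ^ 2 * q ^ k + (2 * (of_nat (Suc k) ^ 1 * q ^ k) + of_nat (Suc k) ^ 0 * q ^ k))) =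
      (\<lambda>k. q * (of_nat (Suc (Suc k)) ^ 2 * q ^ k))"
    by (simp add: fun_eq_iff power2_eq_square algebra_simps)
  finally have "A 2 - 1 = q * (A 2 + (2 * A 1 + A 0))"
    using shift[of 2] by (rule sums_unique2[rotated])
  hence "A 2 * t = 1 + q * (2 * A 1 + A 0)" by (simp add: t_def algebra_simps)
  hence A2: "A 2 = (2 - t) / t ^ 3"
    unfolding A0 A1 q_eq using t by (simp add: field_simps power2_eq_square power3_eq_cube)
  have "(\<lambda>k. q * (of_nat (Suc k) ^ 3 * q ^ k + (3 * (of_nat (Suc k) ^ 2 * q ^ k) +
      (3 * (of_nat (Suc k) ^ 1 * q ^ k) + of_nat (Suc k) ^ 0 * q ^ k))))
      sums (q * (A 3 + (3 * A 2 + (3 * A 1 + A 0))))"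
    by (intro sums_mult sums_add A)
  also have "(\<lambda>k. q * (of_nat (Suc k) ^ 3 * q ^ k + (3 * (of_nat (Suc k) ^ 2 * q ^ k) +
      (3 * (of_nat (Suc k) ^ 1 * q ^ k) + of_nat (Suc k) ^ 0 * q ^ k)))) =
      (\<lambda>k. q * (of_nat (Suc (Suc k)) ^ 3 * q ^ k))"
    by (simp add: fun_eq_iff power2_eq_square power3_eq_cube algebra_simps)
  finally have "A 3 - 1 = q * (A 3 + (3 * A 2 + (3 * A 1 + A 0)))"
    using shift[of 3] by (rule sums_unique2[rotated])
  hence "A 3 * t = 1 + q * (3 * A 2 + (3 * A 1 + A 0))" by (simp add: t_def algebra_simps)
  hence "A 3 * t ^ 4 = t ^ 3 * (1 + q * (3 * A 2 + (3 * A 1 + A 0)))"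
    by (simp add: power4_eq_xxxx power3_eq_cube mult_ac)
  also have "\<dots> = 1 + 4 * q + q ^ 2"
    unfolding A0 A1 A2 q_eq using t by (simp add: field_simps power2_eq_square power3_eq_cube)
  finally have "A 3 = (1 + 4 * q + q ^ 2) / (1 - q) ^ 4" using t by (simp add: field_simps t_def[symmetric])
  thus ?thesis using A[of 3] by simp
qed

lemma lambert_rows:
  fixes q :: complex
  assumes q: "norm q < 1"
  shows "((\<lambda>k. of_nat (Suc k) ^ 1 * q ^ (Suc m * Suc k)) has_sum q ^ Suc m / (1 - q ^ Suc m) ^ 2) UNIV"
    "((\<lambda>k. of_nat (Suc k) ^ 3 * q ^ (Suc m * Suc k)) has_sum
       q ^ Suc m * (1 + 4 * q ^ Suc m + (q ^ Suc m) ^ 2) / (1 - q ^ Suc m) ^ 4) UNIV"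
    "((\<lambda>k. of_nat n * q ^ (Suc k * Suc m)) has_sum of_nat n * (q ^ Suc m / (1 - q ^ Suc m))) UNIV"
proof -
  define x where "x = q ^ Suc m"
  have x: "norm x < 1" unfolding x_def norm_power using q by (simp add: power_less_one_iff del: power_Suc)
  have x1: "q ^ (Suc m * k) = x ^ k" for k by (simp only: x_def power_mult)
  have x2: "q ^ (k * Suc m) = x ^ k" for k by (simp only: mult.commute[of k] x1)
  show "((\<lambda>k. of_nat (Suc k) ^ 1 * q ^ (Suc m * Suc k)) has_sum q ^ Suc m / (1 - q ^ Suc m) ^ 2) UNIV"
    unfolding x1 x_def[symmetric]
    using norm_summable_has_sum_geometric[OF x, of 1 "1 / (1 - x) ^ 2"] geometric_deriv_sums[OF x] by simp
  show "((\<lambda>k. of_nat (Suc k) ^ 3 * q ^ (Suc m * Suc k)) has_sum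
       q ^ Suc m * (1 + 4 * q ^ Suc m + (q ^ Suc m) ^ 2) / (1 - q ^ Suc m) ^ 4) UNIV"
    unfolding x1 x_def[symmetric]
    using norm_summable_has_sum_geometric[OF x cube_geometric_sums[OF x]] by simp
  have "((\<lambda>k. x ^ Suc k) has_sum (x * (1 / (1 - x)))) UNIV"
    using norm_summable_has_sum_geometric[OF x, of 0 "1 / (1 - x)"] geometric_sums[OF x] by simp
  thus "((\<lambda>k. of_nat n * q ^ (Suc k * Suc m)) has_sum of_nat n * (q ^ Suc m / (1 - q ^ Suc m))) UNIV"
    unfolding x2 x_def[symmetric] by (intro has_sum_cmult_right) simp
qed

text \<open>The generating function of the divisor sums \<open>sigma_1\<close>;
  \<open>1 - 24 * lambert1 q\<close> is the normalized Eisenstein series of weight two.\<close>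

definition lambert1 :: "complex \<Rightarrow> complex" where
  "lambert1 q = (\<Sum>k. of_nat (Suc k) * (q ^ Suc k / (1 - q ^ Suc k)))"

text \<open>Both forms come from one double series with terms \<open>k q^(m k)\<close>. The first
  arises from the logarithmic derivative of the Euler product, the second from the rows of the
  lattice sum; their equality links the eta function to lattices.\<close>

lemma lambert1_has_sum:
  fixes q :: complex
  assumes q: "norm q < 1"
  shows "((\<lambda>k. of_nat (Suc k) * (q ^ Suc k / (1 - q ^ Suc k))) has_sum lambert1 q) UNIV"
    "((\<lambda>m. q ^ Suc m / (1 - q ^ Suc m) ^ 2) has_sum lambert1 q) UNIV"
proof -
  obtain S where S: "((\<lambda>(m, k). of_nat (Suc k) ^ 1 * q ^ (Suc m * Suc k)) has_sum S) (UNIV \<times> UNIV)"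
    using double_geometric_summable[OF q, of 1] by (auto simp: summable_on_def)
  have 1: "((\<lambda>m. q ^ Suc m / (1 - q ^ Suc m) ^ 2) has_sum S) UNIV"
    by (rule has_sum_SigmaD[OF S]) (use lambert_rows(1)[OF q] in simp)
  have "((\<lambda>(k, m). of_nat (Suc k) ^ 1 * q ^ (Suc m * Suc k)) has_sum S) (UNIV \<times> UNIV)"
    using S by (subst (asm) has_sum_swap) simp
  hence 2: "((\<lambda>k. of_nat (Suc k) * (q ^ Suc k / (1 - q ^ Suc k))) has_sum S) UNIV"
    by (rule has_sum_SigmaD) (use lambert_rows(3)[OF q] in \<open>simp del: of_nat_Suc\<close>)
  hence "lambert1 q = S" using has_sum_imp_sums sums_unique unfolding lambert1_def by metis
  thus "((\<lambda>k. of_nat (Suc k) * (q ^ Suc k / (1 - q ^ Suc k))) has_sum lambert1 q) UNIV"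
    "((\<lambda>m. q ^ Suc m / (1 - q ^ Suc m) ^ 2) has_sum lambert1 q) UNIV" using 1 2 by simp_all
qed

text \<open>Collecting the terms \<open>k^3 q^(m k)\<close> by the value of \<open>m k\<close>
  yields divisor sums. The shifts by one in the bijection arise because the factors and the exponent
  all start at \<open>Suc 0\<close>.\<close>

lemma sigma_3_has_sum:
  fixes q :: complex
  assumes q: "norm q < 1"
  obtains S where "((\<lambda>m. q ^ Suc m * (1 + 4 * q ^ Suc m + (q ^ Suc m) ^ 2) / (1 - q ^ Suc m) ^ 4) has_sum S) UNIV"
    "((\<lambda>n. of_nat (\<Sum>k | k dvd Suc n. k ^ 3) * q ^ Suc n) has_sum S) UNIV"
proof -
  obtain S where S: "((\<lambda>(m, k). of_nat (Suc k) ^ 3 * q ^ (Suc m * Suc k)) has_sum S) (UNIV \<times> UNIV)"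
    using double_geometric_summable[OF q, of 3] by (auto simp: summable_on_def)
  have 1: "((\<lambda>m. q ^ Suc m * (1 + 4 * q ^ Suc m + (q ^ Suc m) ^ 2) / (1 - q ^ Suc m) ^ 4) has_sum S) UNIV"
    by (rule has_sum_SigmaD[OF S]) (use lambert_rows(2)[OF q] in simp)
  have "((\<lambda>(n, k). of_nat k ^ 3 * q ^ Suc n) has_sum S) (SIGMA n:UNIV. {k. k dvd Suc n})"
  proof (subst has_sum_reindex_bij_witness[of _ "\<lambda>(m, k). (Suc m * Suc k - 1, Suc k)"
      "\<lambda>(n, k). (Suc n div k - 1, k - 1)"])
    show "((\<lambda>(m, k). of_nat (Suc k) ^ 3 * q ^ (Suc m * Suc k)) has_sum S) (UNIV \<times> UNIV)" by (rule S)
  next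
    fix a :: "nat \<times> nat" assume "a \<in> (SIGMA n:UNIV. {k. k dvd Suc n})"
    then obtain n k l where a: "a = (n, k)" "Suc n = k * l" by (auto elim!: dvdE)
    hence pos: "k > 0" "l > 0" by (auto intro!: Nat.gr0I)
    hence "n = l * k - 1" using a by (simp add: mult.commute)
    thus "(case case a of (n, k) \<Rightarrow> (Suc n div k - 1, k - 1) of (m, k) \<Rightarrow> (Suc m * Suc k - 1, Suc k)) = a"
      using pos a by (simp del: mult_Suc mult_Suc_right)
    show "(case case a of (n, k) \<Rightarrow> (Suc n div k - 1, k - 1) of
        (m, k) \<Rightarrow> of_nat (Suc k) ^ 3 * q ^ (Suc m * Suc k)) = (case a of (n, k) \<Rightarrow> of_nat k ^ 3 * q ^ Suc n)"
      using pos a by (simp del: mult_Suc mult_Suc_right power_Suc add: mult.commute)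
  next
    fix b :: "nat \<times> nat"
    obtain m k where b: "b = (m, k)" by (cases b)
    show "(case case b of (m, k) \<Rightarrow> (Suc m * Suc k - 1, Suc k) of (n, k) \<Rightarrow> (Suc n div k - 1, k - 1)) = b"
      by (simp add: b del: mult_Suc mult_Suc_right)
    show "(case b of (m, k) \<Rightarrow> (Suc m * Suc k - 1, Suc k)) \<in> (SIGMA n:UNIV. {k. k dvd Suc n})"
      by (simp add: b del: mult_Suc mult_Suc_right)
  qed auto
  hence "((\<lambda>n. \<Sum>k | k dvd Suc n. of_nat k ^ 3 * q ^ Suc n) has_sum S) UNIV"
    by (rule has_sum_SigmaD) (auto intro!: has_sum_finiteI)
  hence "((\<lambda>n. of_nat (\<Sum>k | k dvd Suc n. k ^ 3) * q ^ Suc n) has_sum S) UNIV"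
    by (simp add: sum_distrib_right)
  with 1 show ?thesis by (rule that)
qed

text \<open>With \<open>E2 = 1 - 24 * lambert1\<close> this is the quasi-modular law
  \<open>E2(z) = E2(- 1 / z) / z^2 + 6 i / (pi z)\<close>. The factor \<open>- 8 pi^2\<close>
  divided out is twice \<open>- 4 pi^2\<close>, the rows \<open>m\<close> and \<open>- m\<close>
  being equal.\<close>

lemma lambert1_transformation:
  assumes z: "Im z > 0"
  shows "lambert1 (nome 1 z) = lambert1 (nome 1 (- 1 / z)) / z ^ 2 - (1 / z ^ 2 - 1) / 24 - \<i> / (4 * of_real pi * z)"
proof -
  have *: "((\<lambda>m :: int. - 4 * of_real pi ^ 2 * lam2 (of_int \<bar>m\<bar> * z)) has_sum
      (- 8 * of_real pi ^ 2 * lambert1 (nome 1 z))) (UNIV - {0})" if z: "Im z > 0" for z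
  proof -
    have q: "norm (nome 1 z) < 1" by (rule nome_1_lt_1[OF z])
    define T where "T = (\<lambda>m :: int. - 4 * of_real pi ^ 2 * lam2 (of_int \<bar>m\<bar> * z))"
    have "(\<lambda>k. - 4 * of_real pi ^ 2 * (nome 1 z ^ Suc k / (1 - nome 1 z ^ Suc k) ^ 2)) sums
        (- 4 * of_real pi ^ 2 * lambert1 (nome 1 z))"
      by (intro sums_mult has_sum_imp_sums lambert1_has_sum(2) q)
    hence "(\<lambda>k. T (int (Suc k))) sums (- 4 * of_real pi ^ 2 * lambert1 (nome 1 z))"
      "(\<lambda>k. T (- int (Suc k))) sums (- 4 * of_real pi ^ 2 * lambert1 (nome 1 z))"
      unfolding T_def lam2_def nome_power[of 1 z "Suc k" for k] abs_minus_cancel abs_of_nat of_int_of_nat_eq by simp_all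
    moreover have "T summable_on UNIV - {0}"
      unfolding T_def using lattice_difference_row(2)[OF z] by (rule has_sum_imp_summable)
    ultimately have "(T has_sum (- 4 * of_real pi ^ 2 * lambert1 (nome 1 z) + - 4 * of_real pi ^ 2 * lambert1 (nome 1 z)))
        (UNIV - {0})" by (intro has_sum_int_nonzero)
    also have "- 4 * of_real pi ^ 2 * lambert1 (nome 1 z) + - 4 * of_real pi ^ 2 * lambert1 (nome 1 z) =
        - 8 * of_real pi ^ 2 * lambert1 (nome 1 z)" by simp
    finally show ?thesis by (simp only: T_def)
  qed
  have z0: "z \<noteq> 0" using z by auto
  have nz: "- 8 * of_real pi ^ 2 \<noteq> (0 :: complex)" by simp
  define a b where "a = lambert1 (nome 1 z)" and "b = lambert1 (nome 1 (- 1 / z))"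
  have "- 8 * of_real pi ^ 2 * a = (- 8 * of_real pi ^ 2 * b) / z ^ 2 - of_real pi ^ 2 / 3 +
      of_real pi ^ 2 / 3 / z ^ 2 + 2 * of_real pi * \<i> / z"
    unfolding a_def b_def by (rule lam2_sum_transformation[OF z *[OF z] *[OF Im_neg_inverse[OF z]]])
  hence "a = ((- 8 * of_real pi ^ 2 * b) / z ^ 2 - of_real pi ^ 2 / 3 +
      of_real pi ^ 2 / 3 / z ^ 2 + 2 * of_real pi * \<i> / z) / (- 8 * of_real pi ^ 2)"
    by (metis nonzero_mult_div_cancel_left nz)
  also have "\<dots> = b / z ^ 2 - (1 / z ^ 2 - 1) / 24 - \<i> / (4 * of_real pi * z)"
    using z0 by (simp add: field_simps power2_eq_square)
  finally show ?thesis by (simp add: a_def b_def)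
qed

subsection \<open>The Eisenstein series of weight four\<close>

text \<open>The row \<open>m = 0\<close> gives twice the zeta value at 4, namely
  \<open>pi^4 / 45\<close>. The other rows give \<open>16 / 3 * pi^4 * S\<close>, and
  \<open>45 * 16 / 3 = 240\<close> is the constant of the Eisenstein series.\<close>

lemma eisenstein_E4_lattice_sum:
  assumes z: "Im z > 0"
  shows "((\<lambda>(m :: int, n :: int). 1 / (of_int m * z + of_int n) ^ 4) has_sum
    (of_real pi ^ 4 / 45 * eisenstein_E4 z)) (UNIV - {(0, 0)})"
proof -
  define f where "f = (\<lambda>(m :: int, n :: int). 1 / (of_int m * z + of_int n) ^ 4)"
  define q where "q = nome 1 z"
  have q: "norm q < 1" unfolding q_def by (rule nome_1_lt_1[OF z])
  obtain S where S: "((\<lambda>m. q ^ Suc m * (1 + 4 * q ^ Suc m + (q ^ Suc m) ^ 2) / (1 - q ^ Suc m) ^ 4) has_sum S) UNIV"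
    "((\<lambda>n. of_nat (\<Sum>k | k dvd Suc n. k ^ 3) * q ^ Suc n) has_sum S) UNIV"
    using sigma_3_has_sum[OF q] by blast
  have E4: "eisenstein_E4 z = 1 + 240 * S"
    using sums_unique[OF has_sum_imp_sums[OF S(2)]] unfolding eisenstein_E4_def q_def[symmetric] by simp
  have fsum: "f summable_on UNIV - {(0, 0)}"
    unfolding f_def using lattice_sum_summable[OF z, of 4] by simp
  hence row0_sum: "f summable_on {0} \<times> (UNIV - {0})" and rows_sum: "f summable_on (UNIV - {0}) \<times> UNIV"
    by (rule summable_on_subset; auto)+
  have "(\<lambda>n. 1 / of_int n ^ 4 :: complex) summable_on (UNIV - {0 :: int})"
  proof -
    have "(\<lambda>n. f (0, n)) summable_on (UNIV - {0})"
      using row0_sum summable_on_SigmaD1[of "\<lambda>m n. f (m, n)" "{0}" "\<lambda>_. UNIV - {0}" 0] by simp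
    thus ?thesis by (simp add: f_def)
  qed
  hence "((\<lambda>n :: int. 1 / of_int n ^ 4 :: complex) has_sum (of_real pi ^ 4 / 90 + of_real pi ^ 4 / 90)) (UNIV - {0})"
  proof (rule has_sum_int_nonzero)
    show "(\<lambda>k. 1 / of_int (int (Suc k)) ^ 4 :: complex) sums (of_real pi ^ 4 / 90)"
      using zeta_4_sums by (simp only: of_int_of_nat_eq)
    have "of_int (- int (Suc k)) ^ 4 = (of_nat (Suc k) ^ 4 :: complex)" for k
      by (simp only: of_int_minus power_minus_even[of 4] even_numeral of_int_of_nat_eq)
    thus "(\<lambda>k. 1 / of_int (- int (Suc k)) ^ 4 :: complex) sums (of_real pi ^ 4 / 90)"
      using zeta_4_sums by (simp only:)
  qed
  hence row0: "((\<lambda>n. f (0, n)) has_sum (of_real pi ^ 4 / 45)) (UNIV - {0})" by (simp add: f_def)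
  have "(f has_sum (of_real pi ^ 4 / 45)) ({0} \<times> (UNIV - {0}))"
    by (rule has_sum_SigmaI[OF _ _ row0_sum, where g = "\<lambda>_. of_real pi ^ 4 / 45"])
       (use row0 in \<open>auto intro!: has_sum_finiteI\<close>)
  moreover have "(f has_sum (8 / 3 * of_real pi ^ 4 * S + 8 / 3 * of_real pi ^ 4 * S)) ((UNIV - {0}) \<times> UNIV)"
  proof (rule has_sum_SigmaI[OF _ _ rows_sum])
    show "((\<lambda>n. f (m, n)) has_sum (8 / 3 * of_real pi ^ 4 * lam4 (of_int \<bar>m\<bar> * z))) UNIV" if "m \<in> UNIV - {0}" for m
      using row_has_sum(2)[OF z, of m] that by (simp add: f_def)
    define T where "T = (\<lambda>m :: int. 8 / 3 * of_real pi ^ 4 * lam4 (of_int \<bar>m\<bar> * z))"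
    have "T summable_on UNIV - {0}"
    proof (rule has_sum_imp_summable, rule has_sum_SigmaD[OF has_sum_infsum[OF rows_sum]])
      show "((\<lambda>n. f (m, n)) has_sum T m) UNIV" if "m \<in> UNIV - {0}" for m
        using row_has_sum(2)[OF z, of m] that by (simp add: f_def T_def)
    qed
    moreover have "(\<lambda>k. 8 / 3 * of_real pi ^ 4 * (q ^ Suc k * (1 + 4 * q ^ Suc k + (q ^ Suc k) ^ 2) / (1 - q ^ Suc k) ^ 4)) sums
        (8 / 3 * of_real pi ^ 4 * S)"
      by (intro sums_mult has_sum_imp_sums S(1))
    hence "(\<lambda>k. T (int (Suc k))) sums (8 / 3 * of_real pi ^ 4 * S)"
      "(\<lambda>k. T (- int (Suc k))) sums (8 / 3 * of_real pi ^ 4 * S)"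
      unfolding T_def lam4_def q_def nome_power[of 1 z "Suc k" for k] abs_minus_cancel abs_of_nat of_int_of_nat_eq
      by simp_all
    ultimately show "(T has_sum (8 / 3 * of_real pi ^ 4 * S + 8 / 3 * of_real pi ^ 4 * S)) (UNIV - {0})"
      by (rule has_sum_int_nonzero)
  qed
  ultimately have "(f has_sum (of_real pi ^ 4 / 45 + (8 / 3 * of_real pi ^ 4 * S + 8 / 3 * of_real pi ^ 4 * S)))
      ({0} \<times> (UNIV - {0}) \<union> (UNIV - {0}) \<times> UNIV)"
    by (rule has_sum_Un_disjoint) auto
  moreover have "{0} \<times> (UNIV - {0}) \<union> (UNIV - {0}) \<times> UNIV = UNIV - {(0 :: int, 0 :: int)}" by auto
  moreover have "of_real pi ^ 4 / 45 + (8 / 3 * of_real pi ^ 4 * S + 8 / 3 * of_real pi ^ 4 * S) =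
      of_real pi ^ 4 / 45 * eisenstein_E4 z" by (simp add: E4 field_simps)
  ultimately have "(f has_sum (of_real pi ^ 4 / 45 * eisenstein_E4 z)) (UNIV - {(0, 0)})"
    by (simp only:)
  thus ?thesis by (simp add: f_def)
qed

lemma eisenstein_E4_transformation:
  assumes z: "Im z > 0"
  shows "eisenstein_E4 (- 1 / z) = z ^ 4 * eisenstein_E4 z"
proof -
  have z0: "z \<noteq> 0" using z by auto
  have "((\<lambda>(m :: int, n :: int). 1 / (of_int m * (- 1 / z) + of_int n) ^ 4) has_sum
      (z ^ 4 * (of_real pi ^ 4 / 45 * eisenstein_E4 z))) (UNIV - {(0, 0)})"
  proof -
    have "((\<lambda>x. z ^ 4 * (case x of (m :: int, n :: int) \<Rightarrow> 1 / (of_int m * z + of_int n) ^ 4)) has_sum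
        (z ^ 4 * (of_real pi ^ 4 / 45 * eisenstein_E4 z))) (UNIV - {(0, 0)})"
      by (intro has_sum_cmult_right eisenstein_E4_lattice_sum z)
    also have "?this \<longleftrightarrow> ?thesis"
    proof (rule has_sum_reindex_bij_witness[of _ "\<lambda>(m, n). (n, - m)" "\<lambda>(m, n). (- n, m)"])
      fix a :: "int \<times> int"
      obtain m n where a: "a = (m, n)" by (cases a)
      have "of_int (- n) * (- 1 / z) + of_int m = (of_int m * z + of_int n) / z" using z0 by (simp add: field_simps)
      thus "(case case a of (m, n) \<Rightarrow> (- n, m) of (m, n) \<Rightarrow> 1 / (of_int m * (- 1 / z) + of_int n) ^ 4) =
          z ^ 4 * (case a of (m, n) \<Rightarrow> 1 / (of_int m * z + of_int n) ^ 4)"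
        by (simp only: a prod.case power_divide) simp
    qed auto
    finally show ?thesis .
  qed
  from has_sum_unique[OF eisenstein_E4_lattice_sum[OF Im_neg_inverse[OF z]] this]
  show ?thesis by simp
qed

definition E4_series :: "complex fps" where
  "E4_series = Abs_fps (\<lambda>n. if n = 0 then 1 else 240 * of_nat (\<Sum>k | k dvd n. k ^ 3))"

lemma E4_series:
  shows "fps_conv_radius E4_series \<ge> 1" "Im z > 0 \<Longrightarrow> eisenstein_E4 z = eval_fps E4_series (nome 1 z)"
proof -
  have sums: "\<exists>S. (\<lambda>n. fps_nth E4_series n * q ^ n) sums (1 + 240 * S) \<and>
      (\<lambda>n. of_nat (\<Sum>k | k dvd Suc n. k ^ 3) * q ^ Suc n) sums S" if q: "norm q < 1" for q :: complex
  proof -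
    obtain S where "((\<lambda>n. of_nat (\<Sum>k | k dvd Suc n. k ^ 3) * q ^ Suc n) has_sum S) UNIV"
      using sigma_3_has_sum[OF q] by blast
    hence S: "(\<lambda>n. of_nat (\<Sum>k | k dvd Suc n. k ^ 3) * q ^ Suc n) sums S" by (rule has_sum_imp_sums)
    hence "(\<lambda>n. 240 * (of_nat (\<Sum>k | k dvd Suc n. k ^ 3) * q ^ Suc n)) sums (240 * S)" by (rule sums_mult)
    hence "(\<lambda>n. fps_nth E4_series (Suc n) * q ^ Suc n) sums (240 * S)" by (simp add: E4_series_def mult.assoc)
    hence "(\<lambda>n. fps_nth E4_series n * q ^ n) sums (240 * S + fps_nth E4_series 0 * q ^ 0)"
      by (subst (asm) sums_Suc_iff)
    thus ?thesis using S by (intro exI[of _ S]) (simp add: E4_series_def add.commute)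
  qed
  show "fps_conv_radius E4_series \<ge> 1" unfolding fps_conv_radius_def
  proof (rule conv_radius_geI_ex)
    fix r :: real assume r: "0 < r" "ereal r < 1"
    thus "\<exists>z. norm z = r \<and> summable (\<lambda>n. fps_nth E4_series n * z ^ n)"
      using sums[of "of_real r"] by (intro exI[of _ "of_real r"]) (auto simp: sums_iff one_ereal_def)
  qed
  show "eisenstein_E4 z = eval_fps E4_series (nome 1 z)" if "Im z > 0"
    using sums[OF nome_1_lt_1[OF that]] unfolding eisenstein_E4_def eval_fps_def by (auto simp: sums_iff)
qed

subsection \<open>The Dedekind eta function\<close>

text \<open>The eta function without its fractional power of \<open>q\<close>, as a function of
  \<open>w = nome 1 z\<close>; in this form it is holomorphic at the cusp
  \<open>w = 0\<close>.\<close>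

definition euler_phi :: "complex \<Rightarrow> complex" where
  "euler_phi w = (\<Prod>n. 1 - w ^ Suc n)"

lemma convergent_euler_product:
  fixes w :: complex
  assumes "norm w < 1"
  shows "convergent_prod (\<lambda>n. 1 - w ^ Suc n)"
proof -
  have "summable (\<lambda>n. norm w * norm w ^ n)" using assms by (intro summable_mult summable_geometric) auto
  hence "summable (\<lambda>n. norm (1 - w ^ Suc n - 1))" by (simp add: norm_mult norm_power)
  thus ?thesis
    by (intro abs_convergent_prod_imp_convergent_prod) (simp only: abs_convergent_prod_conv_summable)
qed

lemma euler_phi_nonzero:
  assumes "norm w < 1"
  shows "euler_phi w \<noteq> 0"
  unfolding euler_phi_def
proof (rule prodinf_nonzero[OF convergent_euler_product[OF assms]])
  fix n
  have "norm (w ^ Suc n) < 1" unfolding norm_power using assms by (simp add: power_less_one_iff del: power_Suc)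
  thus "1 - w ^ Suc n \<noteq> 0" by auto
qed

lemma euler_phi_0 [simp]: "euler_phi 0 = 1"
  by (simp add: euler_phi_def)

lemma euler_phi_uniform_limit:
  assumes r: "r < 1"
  shows "uniform_limit (cball 0 r) (\<lambda>n w. \<Prod>k<n. 1 - w ^ Suc k) euler_phi sequentially"
proof -
  have "uniformly_convergent_on (cball 0 r) (\<lambda>n (w :: complex). \<Prod>k<n. 1 - w ^ Suc k)"
  proof (rule uniformly_convergent_on_prod')
    show "uniformly_convergent_on (cball 0 r) (\<lambda>n (w :: complex). \<Sum>k<n. norm (1 - w ^ Suc k - 1))"
    proof (rule Weierstrass_m_test')
      fix n :: nat and w :: complex assume "w \<in> cball 0 r"
      hence "norm w \<le> \<bar>r\<bar>" by auto
      hence "norm w ^ Suc n \<le> \<bar>r\<bar> ^ Suc n" by (intro power_mono) auto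
      \<comment> \<open>For negative \<open>r\<close> the disc is empty; the case distinction keeps
        the majorant nonnegative and summable there.\<close>
      thus "norm (norm (1 - w ^ Suc n - 1)) \<le> (if r < 0 then 0 else r ^ Suc n)"
        using \<open>w \<in> cball 0 r\<close> norm_ge_zero[of w] by (auto simp: norm_power[symmetric] simp del: power_Suc norm_ge_zero)
    next
      have "summable (\<lambda>n. r * r ^ n)" if "r \<ge> 0" using r that by (intro summable_mult summable_geometric) auto
      thus "summable (\<lambda>n. if r < 0 then 0 else r ^ Suc n)" by (cases "r < 0") auto
    qed
  qed (auto intro!: continuous_intros)
  hence lim: "uniform_limit (cball 0 r) (\<lambda>n (w :: complex). \<Prod>k<n. 1 - w ^ Suc k)
      (\<lambda>w. lim (\<lambda>n. \<Prod>k<n. 1 - w ^ Suc k)) sequentially"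
    by (simp only: uniformly_convergent_uniform_limit_iff)
  have "lim (\<lambda>n. \<Prod>k<n. 1 - w ^ Suc k) = euler_phi w" if "w \<in> cball 0 r" for w :: complex
  proof (rule limI)
    have "norm w < 1" using that r by simp
    from convergent_prod_LIMSEQ[OF convergent_euler_product[OF this]]
    have "(\<lambda>n. \<Prod>k<Suc n. 1 - w ^ Suc k) \<longlonglongrightarrow> euler_phi w"
      unfolding euler_phi_def lessThan_Suc_atMost .
    thus "(\<lambda>n. \<Prod>k<n. 1 - w ^ Suc k) \<longlonglongrightarrow> euler_phi w" by (rule LIMSEQ_imp_Suc)
  qed
  with lim show ?thesis by (subst uniform_limit_cong'[where g = "\<lambda>n w. \<Prod>k<n. 1 - w ^ Suc k"]) auto
qed

lemma holomorphic_euler_phi: "euler_phi holomorphic_on ball 0 1"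
proof (rule holomorphic_uniform_sequence)
  fix w :: complex assume w: "w \<in> ball 0 1"
  define d where "d = (1 - norm w) / 2"
  have d: "d > 0" using w by (simp add: d_def)
  have sub: "cball w d \<subseteq> cball 0 ((1 + norm w) / 2)"
  proof
    fix x assume "x \<in> cball w d"
    hence "norm (x - w) \<le> d" by (simp add: dist_norm norm_minus_commute)
    hence "norm x \<le> norm w + d" using norm_triangle_sub[of x w] by linarith
    thus "x \<in> cball 0 ((1 + norm w) / 2)" by (simp add: d_def field_simps)
  qed
  have "cball 0 ((1 + norm w) / 2) \<subseteq> ball (0 :: complex) 1" using w by auto
  moreover have "uniform_limit (cball w d) (\<lambda>n w. \<Prod>k<n. 1 - w ^ Suc k) euler_phi sequentially"
    by (rule uniform_limit_on_subset[OF euler_phi_uniform_limit sub]) (use w in auto)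
  ultimately show "\<exists>d. 0 < d \<and> cball w d \<subseteq> ball 0 1 \<and>
      uniform_limit (cball w d) (\<lambda>n w. \<Prod>k<n. 1 - w ^ Suc k) euler_phi sequentially"
    using d sub by (intro exI[of _ d]) auto
qed (auto intro!: holomorphic_intros)

lemma euler_phi_logderiv:
  assumes w: "norm w < 1"
  shows "(euler_phi has_field_derivative deriv euler_phi w) (at w)"
    "w * deriv euler_phi w = - lambert1 w * euler_phi w"
proof -
  show "(euler_phi has_field_derivative deriv euler_phi w) (at w)"
    by (rule holomorphic_derivI[OF holomorphic_euler_phi]) (use w in auto)
  define r where "r = (1 + norm w) / 2"
  have r: "norm w < r" "r < 1" using w by (auto simp: r_def)
  have "(\<lambda>k. deriv (\<lambda>w. 1 - w ^ Suc k) w / (1 - w ^ Suc k)) sums (deriv euler_phi w / euler_phi w)"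
  proof (rule logderiv_prodinf_complex_uniform_limit)
    show "uniform_limit (ball 0 r) (\<lambda>n w. \<Prod>k<n. 1 - w ^ Suc k) euler_phi sequentially"
      by (rule uniform_limit_on_subset[OF euler_phi_uniform_limit[OF r(2)]]) auto
  qed (use r euler_phi_nonzero[OF w] in \<open>auto intro!: holomorphic_intros\<close>)
  moreover have "deriv (\<lambda>w. 1 - w ^ Suc k) w = - (of_nat (Suc k) * w ^ k)" for k
    by (rule DERIV_imp_deriv) (auto intro!: derivative_eq_intros simp del: power_Suc)
  ultimately have "(\<lambda>k. - (of_nat (Suc k) * w ^ k) / (1 - w ^ Suc k)) sums (deriv euler_phi w / euler_phi w)"
    by (simp only:)
  hence "(\<lambda>k. - w * (- (of_nat (Suc k) * w ^ k) / (1 - w ^ Suc k))) sums (- w * (deriv euler_phi w / euler_phi w))"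
    by (rule sums_mult)
  hence "(\<lambda>k. of_nat (Suc k) * (w ^ Suc k / (1 - w ^ Suc k))) sums (- w * (deriv euler_phi w / euler_phi w))"
    by (simp add: mult_ac)
  moreover have "(\<lambda>k. of_nat (Suc k) * (w ^ Suc k / (1 - w ^ Suc k))) sums lambert1 w"
    by (rule has_sum_imp_sums[OF lambert1_has_sum(1)[OF w]])
  ultimately have "lambert1 w = - w * (deriv euler_phi w / euler_phi w)" by (rule sums_unique2[rotated])
  thus "w * deriv euler_phi w = - lambert1 w * euler_phi w" using euler_phi_nonzero[OF w] by simp
qed

lemma dedekind_eta_eq: "dedekind_eta z = nome 24 z * euler_phi (nome 1 z)"
  by (simp add: dedekind_eta_def euler_phi_def)

lemma dedekind_eta_power_24: "dedekind_eta z ^ 24 = nome 1 z * euler_phi (nome 1 z) ^ 24"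
  using nome_mult_power[of 24 1 z] by (simp add: dedekind_eta_eq power_mult_distrib)

lemma dedekind_eta_nonzero: "Im z > 0 \<Longrightarrow> dedekind_eta z \<noteq> 0"
  using euler_phi_nonzero[OF nome_1_lt_1] by (simp add: dedekind_eta_eq)

lemma holomorphic_nome: "h > 0 \<Longrightarrow> nome h holomorphic_on A"
  unfolding nome_def by (intro holomorphic_intros) auto

lemma holomorphic_dedekind_eta: "dedekind_eta holomorphic_on upper_half_plane"
proof -
  have "(\<lambda>z. euler_phi (nome 1 z)) holomorphic_on upper_half_plane"
    by (rule holomorphic_on_compose_gen[OF holomorphic_nome holomorphic_euler_phi, unfolded o_def])
       (auto simp: upper_half_plane_def nome_1_lt_1[simplified])
  hence "(\<lambda>z. nome 24 z * euler_phi (nome 1 z)) holomorphic_on upper_half_plane"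
    by (intro holomorphic_intros holomorphic_nome) auto
  thus ?thesis by (simp add: dedekind_eta_eq[abs_def])
qed

lemma has_field_derivative_nome_1: "(nome 1 has_field_derivative 2 * of_real pi * \<i> * nome 1 z) (at z)"
  unfolding nome_def by (auto intro!: derivative_eq_intros)

text \<open>The logarithmic derivative of the discriminant is \<open>2 pi i\<close> times the
  Eisenstein series of weight two.\<close>

lemma eta_power_24_deriv:
  assumes z: "Im z > 0"
  shows "((\<lambda>z. dedekind_eta z ^ 24) has_field_derivative
    dedekind_eta z ^ 24 * (2 * of_real pi * \<i> * (1 - 24 * lambert1 (nome 1 z)))) (at z)"
proof -
  define q where "q = nome 1 z"
  define E where "E = euler_phi q"
  have q: "norm q < 1" unfolding q_def by (rule nome_1_lt_1[OF z])
  have "((\<lambda>z. euler_phi (nome 1 z)) has_field_derivative deriv euler_phi q * (2 * of_real pi * \<i> * q)) (at z)"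
    unfolding q_def by (rule DERIV_chain2[OF euler_phi_logderiv(1)[OF q[unfolded q_def]] has_field_derivative_nome_1])
  also have "deriv euler_phi q * (2 * of_real pi * \<i> * q) = 2 * of_real pi * \<i> * (q * deriv euler_phi q)"
    by (simp only: mult_ac)
  finally have *: "((\<lambda>z. euler_phi (nome 1 z)) has_field_derivative
      2 * of_real pi * \<i> * (- lambert1 q * E)) (at z)"
    unfolding euler_phi_logderiv(2)[OF q] E_def .
  have "((\<lambda>z. nome 1 z * euler_phi (nome 1 z) ^ 24) has_field_derivative
      q * (24 * (2 * of_real pi * \<i> * (- lambert1 q * E) * E ^ 23)) + 2 * of_real pi * \<i> * q * E ^ 24) (at z)"
    by (rule derivative_eq_intros has_field_derivative_nome_1 * refl)+ (simp add: q_def E_def)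
  also have "q * (24 * (2 * of_real pi * \<i> * (- lambert1 q * E) * E ^ 23)) + 2 * of_real pi * \<i> * q * E ^ 24 =
      q * E ^ 24 * (2 * of_real pi * \<i> * (1 - 24 * lambert1 q))"
  proof -
    have "E ^ 24 = E * E ^ 23" by (simp flip: power_Suc)
    thus ?thesis by (simp only: algebra_simps) simp
  qed
  finally show ?thesis unfolding dedekind_eta_power_24 q_def E_def .
qed

text \<open>The quasi-modular term of the weight-two series is exactly the logarithmic derivative of
  \<open>z^12\<close>, so the quotient \<open>h\<close> of the two sides has derivative 0. Its value
  is found at the fixed point \<open>\<i>\<close>, where \<open>\<i>^12 = 1\<close>.\<close>

lemma eta_power_24_transformation:
  assumes z: "Im z > 0"
  shows "dedekind_eta (- 1 / z) ^ 24 = z ^ 12 * dedekind_eta z ^ 24"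
proof -
  define \<Delta> where "\<Delta> = (\<lambda>z. dedekind_eta z ^ 24)"
  define L where "L = (\<lambda>z. 2 * of_real pi * \<i> * (1 - 24 * lambert1 (nome 1 z)))"
  have \<Delta>': "(\<Delta> has_field_derivative \<Delta> z * L z) (at z)" if "Im z > 0" for z
    unfolding \<Delta>_def L_def by (rule eta_power_24_deriv[OF that])
  define h where "h = (\<lambda>z. \<Delta> (- 1 / z) / (z ^ 12 * \<Delta> z))"
  have "(h has_field_derivative 0) (at z)" if z: "Im z > 0" for z
  proof -
    have z0: "z \<noteq> 0" using z by auto
    have nz: "\<Delta> z \<noteq> 0" using dedekind_eta_nonzero[OF z] by (simp add: \<Delta>_def)
    have "((\<lambda>z. - 1 / z) has_field_derivative 1 / z ^ 2) (at z)"
      using z0 by (auto intro!: derivative_eq_intros simp: power2_eq_square)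
    from DERIV_chain2[OF \<Delta>'[OF Im_neg_inverse[OF z]] this]
    have 1: "((\<lambda>z. \<Delta> (- 1 / z)) has_field_derivative \<Delta> (- 1 / z) * L (- 1 / z) * (1 / z ^ 2)) (at z)" .
    have 2: "((\<lambda>z. z ^ 12 * \<Delta> z) has_field_derivative 12 * z ^ 11 * \<Delta> z + z ^ 12 * (\<Delta> z * L z)) (at z)"
      by (rule derivative_eq_intros \<Delta>'[OF z] refl)+ simp
    \<comment> \<open>The number 12 is \<open>- 2 pi i\<close> times the coefficient
      \<open>6 i / pi\<close> of the quasi-modular term.\<close>
    have L_eq: "L z = L (- 1 / z) / z ^ 2 - 12 / z"
      unfolding L_def lambert1_transformation[OF z] using z0
      by (simp add: field_simps power2_eq_square)
    have "(h has_field_derivative (\<Delta> (- 1 / z) * L (- 1 / z) * (1 / z ^ 2) * (z ^ 12 * \<Delta> z) -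
        \<Delta> (- 1 / z) * (12 * z ^ 11 * \<Delta> z + z ^ 12 * (\<Delta> z * L z))) / (z ^ 12 * \<Delta> z * (z ^ 12 * \<Delta> z))) (at z)"
      unfolding h_def by (rule DERIV_divide[OF 1 2]) (use z0 nz in auto)
    also have "\<Delta> (- 1 / z) * L (- 1 / z) * (1 / z ^ 2) * (z ^ 12 * \<Delta> z) -
        \<Delta> (- 1 / z) * (12 * z ^ 11 * \<Delta> z + z ^ 12 * (\<Delta> z * L z)) =
        \<Delta> (- 1 / z) * \<Delta> z * (z ^ 12 * (L (- 1 / z) / z ^ 2 - 12 / z - L z))"
    proof -
      have "z ^ 12 * (12 / z) = 12 * z ^ 11" using z0 by (simp add: field_simps flip: power_Suc)
      thus ?thesis by (simp add: algebra_simps)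
    qed
    also have "L (- 1 / z) / z ^ 2 - 12 / z - L z = 0" by (simp add: L_eq)
    finally show ?thesis by simp
  qed
  hence "\<exists>c. \<forall>z\<in>upper_half_plane. h z = c"
    by (intro has_field_derivative_zero_constant[OF convex_upper_half_plane])
       (auto simp: upper_half_plane_def intro: has_field_derivative_at_within)
  then obtain c where c: "\<And>z. Im z > 0 \<Longrightarrow> h z = c" by (auto simp: upper_half_plane_def)
  have "h \<i> = 1"
  proof -
    have "- 1 / \<i> = \<i>" by simp
    moreover have "\<i> ^ 12 = 1" using power_mult[of \<i> 4 3] by simp
    moreover have "\<Delta> \<i> \<noteq> 0" using dedekind_eta_nonzero[of \<i>] by (simp add: \<Delta>_def)
    ultimately have "h \<i> = \<Delta> \<i> / \<Delta> \<i>" unfolding h_def by (simp only: mult_1_left)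
    thus ?thesis using \<open>\<Delta> \<i> \<noteq> 0\<close> by simp
  qed
  hence "c = 1" using c[of \<i>] by simp
  hence "h z = 1" using c[OF z] by simp
  moreover have "z \<noteq> 0" using z by auto
  moreover have "\<Delta> z \<noteq> 0" using dedekind_eta_nonzero[OF z] by (simp add: \<Delta>_def)
  ultimately have "\<Delta> (- 1 / z) = z ^ 12 * \<Delta> z" unfolding h_def by (simp add: divide_eq_eq)
  thus ?thesis by (simp add: \<Delta>_def)
qed

lemma eta_power_24_plus_1: "dedekind_eta (z + 1) ^ 24 = dedekind_eta z ^ 24"
  using nome_1_plus_of_int[of z 1] by (simp add: dedekind_eta_power_24)

text \<open>The sixth power of the quantity involves only the 24th power of eta, whose behaviour
  under \<open>z + 1\<close> and \<open>- 1 / z\<close> is known. Sixth roots of nonnegative reals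
  are unique, so no root of unity has to be followed.\<close>

lemma eta_norm_invariant:
  assumes "\<gamma> \<in> SL2Z" "Im z > 0"
  shows "norm (dedekind_eta (moebius_act \<gamma> z)) ^ 4 * Im (moebius_act \<gamma> z) = norm (dedekind_eta z) ^ 4 * Im z"
proof -
  define \<psi> where "\<psi> = (\<lambda>z. (norm (dedekind_eta z) ^ 4 * Im z) ^ 6)"
  have \<psi>_eq: "\<psi> z = norm (dedekind_eta z ^ 24) * Im z ^ 6" for z
    by (simp add: \<psi>_def power_mult_distrib norm_power power_mult[symmetric])
  have "\<psi> (moebius_act \<gamma> z) = \<psi> z"
  proof (rule SL2Z_invariantI[OF _ _ assms])
    show "\<psi> (z + 1) = \<psi> z" for z by (simp add: \<psi>_eq eta_power_24_plus_1)
    show "\<psi> (- 1 / z) = \<psi> z" if "Im z > 0" for z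
    proof -
      have z0: "norm z > 0" using that by auto
      have "Im (- 1 / z) = Im z / norm z ^ 2"
        using moebius_act_Im[of 0 "-1" 1 0 z] that by simp
      thus ?thesis unfolding \<psi>_eq eta_power_24_transformation[OF that]
        using z0 by (simp add: norm_mult norm_power power_divide power_mult[symmetric])
    qed
  qed
  moreover have "Im (moebius_act \<gamma> z) > 0" using assms by (intro moebius_act_upper) (auto simp: SL2Z_iff)
  ultimately show ?thesis using assms(2) unfolding \<psi>_def by (subst (asm) power_eq_iff_eq_base) auto
qed

subsection \<open>Hauptmoduln are determined up to a constant\<close>

text \<open>In \<open>f - J\<close> the poles at infinity cancel and every cusp becomes regular.
  This serves level 18, where \<open>j\<close> is a Hauptmodul by definition, and level 1, where
  \<open>modular_j\<close> is shown to be invariant itself.\<close>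

lemma hauptmodul_unique:
  assumes N: "N > 0" and J: "hauptmodul N J" and f: "f holomorphic_on upper_half_plane"
    and inv: "\<And>\<gamma> z. \<gamma> \<in> Gamma0 N \<Longrightarrow> Im z > 0 \<Longrightarrow> f (moebius_act \<gamma> z) = f z"
    and cusps: "\<And>a b c d. (a, b, c, d) \<in> SL2Z \<Longrightarrow> \<not> int N dvd c \<Longrightarrow>
      regular_at_infinity (\<lambda>z. f (moebius_act (a, b, c, d) z))"
    and pole: "regular_at_infinity (\<lambda>z. f z - inverse (nome 1 z))"
  obtains c where "\<And>z. Im z > 0 \<Longrightarrow> f z = J z + c"
proof -
  define g where "g = (\<lambda>z. f z - J z)"
  have g_inv: "g (moebius_act \<gamma> z) = g z" if "\<gamma> \<in> Gamma0 N" "Im z > 0" for \<gamma> z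
    using inv[OF that] hauptmodul_invariant[OF J that] by (simp add: g_def)
  have "regular_at_infinity (\<lambda>z. (f z - inverse (nome 1 z)) - (J z - inverse (nome 1 z)))"
    by (intro regular_at_infinity_diff pole hauptmodul_minus_pole(1)[OF J])
  hence g_reg: "regular_at_infinity g" by (simp add: g_def)
  have "\<exists>c. \<forall>z. Im z > 0 \<longrightarrow> g z = c"
  proof (rule constant_if_regular_at_cusps[OF N, of g])
    show "g holomorphic_on upper_half_plane"
      unfolding g_def by (intro holomorphic_intros f hauptmodul_holomorphic[OF J])
  next
    fix \<gamma> assume \<gamma>: "\<gamma> \<in> SL2Z"
    obtain p q r s where eq: "\<gamma> = (p, q, r, s)" by (cases \<gamma>) auto
    show "regular_at_infinity (\<lambda>z. g (moebius_act \<gamma> z))"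
    proof (cases "int N dvd r")
      case True
      have \<gamma>N: "\<gamma> \<in> Gamma0 N" using \<gamma> True by (simp add: eq Gamma0_def)
      have "eventually (\<lambda>z. g (moebius_act \<gamma> z) = g z) i_infinity"
        using eventually_Im_gt_i_infinity[of 0] by eventually_elim (rule g_inv[OF \<gamma>N])
      thus ?thesis using g_reg by (subst regular_at_infinity_cong)
    next
      case False
      show ?thesis unfolding g_def eq
        using cusps[OF _ False] hauptmodul_regular_at_other_cusps[OF J _ False] \<gamma>
        by (intro regular_at_infinity_diff) (auto simp: eq)
    qed
  next
    fix c assume "\<And>z. Im z > 0 \<Longrightarrow> g z = c"
    thus "\<exists>c. \<forall>z. Im z > 0 \<longrightarrow> g z = c" by blast
  qed (simp add: g_inv)
  then obtain c where "\<And>z. Im z > 0 \<Longrightarrow> g z = c" by blast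
  thus ?thesis by (intro that[of c]) (simp add: g_def algebra_simps)
qed

text \<open>Because \<open>E 0 = 1\<close>, the difference is \<open>(E w - E 0) / w\<close> at
  \<open>w = nome 1 z\<close>, which has a removable singularity at 0.\<close>

lemma regular_minus_simple_pole:
  assumes "E analytic_on {0}" "E 0 = 1" "eventually (\<lambda>z. f z = inverse (nome 1 z) * E (nome 1 z)) i_infinity"
  shows "regular_at_infinity (\<lambda>z. f z - inverse (nome 1 z))"
proof (rule regular_at_infinityI[of 1])
  show "(\<lambda>w. if w = 0 then deriv E 0 else E w / w - E 0 / (w - 0)) analytic_on {0}"
    by (rule pole_theorem_analytic[OF assms(1)]) (auto intro!: exI[of _ 1])
  show "eventually (\<lambda>z. f z - inverse (nome 1 z) =
      (if nome 1 z = 0 then deriv E 0 else E (nome 1 z) / nome 1 z - E 0 / (nome 1 z - 0))) i_infinity"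
    using assms(3) by eventually_elim (simp add: assms(2) divide_inverse mult.commute)
qed auto

lemma analytic_euler_phi: "euler_phi analytic_on {0}"
  using holomorphic_euler_phi by (auto simp: analytic_at intro!: exI[of _ "ball 0 1"])

lemma holomorphic_E4: "eisenstein_E4 holomorphic_on upper_half_plane"
proof -
  have "(\<lambda>z. eval_fps E4_series (nome 1 z)) holomorphic_on upper_half_plane"
  proof (rule holomorphic_on_compose_gen[OF holomorphic_nome holomorphic_on_eval_fps, unfolded o_def])
    show "nome 1 ` upper_half_plane \<subseteq> eball 0 (fps_conv_radius E4_series)"
    proof
      fix w assume "w \<in> nome 1 ` upper_half_plane"
      hence "ereal (norm w) < 1" using nome_1_lt_1 by (auto simp: upper_half_plane_def one_ereal_def)
      hence "ereal (norm w) < fps_conv_radius E4_series" using E4_series(1) by (rule less_le_trans)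
      thus "w \<in> eball 0 (fps_conv_radius E4_series)" by simp
    qed
  qed auto
  also have "?this \<longleftrightarrow> ?thesis"
    by (rule holomorphic_cong) (auto simp: upper_half_plane_def E4_series(2))
  finally show ?thesis .
qed

text \<open>Numerator and denominator both have weight 12, so invariance under the two generators is
  immediate. At level 1 there is no cusp besides infinity, and the condition on other cusps is
  vacuous.\<close>

lemma modular_j_eq_hauptmodul:
  assumes J: "hauptmodul 1 J"
  obtains c where "\<And>z. Im z > 0 \<Longrightarrow> modular_j z = J z + c"
proof (rule hauptmodul_unique[OF zero_less_one J, of modular_j])
  show "modular_j holomorphic_on upper_half_plane"
    unfolding modular_j_def
    by (intro holomorphic_intros holomorphic_E4 holomorphic_dedekind_eta)
       (auto simp: upper_half_plane_def dedekind_eta_nonzero)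
next
  fix \<gamma> z assume "\<gamma> \<in> Gamma0 1" "Im z > 0"
  thus "modular_j (moebius_act \<gamma> z) = modular_j z"
  proof (intro SL2Z_invariantI)
    fix z :: complex assume z: "Im z > 0"
    have "eisenstein_E4 (z + 1) = eisenstein_E4 z"
      using nome_1_plus_of_int[of z 1] by (simp add: eisenstein_E4_def)
    thus "modular_j (z + 1) = modular_j z" by (simp add: modular_j_def eta_power_24_plus_1)
    have "z \<noteq> 0" using z by auto
    thus "modular_j (- 1 / z) = modular_j z"
      unfolding modular_j_def eisenstein_E4_transformation[OF z] eta_power_24_transformation[OF z]
      by (simp add: power_mult_distrib power_mult[symmetric])
  qed (auto simp: Gamma0_imp_SL2Z)
next
  define E where "E = (\<lambda>w. eval_fps E4_series w ^ 3 / euler_phi w ^ 24)"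
  have "fps_conv_radius E4_series > 0" using E4_series(1) by (rule less_le_trans[rotated]) simp
  hence "ereal 0 < fps_conv_radius E4_series" by (simp add: zero_ereal_def)
  hence "E analytic_on {0}" unfolding E_def by (intro analytic_intros analytic_euler_phi) auto
  moreover have "E 0 = 1" by (simp add: E_def eval_fps_at_0 E4_series_def)
  moreover have "eventually (\<lambda>z. modular_j z = inverse (nome 1 z) * E (nome 1 z)) i_infinity"
    using eventually_Im_gt_i_infinity[of 0]
    by eventually_elim
       (simp add: modular_j_def E4_series(2) dedekind_eta_power_24[simplified] E_def divide_simps)
  ultimately show "regular_at_infinity (\<lambda>z. modular_j z - inverse (nome 1 z))"
    by (rule regular_minus_simple_pole)
next
  fix c assume "\<And>z. Im z > 0 \<Longrightarrow> modular_j z = J z + c"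
  thus ?thesis by (rule that)
qed auto

subsection \<open>Eta quotients\<close>

definition eta_quotient :: "nat set \<Rightarrow> (nat \<Rightarrow> int) \<Rightarrow> complex \<Rightarrow> complex" where
  "eta_quotient D r z = (\<Prod>\<delta>\<in>D. dedekind_eta (of_nat \<delta> * z) powi r \<delta>)"

text \<open>The shape an eta quotient takes after a substitution from \<open>SL2Z\<close>: each
  argument \<open>\<delta> z\<close> is replaced by an upper triangular image of
  \<open>z\<close>.\<close>

definition eta_product ::
    "nat set \<Rightarrow> (nat \<Rightarrow> int) \<Rightarrow> (nat \<Rightarrow> nat \<times> nat \<times> nat) \<Rightarrow> complex \<Rightarrow> complex" where
  "eta_product D r K z = (\<Prod>\<delta>\<in>D. dedekind_eta (moebius_act (hmat (K \<delta>)) z) powi r \<delta>)"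

lemma eta_quotient_eq_product: "eta_quotient D r = eta_product D r (\<lambda>\<delta>. (\<delta>, 0, 1))"
  by (simp add: fun_eq_iff eta_quotient_def eta_product_def)

lemma prod_power_int_const:
  fixes x :: "'a :: field"
  assumes "x \<noteq> 0"
  shows "(\<Prod>i\<in>I. x powi f i) = x powi (\<Sum>i\<in>I. f i)"
  by (induction I rule: infinite_finite_induct) (use assms in \<open>auto simp: power_int_add\<close>)

lemma norm_prod_power_int:
  fixes f :: "'i \<Rightarrow> complex"
  shows "norm (\<Prod>i\<in>I. f i powi r i) ^ n = (\<Prod>i\<in>I. (norm (f i) ^ n) powi r i)"
proof -
  have "(x powi m) ^ n = (x ^ n) powi m" for x :: real and m
    by (simp only: power_int_power power_int_power' mult.commute)
  thus ?thesis by (simp only: prod_norm[symmetric] norm_power_int prod_power_distrib)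
qed

lemma regular_at_infinity_power_int:
  assumes "regular_at_infinity f" "(f \<longlongrightarrow> c) i_infinity" "c \<noteq> 0"
  shows "regular_at_infinity (\<lambda>z. f z powi n)"
proof (cases n rule: int_cases2)
  case (nonneg k)
  thus ?thesis using regular_at_infinity_power[OF assms(1), of k] by simp
next
  case (nonpos k)
  thus ?thesis
    using regular_at_infinity_power[OF regular_at_infinity_inverse[OF assms], of k]
    by (simp add: power_int_minus power_inverse)
qed

lemma regular_at_infinity_prod:
  assumes "\<And>i. i \<in> I \<Longrightarrow> regular_at_infinity (f i)"
  shows "regular_at_infinity (\<lambda>z. \<Prod>i\<in>I. f i z)"
  using assms by (induction I rule: infinite_finite_induct) (auto intro!: regular_at_infinity_mult)

lemma filterlim_affine_i_infinity:
  assumes "a > 0" "e > 0"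
  shows "filterlim (\<lambda>z. (of_nat a * z + of_int b) / of_nat e) i_infinity i_infinity"
  unfolding filterlim_iff using eventually_affine_i_infinity[OF _ assms] by blast

lemma euler_phi_regular:
  "regular_at_infinity (\<lambda>z. euler_phi (nome 1 z))" "((\<lambda>z. euler_phi (nome 1 z)) \<longlongrightarrow> 1) i_infinity"
proof -
  show "regular_at_infinity (\<lambda>z. euler_phi (nome 1 z))"
    by (rule regular_at_infinityI[of 1, OF _ analytic_euler_phi]) auto
  have "(euler_phi \<longlongrightarrow> 1) (at 0)"
    using analytic_at_imp_isCont[OF analytic_euler_phi] by (simp add: isCont_def)
  thus "((\<lambda>z. euler_phi (nome 1 z)) \<longlongrightarrow> 1) i_infinity"
    by (rule filterlim_compose[OF _ filterlim_nome]) simp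
qed

text \<open>The fractional powers of \<open>q\<close> are collected in a single exponential, whose
  exponent is the order at the cusp and may be fractional; the Euler products are collected in
  \<open>U\<close>.\<close>

lemma eta_product_expansion:
  assumes fin: "finite D" and K: "\<And>\<delta>. \<delta> \<in> D \<Longrightarrow> K \<delta> = (a \<delta>, b \<delta>, e \<delta>) \<and> a \<delta> > 0 \<and> e \<delta> > 0"
  obtains U where "regular_at_infinity U" "(U \<longlongrightarrow> 1) i_infinity"
    "\<And>z. eta_product D r K z = (\<Prod>\<delta>\<in>D. nome 24 (of_nat (b \<delta>) / of_nat (e \<delta>)) powi r \<delta>) *
       exp (2 * of_real pi * \<i> * (\<Sum>\<delta>\<in>D. of_int (r \<delta>) * of_nat (a \<delta>) / (24 * of_nat (e \<delta>))) * z) * U z"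
proof
  define U where "U = (\<lambda>z. \<Prod>\<delta>\<in>D. euler_phi (nome 1 (moebius_act (hmat (K \<delta>)) z)) powi r \<delta>)"
  have *: "regular_at_infinity (\<lambda>z. euler_phi (nome 1 (moebius_act (hmat (K \<delta>)) z)))"
    "((\<lambda>z. euler_phi (nome 1 (moebius_act (hmat (K \<delta>)) z))) \<longlongrightarrow> 1) i_infinity" if \<delta>: "\<delta> \<in> D" for \<delta>
  proof -
    note K = K[OF \<delta>]
    show "regular_at_infinity (\<lambda>z. euler_phi (nome 1 (moebius_act (hmat (K \<delta>)) z)))"
      using regular_at_infinity_affine[OF euler_phi_regular(1), of "a \<delta>" "e \<delta>" "int (b \<delta>)"] K by simp
    show "((\<lambda>z. euler_phi (nome 1 (moebius_act (hmat (K \<delta>)) z))) \<longlongrightarrow> 1) i_infinity"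
      using filterlim_compose[OF euler_phi_regular(2) filterlim_affine_i_infinity, of "a \<delta>" "e \<delta>" "int (b \<delta>)"] K
      by simp
  qed
  show "regular_at_infinity U"
    unfolding U_def by (intro regular_at_infinity_prod regular_at_infinity_power_int[OF *]) auto
  have "(U \<longlongrightarrow> (\<Prod>\<delta>\<in>D. 1 powi r \<delta>)) i_infinity"
    unfolding U_def by (intro tendsto_prod tendsto_power_int *) auto
  thus "(U \<longlongrightarrow> 1) i_infinity" by simp
  fix z
  have "dedekind_eta (moebius_act (hmat (K \<delta>)) z) powi r \<delta> =
      nome 24 (of_nat (b \<delta>) / of_nat (e \<delta>)) powi r \<delta> *
      exp (2 * of_real pi * \<i> * (of_int (r \<delta>) * of_nat (a \<delta>) / (24 * of_nat (e \<delta>))) * z) *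
      euler_phi (nome 1 (moebius_act (hmat (K \<delta>)) z)) powi r \<delta>" if \<delta>: "\<delta> \<in> D" for \<delta>
  proof -
    have "nome 24 (moebius_act (hmat (K \<delta>)) z) =
        nome 24 (of_nat (b \<delta>) / of_nat (e \<delta>)) *
        exp (2 * of_real pi * \<i> * (of_nat (a \<delta>) / (24 * of_nat (e \<delta>))) * z)"
    proof -
      have "moebius_act (hmat (K \<delta>)) z = of_nat (b \<delta>) / of_nat (e \<delta>) + of_nat (a \<delta>) / of_nat (e \<delta>) * z"
        using K[OF \<delta>] by (simp add: add_divide_distrib)
      moreover have "nome 24 (u * z) = exp (2 * of_real pi * \<i> * (u / 24) * z)" for u
        by (simp add: nome_def mult_ac)
      ultimately show ?thesis
        by (simp only: nome_add divide_divide_eq_left mult.commute[of 24])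
    qed
    thus ?thesis
      by (simp add: dedekind_eta_eq power_int_mult_distrib exp_power_int mult_ac)
  qed
  hence "eta_product D r K z = (\<Prod>\<delta>\<in>D. nome 24 (of_nat (b \<delta>) / of_nat (e \<delta>)) powi r \<delta> *
      exp (2 * of_real pi * \<i> * (of_int (r \<delta>) * of_nat (a \<delta>) / (24 * of_nat (e \<delta>))) * z) *
      euler_phi (nome 1 (moebius_act (hmat (K \<delta>)) z)) powi r \<delta>)"
    unfolding eta_product_def by (intro prod.cong) auto
  also have "\<dots> = (\<Prod>\<delta>\<in>D. nome 24 (of_nat (b \<delta>) / of_nat (e \<delta>)) powi r \<delta>) *
      (\<Prod>\<delta>\<in>D. exp (2 * of_real pi * \<i> * (of_int (r \<delta>) * of_nat (a \<delta>) / (24 * of_nat (e \<delta>))) * z)) * U z"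
    by (simp only: prod.distrib U_def)
  also have "(\<Prod>\<delta>\<in>D. exp (2 * of_real pi * \<i> * (of_int (r \<delta>) * of_nat (a \<delta>) / (24 * of_nat (e \<delta>))) * z)) =
      exp (2 * of_real pi * \<i> * (\<Sum>\<delta>\<in>D. of_int (r \<delta>) * of_nat (a \<delta>) / (24 * of_nat (e \<delta>))) * z)"
    unfolding exp_sum[OF fin, symmetric] by (simp only: sum_distrib_left sum_distrib_right)
  finally show "eta_product D r K z = (\<Prod>\<delta>\<in>D. nome 24 (of_nat (b \<delta>) / of_nat (e \<delta>)) powi r \<delta>) *
       exp (2 * of_real pi * \<i> * (\<Sum>\<delta>\<in>D. of_int (r \<delta>) * of_nat (a \<delta>) / (24 * of_nat (e \<delta>))) * z) * U z" .
qed

lemma eta_product_holomorphic: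
  assumes K: "\<And>\<delta>. \<delta> \<in> D \<Longrightarrow> mat_det (hmat (K \<delta>)) > 0"
  shows "eta_product D r K holomorphic_on upper_half_plane"
    "Im z > 0 \<Longrightarrow> eta_product D r K z \<noteq> 0"
proof -
  have nz: "dedekind_eta (moebius_act (hmat (K \<delta>)) z) \<noteq> 0" if "\<delta> \<in> D" "Im z > 0" for \<delta> z
    by (intro dedekind_eta_nonzero moebius_act_upper K that)
  have "(\<lambda>z. dedekind_eta (moebius_act (hmat (K \<delta>)) z) powi r \<delta>) holomorphic_on upper_half_plane"
    if \<delta>: "\<delta> \<in> D" for \<delta>
    by (intro holomorphic_on_power_int holomorphic_on_compose_moebius holomorphic_dedekind_eta K \<delta>)
       (use nz[OF \<delta>] in \<open>auto simp: upper_half_plane_def\<close>)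
  thus "eta_product D r K holomorphic_on upper_half_plane"
    unfolding eta_product_def by (intro holomorphic_on_prod)
  show "eta_product D r K z \<noteq> 0" if "Im z > 0"
    using nz that by (cases "finite D") (auto simp: eta_product_def power_int_eq_0_iff)
qed

text \<open>The first column of the product is \<open>(\<delta> \<alpha>, c)\<close>. As
  \<open>\<alpha>\<close> and \<open>c\<close> are coprime, its gcd is that of
  \<open>\<delta>\<close> and \<open>c\<close>, which determines the diagonal of the Hermite
  form.\<close>

lemma moebius_scaling_decomposition:
  assumes \<gamma>: "(\<alpha>, \<beta>, c, d) \<in> SL2Z" and \<delta>: "\<delta> > 0"
  obtains \<sigma> b where "\<sigma> \<in> SL2Z" "b < \<delta> div gcd \<delta> (nat \<bar>c\<bar>)"
    "mat_mul (hmat (\<delta>, 0, 1)) (\<alpha>, \<beta>, c, d) =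
      mat_mul \<sigma> (hmat (gcd \<delta> (nat \<bar>c\<bar>), b, \<delta> div gcd \<delta> (nat \<bar>c\<bar>)))"
proof -
  have "mat_det (mat_mul (hmat (\<delta>, 0, 1)) (\<alpha>, \<beta>, c, d)) = int \<delta>"
    using \<gamma> unfolding mat_det_mul by (simp add: SL2Z_def)
  then obtain \<sigma> K where \<sigma>: "\<sigma> \<in> SL2Z" "K \<in> hermite \<delta>"
    "mat_mul (hmat (\<delta>, 0, 1)) (\<alpha>, \<beta>, c, d) = mat_mul \<sigma> (hmat K)"
    using hermite_decomposition[OF _ \<delta>] by metis
  obtain a b e where K: "K = (a, b, e)" by (cases K) auto
  obtain p q r s where pq: "\<sigma> = (p, q, r, s)" by (cases \<sigma>) auto
  have ae: "a * e = \<delta>" "b < e" using \<sigma>(2) by (auto simp: hermite_def K)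
  have a: "a > 0" using ae \<delta> by (auto intro!: Nat.gr0I)
  have eqs: "int \<delta> * \<alpha> = p * int a" "c = r * int a" using \<sigma>(3) by (auto simp: K pq)
  have dets: "p * s - q * r = 1" "\<alpha> * d - \<beta> * c = 1" using \<sigma>(1) \<gamma> by (auto simp: pq SL2Z_def)
  define g where "g = gcd \<delta> (nat \<bar>c\<bar>)"
  have "int g dvd int \<delta>" "int g dvd c"
    using gcd_dvd1[of \<delta> "nat \<bar>c\<bar>"] gcd_dvd2[of \<delta> "nat \<bar>c\<bar>"] by (simp_all add: g_def)
  hence "int g dvd s * (p * int a) - q * (r * int a)" by (simp flip: eqs)
  also have "s * (p * int a) - q * (r * int a) = (p * s - q * r) * int a" by (simp add: algebra_simps)
  finally have "g dvd a" using dets by simp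
  moreover have "a dvd g"
    unfolding g_def
  proof (rule gcd_greatest)
    show "a dvd \<delta>" using ae(1) by auto
    have "int a dvd c" using eqs(2) by simp
    thus "a dvd nat \<bar>c\<bar>" by simp
  qed
  ultimately have a_eq: "a = gcd \<delta> (nat \<bar>c\<bar>)" unfolding g_def by (rule dvd_antisym[rotated])
  have e_eq: "e = \<delta> div gcd \<delta> (nat \<bar>c\<bar>)" using ae(1) a unfolding a_eq[symmetric] by auto
  show ?thesis
  proof (rule that[OF \<sigma>(1)])
    show "b < \<delta> div gcd \<delta> (nat \<bar>c\<bar>)" using ae(2) by (simp only: e_eq)
    show "mat_mul (hmat (\<delta>, 0, 1)) (\<alpha>, \<beta>, c, d) =
        mat_mul \<sigma> (hmat (gcd \<delta> (nat \<bar>c\<bar>), b, \<delta> div gcd \<delta> (nat \<bar>c\<bar>)))"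
      using \<sigma>(3) by (simp only: K a_eq e_eq)
  qed
qed

context
  fixes D :: "nat set" and r :: "nat \<Rightarrow> int"
  assumes fin: "finite D" and pos: "\<And>\<delta>. \<delta> \<in> D \<Longrightarrow> \<delta> > 0" and weight: "(\<Sum>\<delta>\<in>D. r \<delta>) = 0"
begin

text \<open>The invariance of \<open>norm eta ^ 4 * Im\<close> is applied to each factor. Comparing
  imaginary parts produces \<open>k \<delta> * X\<close> with \<open>X = norm (c z + d) ^ 2\<close>;
  the exponents \<open>r \<delta>\<close> add up to 0, so the powers of \<open>X\<close> cancel and
  a factor \<open>C\<close> independent of \<open>z\<close> is left.\<close>

lemma eta_quotient_norm_moebius:
  assumes \<gamma>: "(\<alpha>, \<beta>, c, d) \<in> SL2Z"
  shows "\<exists>b C. C > 0 \<and> (\<forall>\<delta>\<in>D. b \<delta> < \<delta> div gcd \<delta> (nat \<bar>c\<bar>)) \<and>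
    C = (\<Prod>\<delta>\<in>D. (real (gcd \<delta> (nat \<bar>c\<bar>)) / (real (\<delta> div gcd \<delta> (nat \<bar>c\<bar>)) * real \<delta>)) powi r \<delta>) \<and>
    (\<forall>z. Im z > 0 \<longrightarrow> norm (eta_quotient D r (moebius_act (\<alpha>, \<beta>, c, d) z)) ^ 4 =
       C * norm (eta_product D r (\<lambda>\<delta>. (gcd \<delta> (nat \<bar>c\<bar>), b \<delta>, \<delta> div gcd \<delta> (nat \<bar>c\<bar>))) z) ^ 4)"
proof -
  define a where "a = (\<lambda>\<delta>. gcd \<delta> (nat \<bar>c\<bar>))"
  define e where "e = (\<lambda>\<delta>. \<delta> div a \<delta>)"
  have "\<forall>\<delta>\<in>D. \<exists>b \<sigma>. \<sigma> \<in> SL2Z \<and> b < e \<delta> \<and>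
      mat_mul (hmat (\<delta>, 0, 1)) (\<alpha>, \<beta>, c, d) = mat_mul \<sigma> (hmat (a \<delta>, b, e \<delta>))"
    using moebius_scaling_decomposition[OF \<gamma> pos] unfolding a_def e_def by metis
  then obtain b \<sigma> where *: "\<And>\<delta>. \<delta> \<in> D \<Longrightarrow> \<sigma> \<delta> \<in> SL2Z" "\<And>\<delta>. \<delta> \<in> D \<Longrightarrow> b \<delta> < e \<delta>"
    "\<And>\<delta>. \<delta> \<in> D \<Longrightarrow> mat_mul (hmat (\<delta>, 0, 1)) (\<alpha>, \<beta>, c, d) = mat_mul (\<sigma> \<delta>) (hmat (a \<delta>, b \<delta>, e \<delta>))"
    by metis
  have a_pos: "a \<delta> > 0" if "\<delta> \<in> D" for \<delta> using pos[OF that] by (simp add: a_def)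
  have e_pos: "e \<delta> > 0" if "\<delta> \<in> D" for \<delta> using *(2)[OF that] by simp
  define k where "k = (\<lambda>\<delta>. real (a \<delta>) / (real (e \<delta>) * real \<delta>))"
  have k_pos: "k \<delta> > 0" if "\<delta> \<in> D" for \<delta> using a_pos[OF that] e_pos[OF that] pos[OF that] by (simp add: k_def)
  define C where "C = (\<Prod>\<delta>\<in>D. k \<delta> powi r \<delta>)"
  show ?thesis
  proof (intro exI[of _ b] exI[of _ C] conjI ballI allI impI)
    show "C > 0" unfolding C_def by (intro prod_pos zero_less_power_int k_pos)
    show "b \<delta> < \<delta> div gcd \<delta> (nat \<bar>c\<bar>)" if "\<delta> \<in> D" for \<delta> using *(2)[OF that] by (simp add: e_def a_def)
    show "C = (\<Prod>\<delta>\<in>D. (real (gcd \<delta> (nat \<bar>c\<bar>)) / (real (\<delta> div gcd \<delta> (nat \<bar>c\<bar>)) * real \<delta>)) powi r \<delta>)"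
      by (simp add: C_def k_def e_def a_def)
    fix z :: complex assume z: "Im z > 0"
    define X where "X = norm (of_int c * z + of_int d) ^ 2"
    have det: "mat_det (\<alpha>, \<beta>, c, d) = 1" using \<gamma> by (simp add: SL2Z_def)
    have nz: "of_int c * z + of_int d \<noteq> 0" using det z by (intro moebius_denominator_nonzero) auto
    hence X: "X > 0" by (simp add: X_def)
    define \<gamma>z where "\<gamma>z = moebius_act (\<alpha>, \<beta>, c, d) z"
    have Im_\<gamma>z: "Im \<gamma>z = Im z / X"
      using moebius_act_Im[of \<alpha> \<beta> c d z] z unfolding \<gamma>z_def X_def det by simp
    define w where "w = (\<lambda>\<delta>. moebius_act (hmat (a \<delta>, b \<delta>, e \<delta>)) z)"
    have eta: "norm (dedekind_eta (of_nat \<delta> * \<gamma>z)) ^ 4 = norm (dedekind_eta (w \<delta>)) ^ 4 * (k \<delta> * X)"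
      if \<delta>: "\<delta> \<in> D" for \<delta>
    proof -
      have detw: "mat_det (hmat (a \<delta>, b \<delta>, e \<delta>)) > 0" using a_pos[OF \<delta>] e_pos[OF \<delta>] by simp
      have w_pos: "Im (w \<delta>) > 0" unfolding w_def by (rule moebius_act_upper[OF detw z])
      have "of_nat \<delta> * \<gamma>z = moebius_act (hmat (\<delta>, 0, 1)) \<gamma>z" by simp
      also have "\<dots> = moebius_act (mat_mul (hmat (\<delta>, 0, 1)) (\<alpha>, \<beta>, c, d)) z"
        unfolding \<gamma>z_def using pos[OF \<delta>] det z by (intro moebius_act_mul[symmetric]) auto
      also have "\<dots> = moebius_act (\<sigma> \<delta>) (w \<delta>)"
        unfolding *(3)[OF \<delta>] w_def using *(1)[OF \<delta>] detw z by (intro moebius_act_mul) (auto simp: SL2Z_iff)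
      finally have "norm (dedekind_eta (of_nat \<delta> * \<gamma>z)) ^ 4 * Im (of_nat \<delta> * \<gamma>z) =
          norm (dedekind_eta (w \<delta>)) ^ 4 * Im (w \<delta>)"
        using eta_norm_invariant[OF *(1)[OF \<delta>] w_pos] by simp
      moreover have "Im (of_nat \<delta> * \<gamma>z) = real \<delta> * Im z / X" by (simp add: Im_\<gamma>z)
      moreover have "Im (w \<delta>) = real (a \<delta>) * Im z / real (e \<delta>)" by (simp add: w_def)
      ultimately have "norm (dedekind_eta (of_nat \<delta> * \<gamma>z)) ^ 4 * (real \<delta> * Im z / X) =
          norm (dedekind_eta (w \<delta>)) ^ 4 * (real (a \<delta>) * Im z / real (e \<delta>))" by simp
      thus ?thesis using z X pos[OF \<delta>] e_pos[OF \<delta>] unfolding k_def by (simp add: field_simps)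
    qed
    have "norm (eta_quotient D r \<gamma>z) ^ 4 = (\<Prod>\<delta>\<in>D. (norm (dedekind_eta (of_nat \<delta> * \<gamma>z)) ^ 4) powi r \<delta>)"
      unfolding eta_quotient_def by (rule norm_prod_power_int)
    also have "\<dots> = (\<Prod>\<delta>\<in>D. (norm (dedekind_eta (w \<delta>)) ^ 4) powi r \<delta> * (k \<delta> powi r \<delta> * X powi r \<delta>))"
      by (intro prod.cong refl) (simp add: eta power_int_mult_distrib)
    also have "\<dots> = (\<Prod>\<delta>\<in>D. (norm (dedekind_eta (w \<delta>)) ^ 4) powi r \<delta>) * (C * (\<Prod>\<delta>\<in>D. X powi r \<delta>))"
      by (simp only: prod.distrib C_def)
    also have "(\<Prod>\<delta>\<in>D. X powi r \<delta>) = 1" using X by (simp add: prod_power_int_const weight)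
    also have "(\<Prod>\<delta>\<in>D. (norm (dedekind_eta (w \<delta>)) ^ 4) powi r \<delta>) =
        norm (eta_product D r (\<lambda>\<delta>. (a \<delta>, b \<delta>, e \<delta>)) z) ^ 4"
      unfolding eta_product_def w_def by (rule norm_prod_power_int[symmetric])
    finally show "norm (eta_quotient D r (moebius_act (\<alpha>, \<beta>, c, d) z)) ^ 4 =
       C * norm (eta_product D r (\<lambda>\<delta>. (gcd \<delta> (nat \<bar>c\<bar>), b \<delta>, \<delta> div gcd \<delta> (nat \<bar>c\<bar>))) z) ^ 4"
      by (simp add: \<gamma>z_def a_def e_def)
  qed
qed

text \<open>Each \<open>\<delta>\<close> divides \<open>N\<close> and hence \<open>c\<close>, so the
  Hermite forms are \<open>(\<delta>, 0, 1)\<close> again and every factor of \<open>C\<close> is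
  1.\<close>

lemma eta_quotient_norm_invariant:
  assumes \<gamma>: "\<gamma> \<in> Gamma0 N" and N: "\<And>\<delta>. \<delta> \<in> D \<Longrightarrow> \<delta> dvd N" and z: "Im z > 0"
  shows "norm (eta_quotient D r (moebius_act \<gamma> z)) = norm (eta_quotient D r z)"
proof -
  obtain \<alpha> \<beta> c d where eq: "\<gamma> = (\<alpha>, \<beta>, c, d)" by (cases \<gamma>) auto
  have \<gamma>': "(\<alpha>, \<beta>, c, d) \<in> SL2Z" "int N dvd c" using \<gamma> by (auto simp: eq Gamma0_def)
  have g: "gcd \<delta> (nat \<bar>c\<bar>) = \<delta>" if "\<delta> \<in> D" for \<delta>
  proof -
    have "int \<delta> dvd c" using N[OF that] \<gamma>'(2) by (meson dvd_trans int_dvd_int_iff)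
    hence "\<delta> dvd nat \<bar>c\<bar>" by (simp add: int_dvd_int_iff[symmetric])
    thus ?thesis by (simp add: gcd_nat.absorb1)
  qed
  obtain b C where *: "\<forall>\<delta>\<in>D. b \<delta> < \<delta> div gcd \<delta> (nat \<bar>c\<bar>)"
    "C = (\<Prod>\<delta>\<in>D. (real (gcd \<delta> (nat \<bar>c\<bar>)) / (real (\<delta> div gcd \<delta> (nat \<bar>c\<bar>)) * real \<delta>)) powi r \<delta>)"
    "\<forall>z. Im z > 0 \<longrightarrow> norm (eta_quotient D r (moebius_act (\<alpha>, \<beta>, c, d) z)) ^ 4 =
       C * norm (eta_product D r (\<lambda>\<delta>. (gcd \<delta> (nat \<bar>c\<bar>), b \<delta>, \<delta> div gcd \<delta> (nat \<bar>c\<bar>))) z) ^ 4"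
    using eta_quotient_norm_moebius[OF \<gamma>'(1)] by (elim exE conjE)
  have "C = 1" unfolding *(2) by (intro prod.neutral ballI) (use g pos in auto)
  moreover have "eta_product D r (\<lambda>\<delta>. (gcd \<delta> (nat \<bar>c\<bar>), b \<delta>, \<delta> div gcd \<delta> (nat \<bar>c\<bar>))) z = eta_quotient D r z"
    unfolding eta_product_def eta_quotient_def
  proof (intro prod.cong refl)
    fix \<delta> assume \<delta>: "\<delta> \<in> D"
    have "b \<delta> = 0" using bspec[OF *(1) \<delta>] g[OF \<delta>] pos[OF \<delta>] by simp
    thus "dedekind_eta (moebius_act (hmat (gcd \<delta> (nat \<bar>c\<bar>), b \<delta>, \<delta> div gcd \<delta> (nat \<bar>c\<bar>))) z) powi r \<delta> =
        dedekind_eta (of_nat \<delta> * z) powi r \<delta>"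
      using g[OF \<delta>] pos[OF \<delta>] by simp
  qed
  ultimately have "norm (eta_quotient D r (moebius_act \<gamma> z)) ^ 4 = norm (eta_quotient D r z) ^ 4"
    using *(3) z by (simp add: eq)
  thus ?thesis by (subst (asm) power_eq_iff_eq_base) auto
qed

text \<open>The transformed quotient divided by the corresponding eta product is holomorphic of
  constant modulus, hence constant. The expansion at the cusp is thus known up to an unspecified
  nonzero factor.\<close>

lemma eta_quotient_at_cusp:
  assumes \<gamma>: "(\<alpha>, \<beta>, c, d) \<in> SL2Z"
  obtains k U where "k \<noteq> 0" "regular_at_infinity U" "(U \<longlongrightarrow> 1) i_infinity"
    "\<And>z. Im z > 0 \<Longrightarrow> eta_quotient D r (moebius_act (\<alpha>, \<beta>, c, d) z) = k *
       exp (2 * of_real pi * \<i> * (\<Sum>\<delta>\<in>D. of_int (r \<delta>) * of_nat (gcd \<delta> (nat \<bar>c\<bar>)) /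
         (24 * of_nat (\<delta> div gcd \<delta> (nat \<bar>c\<bar>)))) * z) * U z"
proof -
  obtain b C where *: "C > 0" "\<forall>\<delta>\<in>D. b \<delta> < \<delta> div gcd \<delta> (nat \<bar>c\<bar>)"
    "\<forall>z. Im z > 0 \<longrightarrow> norm (eta_quotient D r (moebius_act (\<alpha>, \<beta>, c, d) z)) ^ 4 =
       C * norm (eta_product D r (\<lambda>\<delta>. (gcd \<delta> (nat \<bar>c\<bar>), b \<delta>, \<delta> div gcd \<delta> (nat \<bar>c\<bar>))) z) ^ 4"
    using eta_quotient_norm_moebius[OF \<gamma>] by (elim exE conjE)
  define K where "K = (\<lambda>\<delta>. (gcd \<delta> (nat \<bar>c\<bar>), b \<delta>, \<delta> div gcd \<delta> (nat \<bar>c\<bar>)))"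
  have Kpos: "gcd \<delta> (nat \<bar>c\<bar>) > 0" "\<delta> div gcd \<delta> (nat \<bar>c\<bar>) > 0" if "\<delta> \<in> D" for \<delta>
    using pos[OF that] bspec[OF *(2) that] by auto
  have det: "mat_det (\<alpha>, \<beta>, c, d) = 1" using \<gamma> by (simp add: SL2Z_def)
  have detK: "mat_det (hmat (K \<delta>)) > 0" if "\<delta> \<in> D" for \<delta> using Kpos[OF that] by (simp add: K_def)
  have hol_K: "eta_product D r K holomorphic_on upper_half_plane" "Im z > 0 \<Longrightarrow> eta_product D r K z \<noteq> 0" for z
    using detK by (intro eta_product_holomorphic; blast)+
  define F where "F = (\<lambda>z. eta_quotient D r (moebius_act (\<alpha>, \<beta>, c, d) z) / eta_product D r K z)"
  have hol_q: "eta_quotient D r holomorphic_on upper_half_plane" "Im z > 0 \<Longrightarrow> eta_quotient D r z \<noteq> 0" for z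
    unfolding eta_quotient_eq_product using pos by (intro eta_product_holomorphic; simp)+
  have F_holo: "F holomorphic_on upper_half_plane"
    unfolding F_def
  proof (rule holomorphic_on_divide)
    show "(\<lambda>z. eta_quotient D r (moebius_act (\<alpha>, \<beta>, c, d) z)) holomorphic_on upper_half_plane"
      by (rule holomorphic_on_compose_moebius[OF hol_q(1)]) (simp only: det)
    show "eta_product D r K holomorphic_on upper_half_plane" by (rule hol_K(1))
    show "eta_product D r K z \<noteq> 0" if "z \<in> upper_half_plane" for z
      using hol_K(2)[of z] that by (simp add: upper_half_plane_def)
  qed
  have F_norm: "norm (F z) ^ 4 = C" if "Im z > 0" for z
    using *(3)[rule_format, OF that] hol_K(2)[OF that] unfolding F_def K_def[symmetric] norm_divide power_divide by simp
  have norm_F: "norm (F z) \<le> norm (F \<i>)" if "Im z > 0" for z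
    using F_norm[OF that] F_norm[of \<i>] power_eq_iff_eq_base[of 4 "norm (F z)" "norm (F \<i>)"] by simp
  have "F constant_on upper_half_plane"
  proof (rule maximum_modulus_principle[OF F_holo open_upper_half_plane connected_upper_half_plane
          open_upper_half_plane order_refl])
    show "\<i> \<in> upper_half_plane" by (simp add: upper_half_plane_def)
    show "norm (F z) \<le> norm (F \<i>)" if "z \<in> upper_half_plane" for z
      using norm_F that by (simp add: upper_half_plane_def)
  qed
  then obtain k where k: "\<And>z. Im z > 0 \<Longrightarrow> F z = k" by (auto simp: constant_on_def upper_half_plane_def)
  have "k \<noteq> 0" using F_norm[of \<i>] k[of \<i>] *(1) by auto
  obtain U where U: "regular_at_infinity U" "(U \<longlongrightarrow> 1) i_infinity"
    "\<And>z. eta_product D r K z = (\<Prod>\<delta>\<in>D. nome 24 (of_nat (b \<delta>) / of_nat (\<delta> div gcd \<delta> (nat \<bar>c\<bar>))) powi r \<delta>) *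
       exp (2 * of_real pi * \<i> * (\<Sum>\<delta>\<in>D. of_int (r \<delta>) * of_nat (gcd \<delta> (nat \<bar>c\<bar>)) /
         (24 * of_nat (\<delta> div gcd \<delta> (nat \<bar>c\<bar>)))) * z) * U z"
    by (rule eta_product_expansion[OF fin, of K "\<lambda>\<delta>. gcd \<delta> (nat \<bar>c\<bar>)" b "\<lambda>\<delta>. \<delta> div gcd \<delta> (nat \<bar>c\<bar>)" r])
       (use Kpos in \<open>auto simp: K_def\<close>)
  show ?thesis
  proof (rule that[OF _ U(1,2)])
    show "k * (\<Prod>\<delta>\<in>D. nome 24 (of_nat (b \<delta>) / of_nat (\<delta> div gcd \<delta> (nat \<bar>c\<bar>))) powi r \<delta>) \<noteq> 0"
      using \<open>k \<noteq> 0\<close> fin by (simp add: power_int_eq_0_iff)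
    fix z :: complex assume z: "Im z > 0"
    have "eta_quotient D r (moebius_act (\<alpha>, \<beta>, c, d) z) = k * eta_product D r K z"
      using k[OF z] hol_K(2)[OF z] unfolding F_def by (simp add: divide_eq_eq)
    thus "eta_quotient D r (moebius_act (\<alpha>, \<beta>, c, d) z) =
        k * (\<Prod>\<delta>\<in>D. nome 24 (of_nat (b \<delta>) / of_nat (\<delta> div gcd \<delta> (nat \<bar>c\<bar>))) powi r \<delta>) *
        exp (2 * of_real pi * \<i> * (\<Sum>\<delta>\<in>D. of_int (r \<delta>) * of_nat (gcd \<delta> (nat \<bar>c\<bar>)) /
         (24 * of_nat (\<delta> div gcd \<delta> (nat \<bar>c\<bar>)))) * z) * U z"
      unfolding U(3) by (simp only: mult.assoc)
  qed
qed

end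

subsection \<open>Eta quotients as Hauptmoduln\<close>

text \<open>The expansion of \<open>f\<close> may be given in a local parameter \<open>nome h\<close> finer than \<open>nome h\<^sub>0\<close>; periodicity
  forces its order of vanishing to be a multiple of that of \<open>nome h\<^sub>0\<close>.\<close>

lemma regular_divide_nome:
  assumes f: "regular_at_infinity f" "(f \<longlongrightarrow> 0) i_infinity" and h0: "h0 > 0"
    and per: "eventually (\<lambda>z. f (z + of_nat h0) = f z) i_infinity"
  shows "regular_at_infinity (\<lambda>z. f z * inverse (nome h0 z))"
proof -
  obtain h G where G: "h > 0" "G analytic_on {0}" "eventually (\<lambda>z. f z = G (nome h z)) i_infinity"
    using f(1) by (auto simp: regular_at_infinity_def)
  have "(G \<longlongrightarrow> G 0) (at 0)"
    using G(2) analytic_at_imp_isCont isContD by blast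
  hence "((\<lambda>z. G (nome h z)) \<longlongrightarrow> G 0) i_infinity"
    using filterlim_compose filterlim_nome[OF G(1)] by blast
  hence "(f \<longlongrightarrow> G 0) i_infinity" using G(3) by (subst tendsto_cong)
  hence G0: "G 0 = 0" using f(2) tendsto_unique[OF i_infinity_neq_bot] by blast
  obtain \<rho> where \<rho>: "\<rho> > 0" "G holomorphic_on ball 0 \<rho>"
    using G(2) by (auto simp: analytic_on_def)
  have ball_ev: "eventually (\<lambda>z. nome h z \<in> ball 0 \<epsilon>) i_infinity" if "\<epsilon> > 0" for \<epsilon>
  proof (subst eventually_nome_iff[OF G(1)])
    show "eventually (\<lambda>w. w \<in> ball 0 \<epsilon>) (at (0 :: complex))"
      by (rule eventually_at_in_open') (use that in auto)
  qed
  show ?thesis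
  proof (cases "G constant_on ball 0 \<rho>")
    case True
    hence zero: "G w = 0" if "w \<in> ball 0 \<rho>" for w
      using that G0 \<rho>(1) unfolding constant_on_def by (metis centre_in_ball)
    have "eventually (\<lambda>z. f z * inverse (nome h0 z) = 0) i_infinity"
      using ball_ev[OF \<rho>(1)] G(3) by eventually_elim (simp only: zero mult_zero_left)
    with regular_at_infinity_const show ?thesis by (subst regular_at_infinity_cong)
  next
    case False
    obtain u \<epsilon> n where u: "0 < n" "0 < \<epsilon>" "u holomorphic_on ball 0 \<epsilon>"
      "\<And>w. w \<in> ball 0 \<epsilon> \<Longrightarrow> G w = (w - 0) ^ n * u w" "\<And>w. w \<in> ball 0 \<epsilon> \<Longrightarrow> u w \<noteq> 0"
    proof (rule holomorphic_factor_zero_nonconstant[OF \<rho>(2) _ _ _ G0 False])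
      fix u \<epsilon> n assume "0 < n" "0 < \<epsilon>" "u holomorphic_on ball 0 \<epsilon>"
        "\<And>w. w \<in> ball 0 \<epsilon> \<Longrightarrow> G w = (w - 0) ^ n * u w" "\<And>w. w \<in> ball 0 \<epsilon> \<Longrightarrow> u w \<noteq> 0"
      thus thesis by (rule that)
    qed (use \<rho>(1) in auto)
    have u_an: "u analytic_on {0}" using u(2,3) by (auto simp: analytic_at intro!: exI[of _ "ball 0 \<epsilon>"])
    have u_lim: "((\<lambda>z. u (nome h z)) \<longlongrightarrow> u 0) i_infinity"
      using u_an analytic_at_imp_isCont isContD filterlim_compose filterlim_nome[OF G(1)] by blast
    define \<zeta> where "\<zeta> = nome h (of_nat h0)"
    have shift: "filterlim (\<lambda>z. z + of_nat h0) i_infinity i_infinity"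
      using filterlim_affine_i_infinity[of 1 1 "int h0"] by simp
    have ev_shift: "eventually (\<lambda>z. P (z + of_nat h0)) i_infinity" if "eventually P i_infinity" for P
      using shift that unfolding filterlim_iff by blast
    have "eventually (\<lambda>z. \<zeta> ^ n * u (nome h (z + of_nat h0)) = u (nome h z)) i_infinity"
      using per G(3) ev_shift[OF G(3)] ball_ev[OF u(2)] ev_shift[OF ball_ev[OF u(2)]]
    proof eventually_elim
      case (elim z)
      have "nome h (z + of_nat h0) ^ n * u (nome h (z + of_nat h0)) = nome h z ^ n * u (nome h z)"
        using elim u(4) by simp
      moreover have "nome h (z + of_nat h0) ^ n = nome h z ^ n * \<zeta> ^ n"
        by (simp add: nome_add \<zeta>_def power_mult_distrib)
      ultimately show ?case by simp
    qed
    moreover have "((\<lambda>z. \<zeta> ^ n * u (nome h (z + of_nat h0))) \<longlongrightarrow> \<zeta> ^ n * u 0) i_infinity"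
      by (intro tendsto_intros filterlim_compose[OF u_lim shift])
    ultimately have "((\<lambda>z. u (nome h z)) \<longlongrightarrow> \<zeta> ^ n * u 0) i_infinity"
      by (rule Lim_transform_eventually[rotated])
    hence "\<zeta> ^ n * u 0 = u 0" using u_lim tendsto_unique[OF i_infinity_neq_bot] by blast
    hence "\<zeta> ^ n = 1" using u(2,5) by simp
    hence "nome 1 (of_nat (n * h0) / of_nat h) = nome 1 0"
      using G(1) by (simp add: \<zeta>_def nome_power nome_divide) (simp add: nome_def)
    then obtain m :: int where "of_nat (n * h0) / of_nat h = (of_int m :: complex)" unfolding nome_1_eq_iff by auto
    hence "of_int (int (n * h0)) = (of_int (m * int h) :: complex)" using G(1) by (simp add: divide_eq_eq)
    hence nm: "int (n * h0) = m * int h" by (simp only: of_int_eq_iff)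
    hence "m > 0" using u(1) h0 G(1) by (metis mult_pos_pos of_nat_0_less_iff zero_less_mult_pos2)
    then obtain l where l: "m = int (Suc l)" by (metis gr0_implies_Suc zero_less_imp_eq_int of_nat_0_less_iff)
    \<comment> \<open>So \<open>nome h z ^ n\<close> is a positive power of
      \<open>nome h0 z\<close>, and one factor can be split off.\<close>
    have nm': "n * h0 = Suc l * h" using nm unfolding l of_nat_mult[symmetric] of_nat_eq_iff .
    have pow: "nome h z ^ n = nome h0 z ^ Suc l" for z
    proof -
      have "(of_nat n * of_nat h0 :: complex) = of_nat (Suc l) * of_nat h" using nm' by (metis of_nat_mult)
      hence "of_nat n / of_nat h = (of_nat (Suc l) / of_nat h0 :: complex)" using h0 G(1) by (simp add: frac_eq_eq)
      moreover have "nome k z ^ j = exp (2 * of_real pi * \<i> * z * (of_nat j / of_nat k))" for j k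
        by (simp add: nome_power) (simp add: nome_def mult_ac)
      ultimately show ?thesis by (simp only:)
    qed
    have "eventually (\<lambda>z. f z * inverse (nome h0 z) = nome h0 z ^ l * u (nome h z)) i_infinity"
      using G(3) ball_ev[OF u(2)] by eventually_elim (simp add: u(4) pow)
    moreover have "regular_at_infinity (\<lambda>z. nome h0 z ^ l * u (nome h z))"
      by (intro regular_at_infinity_mult regular_at_infinity_power regular_at_infinity_nome h0
            regular_at_infinityI[OF G(1) u_an]) auto
    ultimately show ?thesis by (subst regular_at_infinity_cong)
  qed
qed

text \<open>A translation \<open>k\<close> is sought with \<open>c2 d1 - c1 d2 = k c1 c2\<close>
  modulo \<open>N\<close>. Modulo \<open>g\<close> both sides vanish; modulo \<open>h\<close> the
  product \<open>c1 c2\<close> is invertible because \<open>g\<close> and \<open>h\<close> are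
  coprime.\<close>

lemma unitary_cusps_equivalent:
  assumes \<gamma>1: "(a1, b1, c1, d1) \<in> SL2Z" and \<gamma>2: "(a2, b2, c2, d2) \<in> SL2Z"
    and g: "gcd c1 (int N) = int g" "gcd c2 (int N) = int g" and N: "N = g * h" "coprime g h"
  obtains k :: int and \<delta> where "\<delta> \<in> Gamma0 N"
    "mat_mul (a2, b2, c2, d2) (1, k, 0, 1) = mat_mul \<delta> (a1, b1, c1, d1)"
proof -
  have cop: "coprime c (int h)" if "gcd c (int N) = int g" for c
  proof (rule coprimeI)
    fix l assume l: "l dvd c" "l dvd int h"
    hence "l dvd gcd c (int N)" by (intro gcd_greatest) (auto simp: N)
    hence "l dvd int g" using that by simp
    thus "is_unit l" using l(2) N(2) by (meson coprime_common_divisor coprime_int_iff)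
  qed
  have "coprime (c1 * c2) (int h)" using cop[OF g(1)] cop[OF g(2)] by simp
  then obtain u v where uv: "u * (c1 * c2) + v * int h = 1"
    using bezout_int[of "c1 * c2" "int h"] by auto
  define X where "X = c2 * d1 - c1 * d2"
  define k where "k = u * X"
  have "X - k * (c1 * c2) = X * (1 - u * (c1 * c2))" by (simp add: k_def algebra_simps)
  also have "1 - u * (c1 * c2) = v * int h" using uv by simp
  finally have h: "int h dvd X - k * (c1 * c2)" by simp
  have "int g dvd c1" "int g dvd c2" by (metis g gcd_dvd1)+
  hence "int g dvd X - k * (c1 * c2)" by (simp add: X_def)
  hence "int g * int h dvd X - k * (c1 * c2)" using h N(2) by (intro divides_mult) auto
  hence dvd: "int N dvd X - k * (c1 * c2)" by (simp add: N)
  define \<delta> where "\<delta> = mat_mul (mat_mul (a2, b2, c2, d2) (1, k, 0, 1)) (mat_adj (a1, b1, c1, d1))"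
  have "mat_det \<delta> = 1" using \<gamma>1 \<gamma>2 unfolding \<delta>_def mat_det_mul mat_det_adj SL2Z_iff by simp
  moreover have "\<delta> = (a2 * d1 - (a2 * k + b2) * c1, (a2 * k + b2) * a1 - a2 * b1,
      X - k * (c1 * c2), (c2 * k + d2) * a1 - c2 * b1)"
    by (simp add: \<delta>_def X_def algebra_simps)
  ultimately have "\<delta> \<in> Gamma0 N" using dvd SL2Z_iff[of \<delta>] by (simp add: Gamma0_def)
  moreover have "mat_mul (a2, b2, c2, d2) (1, k, 0, 1) = mat_mul \<delta> (a1, b1, c1, d1)"
    using \<gamma>1 unfolding \<delta>_def mat_mul_assoc SL2Z_iff by (simp only: mat_adj_SL2Z mat_mul_id)
  ultimately show ?thesis by (rule that)
qed

text \<open>By the order formula for eta quotients, the last condition says that the only pole is a simple one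
  at \<open>\<infinity>\<close> and the only zero a simple one at the cusp \<open>1/g0\<close>, whose width is \<open>N div g0\<close>.\<close>

definition eta_data :: "nat \<Rightarrow> nat set \<Rightarrow> (nat \<Rightarrow> int) \<Rightarrow> nat \<Rightarrow> bool" where
  "eta_data N D r g0 \<longleftrightarrow> finite D \<and> (\<forall>\<delta>\<in>D. \<delta> dvd N) \<and> (\<Sum>\<delta>\<in>D. r \<delta>) = 0 \<and>
     g0 < N \<and> g0 dvd N \<and> coprime g0 (N div g0) \<and>
     (\<forall>g\<in>set [g\<leftarrow>[0..<Suc N]. g dvd N]. (\<Sum>\<delta>\<in>D. r \<delta> * int ((gcd \<delta> g) ^ 2 * (N div \<delta>))) =
        (if g = N then - 24 * int N else if g = g0 then 24 * int g0 else 0))"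

text \<open>As \<open>\<delta>\<close> divides \<open>N\<close>, \<open>gcd \<delta> c\<close>
  depends only on \<open>gcd c N\<close>, so finitely many divisors cover all cusps. Multiplication
  by \<open>24 N\<close> makes the orders integral: \<open>- 24 N\<close> becomes -1, and
  \<open>24 g0\<close> becomes the order of one power of \<open>nome (N div g0)\<close>.\<close>

lemma eta_order_at_cusp:
  assumes data: "eta_data N D r g0"
  shows "(\<Sum>\<delta>\<in>D. of_int (r \<delta>) * of_nat (gcd \<delta> (nat \<bar>c\<bar>)) / (24 * of_nat (\<delta> div gcd \<delta> (nat \<bar>c\<bar>))) :: complex) =
    (if int N dvd c then -1 else if gcd (nat \<bar>c\<bar>) N = g0 then 1 / of_nat (N div g0) else 0)"
proof -
  define g where "g = gcd (nat \<bar>c\<bar>) N"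
  have N: "N > 0" using data by (simp add: eta_data_def)
  have g: "g dvd N" unfolding g_def by (rule gcd_dvd2)
  hence g_in: "g \<in> set [g\<leftarrow>[0..<Suc N]. g dvd N]" using N by (auto dest: dvd_imp_le simp del: upt_Suc)
  have term_eq: "of_int (r \<delta>) * of_nat (gcd \<delta> (nat \<bar>c\<bar>)) / (24 * of_nat (\<delta> div gcd \<delta> (nat \<bar>c\<bar>))) =
      (of_int (r \<delta> * int ((gcd \<delta> g) ^ 2 * (N div \<delta>))) / (24 * of_nat N) :: complex)" if "\<delta> \<in> D" for \<delta>
  proof -
    have \<delta>: "\<delta> dvd N" using data that by (simp add: eta_data_def)
    define a where "a = gcd \<delta> (nat \<bar>c\<bar>)"
    have "gcd \<delta> g = gcd (gcd \<delta> N) (nat \<bar>c\<bar>)" unfolding g_def by (metis gcd.assoc gcd.commute)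
    also have "gcd \<delta> N = \<delta>" using \<delta> by (simp add: gcd_nat.absorb1)
    finally have ag: "gcd \<delta> g = a" by (simp add: a_def)
    obtain e where e: "\<delta> = a * e" by (metis a_def dvdE gcd_dvd1)
    obtain m where m: "N = \<delta> * m" using \<delta> by auto
    have pos: "a > 0" "e > 0" "m > 0" using N by (auto simp: m e)
    show ?thesis unfolding a_def[symmetric] ag using pos by (simp add: m e power2_eq_square)
  qed
  have "(\<Sum>\<delta>\<in>D. of_int (r \<delta>) * of_nat (gcd \<delta> (nat \<bar>c\<bar>)) / (24 * of_nat (\<delta> div gcd \<delta> (nat \<bar>c\<bar>))) :: complex) =
      of_int (\<Sum>\<delta>\<in>D. r \<delta> * int ((gcd \<delta> g) ^ 2 * (N div \<delta>))) / (24 * of_nat N)"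
    unfolding of_int_sum sum_divide_distrib by (intro sum.cong refl term_eq)
  also have "(\<Sum>\<delta>\<in>D. r \<delta> * int ((gcd \<delta> g) ^ 2 * (N div \<delta>))) =
      (if g = N then - 24 * int N else if g = g0 then 24 * int g0 else 0)"
    using data g_in unfolding eta_data_def by blast
  also have "of_int \<dots> / (24 * of_nat N) = (if g = N then -1 else if g = g0 then 1 / of_nat (N div g0) else 0 :: complex)"
  proof -
    have "of_nat N = (of_nat g0 * of_nat (N div g0) :: complex)" "g0 > 0"
      using data N by (auto simp: eta_data_def of_nat_mult[symmetric] simp del: of_nat_mult intro!: Nat.gr0I)
    moreover have "N div g0 \<noteq> 0" using data N by (simp add: eta_data_def dvd_div_eq_0_iff)
    ultimately show ?thesis using N by simp
  qed
  also have "g = N \<longleftrightarrow> int N dvd c"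
  proof -
    have "g = N \<longleftrightarrow> N dvd nat \<bar>c\<bar>" unfolding g_def by (metis gcd_nat.absorb_iff2)
    thus ?thesis by simp
  qed
  finally show ?thesis by (simp add: g_def)
qed

text \<open>At infinity the simple poles of \<open>J - x0\<close> and \<open>f\<close> cancel. At
  the cusp of \<open>g0\<close> the denominator vanishes to order one in the local parameter and the
  numerator at least to that order; at the remaining cusps \<open>f\<close> has a nonzero limit.
  Equal leading coefficients at infinity make the constant quotient 1.\<close>

lemma eta_quotient_eq_hauptmodul:
  assumes data: "eta_data N D r g0" and J: "hauptmodul N J"
  obtains c where "\<And>z. Im z > 0 \<Longrightarrow> eta_quotient D r z = J z + c"
proof -
  define h0 where "h0 = N div g0"
  have fin: "finite D" and DN: "\<And>\<delta>. \<delta> \<in> D \<Longrightarrow> \<delta> dvd N" and weight: "(\<Sum>\<delta>\<in>D. r \<delta>) = 0"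
    and g0: "g0 < N" "g0 dvd N" "coprime g0 h0"
    using data by (auto simp: eta_data_def h0_def)
  have N: "N > 0" using g0 by simp
  have Nh0: "N = g0 * h0" using g0(2) by (simp add: h0_def)
  have h0: "h0 > 0" using N Nh0 by (auto intro!: Nat.gr0I)
  have pos: "\<delta> > 0" if "\<delta> \<in> D" for \<delta> using DN[OF that] N by (auto intro!: Nat.gr0I)
  note at_cusp = eta_quotient_at_cusp[OF fin pos weight]
  define f where "f = eta_quotient D r"
  have f_nz: "f z \<noteq> 0" if "Im z > 0" for z
    unfolding f_def eta_quotient_eq_product by (rule eta_product_holomorphic(2)[OF _ that]) (use pos in simp)
  have f_holo: "f holomorphic_on upper_half_plane"
    unfolding f_def eta_quotient_eq_product by (rule eta_product_holomorphic(1)) (use pos in simp)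
  have \<gamma>1: "(1, 0, int g0, 1) \<in> SL2Z" by (simp add: SL2Z_def)
  have not_dvd: "\<not> int N dvd int g0"
    using g0 N Nh0 by (auto dest: dvd_imp_le simp: nat_dvd_not_less)
  obtain x0 where x0: "((\<lambda>z. J (moebius_act (1, 0, int g0, 1) z)) \<longlongrightarrow> x0) i_infinity"
    using regular_at_infinity_limit[OF hauptmodul_regular_at_other_cusps[OF J \<gamma>1 not_dvd]] .
  define G where "G = (\<lambda>z. (J z - x0) / f z)"
  have G_reg: "regular_at_infinity (\<lambda>z. G (moebius_act (a, b, c, d) z))" if \<gamma>: "(a, b, c, d) \<in> SL2Z" for a b c d
  proof -
    define \<kappa> :: complex where "\<kappa> = (if int N dvd c then -1 else if gcd (nat \<bar>c\<bar>) N = g0 then 1 / of_nat h0 else 0)"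
    obtain k U where U: "k \<noteq> 0" "regular_at_infinity U" "(U \<longlongrightarrow> 1) i_infinity"
      "\<And>z. Im z > 0 \<Longrightarrow> f (moebius_act (a, b, c, d) z) = k * exp (2 * of_real pi * \<i> * \<kappa> * z) * U z"
    proof (rule at_cusp[OF _ \<gamma>])
      fix k U assume "k \<noteq> 0" "regular_at_infinity U" "(U \<longlongrightarrow> 1) i_infinity"
        "\<And>z. Im z > 0 \<Longrightarrow> eta_quotient D r (moebius_act (a, b, c, d) z) = k *
           exp (2 * of_real pi * \<i> * (\<Sum>\<delta>\<in>D. of_int (r \<delta>) * of_nat (gcd \<delta> (nat \<bar>c\<bar>)) /
             (24 * of_nat (\<delta> div gcd \<delta> (nat \<bar>c\<bar>)))) * z) * U z"
      thus thesis
        unfolding f_def[symmetric] eta_order_at_cusp[OF data, folded h0_def] \<kappa>_def[symmetric] by (rule that)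
    qed assumption
    define \<phi> where "\<phi> = (\<lambda>z. J (moebius_act (a, b, c, d) z) - x0)"
    have det: "mat_det (a, b, c, d) = 1" using \<gamma> by (simp add: SL2Z_def)
    have "regular_at_infinity (\<lambda>z. \<phi> z * exp (- (2 * of_real pi * \<i> * \<kappa> * z)))"
    proof (cases "int N dvd c")
      case True
      have \<gamma>N: "(a, b, c, d) \<in> Gamma0 N" using \<gamma> True by (simp add: Gamma0_def)
      have "regular_at_infinity (\<lambda>z. (J z - inverse (nome 1 z)) * nome 1 z + (1 - x0 * nome 1 z))"
        by (intro regular_at_infinity_add regular_at_infinity_mult regular_at_infinity_diff
              regular_at_infinity_const regular_at_infinity_nome hauptmodul_minus_pole(1)[OF J]) auto
      moreover have "eventually (\<lambda>z. \<phi> z * exp (- (2 * of_real pi * \<i> * \<kappa> * z)) =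
          (J z - inverse (nome 1 z)) * nome 1 z + (1 - x0 * nome 1 z)) i_infinity"
        using eventually_Im_gt_i_infinity[of 0]
      proof eventually_elim
        case (elim z)
        have "exp (- (2 * of_real pi * \<i> * \<kappa> * z)) = nome 1 z" using True by (simp add: \<kappa>_def nome_def)
        moreover have "\<phi> z = J z - x0" unfolding \<phi>_def hauptmodul_invariant[OF J \<gamma>N elim] ..
        moreover have "inverse (nome 1 z) * nome 1 z = 1" by simp
        ultimately show ?case by (simp only: left_diff_distrib) simp
      qed
      ultimately show ?thesis by (subst regular_at_infinity_cong)
    next
      case False
      have \<phi>_reg: "regular_at_infinity \<phi>"
        unfolding \<phi>_def by (intro regular_at_infinity_diff regular_at_infinity_const
            hauptmodul_regular_at_other_cusps[OF J \<gamma> False])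
      show ?thesis
      proof (cases "gcd (nat \<bar>c\<bar>) N = g0")
        case 2: False
        thus ?thesis using False \<phi>_reg by (simp add: \<kappa>_def)
      next
        case 2: True
        have gc: "gcd c (int N) = int g0" using 2 unfolding gcd_int_def by (simp only: nat_int abs_of_nat)
        have g1: "gcd (int g0) (int N) = int g0" using g0(2) by simp
        \<comment> \<open>The cusp \<open>a/c\<close> is carried to \<open>1/g0\<close> up to a
          translation by \<open>m\<close>, so \<open>J\<close> has the same limit \<open>x0\<close>
          there.\<close>
        obtain m \<delta> where m: "\<delta> \<in> Gamma0 N"
          "mat_mul (a, b, c, d) (1, m, 0, 1) = mat_mul \<delta> (1, 0, int g0, 1)"
          by (rule unitary_cusps_equivalent[OF \<gamma>1 \<gamma> g1 gc Nh0 g0(3)], rule that)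
        have J_shift: "J (moebius_act (a, b, c, d) (z + of_int m)) = J (moebius_act (1, 0, int g0, 1) z)"
          if z: "Im z > 0" for z
        proof -
          have "moebius_act (a, b, c, d) (z + of_int m) = moebius_act (mat_mul (a, b, c, d) (1, m, 0, 1)) z"
            using det z moebius_act_mul[of "(a, b, c, d)" "(1, m, 0, 1)" z] by simp
          also have "\<dots> = moebius_act \<delta> (moebius_act (1, 0, int g0, 1) z)"
            unfolding m(2) using z Gamma0_imp_SL2Z[OF m(1)] by (intro moebius_act_mul) (auto simp: SL2Z_iff)
          finally show ?thesis
            using hauptmodul_invariant[OF J m(1) moebius_act_upper[of "(1, 0, int g0, 1)" z]] z by simp
        qed
        have per: "J (moebius_act (a, b, c, d) (z + of_nat h0)) = J (moebius_act (a, b, c, d) z)"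
          if z: "Im z > 0" for z
        proof -
          \<comment> \<open>The conjugate of the translation by \<open>h0\<close> has lower left
            entry \<open>- h0 c^2\<close>; it lies in \<open>Gamma0 N\<close> because
            \<open>g0\<close> divides \<open>c\<close> and \<open>N = g0 h0\<close>.\<close>
          define \<epsilon> where "\<epsilon> = mat_mul (mat_mul (a, b, c, d) (1, int h0, 0, 1)) (mat_adj (a, b, c, d))"
          have "int g0 dvd c" by (metis gc gcd_dvd1)
          hence "int N dvd c * (int h0 * c)"
            unfolding Nh0 of_nat_mult by (intro mult_dvd_mono) auto
          moreover have "mat_det \<epsilon> = 1" unfolding \<epsilon>_def mat_det_mul mat_det_adj det by simp
          moreover have "\<epsilon> = (a * d - (a * int h0 + b) * c, (a * int h0 + b) * a - a * b, - (c * (int h0 * c)),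
              (c * int h0 + d) * a - c * b)" by (simp add: \<epsilon>_def algebra_simps)
          ultimately have \<epsilon>: "\<epsilon> \<in> Gamma0 N" using SL2Z_iff[of \<epsilon>] by (simp add: Gamma0_def)
          have "moebius_act (a, b, c, d) (z + of_nat h0) = moebius_act (mat_mul (a, b, c, d) (1, int h0, 0, 1)) z"
            using det z moebius_act_mul[of "(a, b, c, d)" "(1, int h0, 0, 1)" z] by simp
          also have "mat_mul (a, b, c, d) (1, int h0, 0, 1) = mat_mul \<epsilon> (a, b, c, d)"
            unfolding \<epsilon>_def mat_mul_assoc by (simp only: mat_adj_SL2Z[OF det] mat_mul_id)
          also have "moebius_act (mat_mul \<epsilon> (a, b, c, d)) z = moebius_act \<epsilon> (moebius_act (a, b, c, d) z)"
            using Gamma0_imp_SL2Z[OF \<epsilon>] det z by (intro moebius_act_mul) (simp_all only: SL2Z_iff)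
          finally show ?thesis
            using hauptmodul_invariant[OF J \<epsilon> moebius_act_upper[of "(a, b, c, d)" z]] z det by simp
        qed
        have "filterlim (\<lambda>z. z + of_int (- m)) i_infinity i_infinity"
          using filterlim_affine_i_infinity[of 1 1 "- m"] by simp
        from filterlim_compose[OF x0 this]
        have "((\<lambda>z. J (moebius_act (1, 0, int g0, 1) (z + of_int (- m)))) \<longlongrightarrow> x0) i_infinity" .
        moreover have "eventually (\<lambda>z. J (moebius_act (1, 0, int g0, 1) (z + of_int (- m))) =
            J (moebius_act (a, b, c, d) z)) i_infinity"
          using eventually_Im_gt_i_infinity[of 0]
        proof eventually_elim
          case (elim z)
          have "z + of_int (- m) + of_int m = z" by simp
          thus ?case using J_shift[of "z + of_int (- m)"] elim by (simp del: moebius_act.simps)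
        qed
        ultimately have "((\<lambda>z. J (moebius_act (a, b, c, d) z)) \<longlongrightarrow> x0) i_infinity"
          by (rule Lim_transform_eventually)
        from tendsto_diff[OF this tendsto_const[of x0]]
        have \<phi>_lim: "(\<phi> \<longlongrightarrow> 0) i_infinity" unfolding \<phi>_def by simp
        have "regular_at_infinity (\<lambda>z. \<phi> z * inverse (nome h0 z))"
        proof (rule regular_divide_nome[OF \<phi>_reg \<phi>_lim h0])
          show "eventually (\<lambda>z. \<phi> (z + of_nat h0) = \<phi> z) i_infinity"
            using eventually_Im_gt_i_infinity[of 0]
            by eventually_elim (simp only: \<phi>_def per)
        qed
        moreover have "exp (- (2 * of_real pi * \<i> * \<kappa> * z)) = inverse (nome h0 z)" for z
          using False 2 by (simp add: \<kappa>_def nome_def exp_minus)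
        ultimately show ?thesis by simp
      qed
    qed
    moreover have "regular_at_infinity (\<lambda>z. inverse (U z))"
      by (rule regular_at_infinity_inverse[OF U(2,3)]) simp
    ultimately have "regular_at_infinity (\<lambda>z. \<phi> z * exp (- (2 * of_real pi * \<i> * \<kappa> * z)) * inverse (U z) * inverse k)"
      using regular_at_infinity_const by (rule regular_at_infinity_mult[OF regular_at_infinity_mult])
    moreover have "eventually (\<lambda>z. G (moebius_act (a, b, c, d) z) =
        \<phi> z * exp (- (2 * of_real pi * \<i> * \<kappa> * z)) * inverse (U z) * inverse k) i_infinity"
      using eventually_Im_gt_i_infinity[of 0]
      by eventually_elim (simp only: G_def \<phi>_def U(4) divide_inverse inverse_mult_distrib exp_minus mult_ac)
    ultimately show ?thesis by (subst regular_at_infinity_cong)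
  qed
  have "\<exists>C. \<forall>z. Im z > 0 \<longrightarrow> G z = C"
  proof (rule constant_if_regular_at_cusps[OF N, of G])
    show "G holomorphic_on upper_half_plane"
      unfolding G_def using f_nz
      by (intro holomorphic_intros hauptmodul_holomorphic[OF J] f_holo) (auto simp: upper_half_plane_def)
    show "norm (G (moebius_act \<gamma> z)) = norm (G z)" if "\<gamma> \<in> Gamma0 N" "Im z > 0" for \<gamma> z
      using hauptmodul_invariant[OF J that] eta_quotient_norm_invariant[OF fin pos weight that(1) DN that(2)]
      by (simp add: G_def f_def norm_divide)
    show "regular_at_infinity (\<lambda>z. G (moebius_act \<gamma> z))" if "\<gamma> \<in> SL2Z" for \<gamma>
      using G_reg that by (cases \<gamma>) blast
  next
    fix C assume "\<And>z. Im z > 0 \<Longrightarrow> G z = C"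
    thus "\<exists>C. \<forall>z. Im z > 0 \<longrightarrow> G z = C" by blast
  qed
  then obtain C where C: "\<And>z. Im z > 0 \<Longrightarrow> G z = C" by blast
  obtain U where U: "regular_at_infinity U" "(U \<longlongrightarrow> 1) i_infinity"
    "\<And>z. f z = (\<Prod>\<delta>\<in>D. nome 24 (of_nat 0 / of_nat 1) powi r \<delta>) *
       exp (2 * of_real pi * \<i> * (\<Sum>\<delta>\<in>D. of_int (r \<delta>) * of_nat \<delta> / (24 * of_nat 1)) * z) * U z"
    unfolding f_def eta_quotient_eq_product
    by (rule eta_product_expansion[OF fin, of "\<lambda>\<delta>. (\<delta>, 0, 1)" "\<lambda>\<delta>. \<delta>" "\<lambda>_. 0" "\<lambda>_. 1" r]) (use pos in auto)
  \<comment> \<open>The order at infinity is the case \<open>c = 0\<close> of the order formula,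
    where \<open>gcd \<delta> 0 = \<delta>\<close>.\<close>
  have order: "(\<Sum>\<delta>\<in>D. of_int (r \<delta>) * of_nat \<delta> / (24 * of_nat 1) :: complex) = -1"
  proof -
    have "(\<Sum>\<delta>\<in>D. of_int (r \<delta>) * of_nat \<delta> / (24 * of_nat 1) :: complex) =
        (\<Sum>\<delta>\<in>D. of_int (r \<delta>) * of_nat (gcd \<delta> (nat \<bar>0\<bar>)) / (24 * of_nat (\<delta> div gcd \<delta> (nat \<bar>0\<bar>))))"
      by (intro sum.cong refl) (use pos in force)
    thus ?thesis unfolding eta_order_at_cusp[OF data] by simp
  qed
  have f_eq: "f z = inverse (nome 1 z) * U z" for z
    unfolding U(3) order by (simp add: nome_def exp_minus)
  have nome_lim: "(nome 1 \<longlongrightarrow> 0) i_infinity"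
    using filterlim_nome[of 1] unfolding filterlim_at by simp
  have "((\<lambda>z. ((J z - inverse (nome 1 z)) * nome 1 z + (1 - x0 * nome 1 z)) / U z) \<longlongrightarrow>
      (fls_nth (q_expansion J) 0 * 0 + (1 - x0 * 0)) / 1) i_infinity"
    by (intro tendsto_intros hauptmodul_minus_pole(2)[OF J] U(2) nome_lim) auto
  moreover have "((J z - inverse (nome 1 z)) * nome 1 z + (1 - x0 * nome 1 z)) / U z = G z" for z
    unfolding G_def f_eq by (simp add: field_simps)
  ultimately have "(G \<longlongrightarrow> 1) i_infinity" by simp
  moreover have "eventually (\<lambda>z. G z = C) i_infinity"
    using eventually_Im_gt_i_infinity[of 0] by eventually_elim (rule C)
  hence "(G \<longlongrightarrow> C) i_infinity" by (rule tendsto_eventually)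
  ultimately have "C = 1" using tendsto_unique[OF i_infinity_neq_bot] by blast
  hence "f z = J z + (- x0)" if "Im z > 0" for z
    using C[OF that] f_nz[OF that] unfolding G_def by (simp add: divide_eq_eq)
  thus ?thesis unfolding f_def by (rule that)
qed

text \<open>Peels off the two entries that are not numerals, so that simplification can enumerate
  the candidate divisors of a concrete level.\<close>

lemma upt_0_ge_2: "2 \<le> n \<Longrightarrow> [0..<n] = 0 # Suc 0 # [2..<n]"
  by (simp add: upt_conv_Cons numeral_2_eq_2)

text \<open>At the prime power levels the zero lies at the cusp 0, that is \<open>g0 = 1\<close>.
  The quotients of levels 6, 10 and 12 vanish at the cusps \<open>1/3\<close>, \<open>1/5\<close>
  and \<open>1/4\<close> instead.\<close>

lemma eta_data_table:
  "eta_data 2 {1, 2} (\<lambda>\<delta>. if \<delta> = 1 then 24 else - 24) 1"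
  "eta_data 3 {1, 3} (\<lambda>\<delta>. if \<delta> = 1 then 12 else - 12) 1"
  "eta_data 4 {1, 4} (\<lambda>\<delta>. if \<delta> = 1 then 8 else - 8) 1"
  "eta_data 5 {1, 5} (\<lambda>\<delta>. if \<delta> = 1 then 6 else - 6) 1"
  "eta_data 6 {1, 2, 3, 6} (\<lambda>\<delta>. if \<delta> = 1 then - 3 else if \<delta> = 2 then 3 else if \<delta> = 3 then 9 else - 9) 3"
  "eta_data 7 {1, 7} (\<lambda>\<delta>. if \<delta> = 1 then 4 else - 4) 1"
  "eta_data 8 {1, 2, 4, 8} (\<lambda>\<delta>. if \<delta> = 1 then 4 else if \<delta> = 2 then - 2 else if \<delta> = 4 then 2 else - 4) 1"
  "eta_data 9 {1, 9} (\<lambda>\<delta>. if \<delta> = 1 then 3 else - 3) 1"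
  "eta_data 10 {1, 2, 5, 10} (\<lambda>\<delta>. if \<delta> = 1 then - 1 else if \<delta> = 2 then 1 else if \<delta> = 5 then 5 else - 5) 5"
  "eta_data 12 {2, 4, 6, 12} (\<lambda>\<delta>. if \<delta> = 2 then - 2 else if \<delta> = 4 then 4 else if \<delta> = 6 then 2 else - 4) 4"
  "eta_data 13 {1, 13} (\<lambda>\<delta>. if \<delta> = 1 then 2 else - 2) 1"
  "eta_data 25 {1, 25} (\<lambda>\<delta>. if \<delta> = 1 then 1 else - 1) 1"
proof -
  have coprime: "coprime (Suc 0) n" "coprime 3 (2 :: nat)" "coprime 5 (2 :: nat)" "coprime 4 (3 :: nat)" for n
    by (simp_all add: coprime_iff_gcd_eq_1 gcd_non_0_nat)
  note [simp] = eta_data_def upt_0_ge_2 upt_rec_numeral coprime gcd_non_0_nat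
  note [simp del] = upt_Suc set_filter
  show "eta_data 2 {1, 2} (\<lambda>\<delta>. if \<delta> = 1 then 24 else - 24) 1" by simp
  show "eta_data 3 {1, 3} (\<lambda>\<delta>. if \<delta> = 1 then 12 else - 12) 1" by simp
  show "eta_data 4 {1, 4} (\<lambda>\<delta>. if \<delta> = 1 then 8 else - 8) 1" by simp
  show "eta_data 5 {1, 5} (\<lambda>\<delta>. if \<delta> = 1 then 6 else - 6) 1" by simp
  show "eta_data 6 {1, 2, 3, 6} (\<lambda>\<delta>. if \<delta> = 1 then - 3 else if \<delta> = 2 then 3 else if \<delta> = 3 then 9 else - 9) 3" by simp
  show "eta_data 7 {1, 7} (\<lambda>\<delta>. if \<delta> = 1 then 4 else - 4) 1" by simp
  show "eta_data 8 {1, 2, 4, 8} (\<lambda>\<delta>. if \<delta> = 1 then 4 else if \<delta> = 2 then - 2 else if \<delta> = 4 then 2 else - 4) 1" by simp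
  show "eta_data 9 {1, 9} (\<lambda>\<delta>. if \<delta> = 1 then 3 else - 3) 1" by simp
  show "eta_data 10 {1, 2, 5, 10} (\<lambda>\<delta>. if \<delta> = 1 then - 1 else if \<delta> = 2 then 1 else if \<delta> = 5 then 5 else - 5) 5" by simp
  show "eta_data 12 {2, 4, 6, 12} (\<lambda>\<delta>. if \<delta> = 2 then - 2 else if \<delta> = 4 then 4 else if \<delta> = 6 then 2 else - 4) 4" by simp
  show "eta_data 13 {1, 13} (\<lambda>\<delta>. if \<delta> = 1 then 2 else - 2) 1" by simp
  show "eta_data 25 {1, 25} (\<lambda>\<delta>. if \<delta> = 1 then 1 else - 1) 1" by simp
qed

lemma explicit_hauptmodul_eta_quotient:
  "explicit_hauptmodul 2 = eta_quotient {1, 2} (\<lambda>\<delta>. if \<delta> = 1 then 24 else - 24)"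
  "explicit_hauptmodul 3 = eta_quotient {1, 3} (\<lambda>\<delta>. if \<delta> = 1 then 12 else - 12)"
  "explicit_hauptmodul 4 = eta_quotient {1, 4} (\<lambda>\<delta>. if \<delta> = 1 then 8 else - 8)"
  "explicit_hauptmodul 5 = eta_quotient {1, 5} (\<lambda>\<delta>. if \<delta> = 1 then 6 else - 6)"
  "explicit_hauptmodul 6 = eta_quotient {1, 2, 3, 6} (\<lambda>\<delta>. if \<delta> = 1 then - 3 else if \<delta> = 2 then 3 else if \<delta> = 3 then 9 else - 9)"
  "explicit_hauptmodul 7 = eta_quotient {1, 7} (\<lambda>\<delta>. if \<delta> = 1 then 4 else - 4)"
  "explicit_hauptmodul 8 = eta_quotient {1, 2, 4, 8} (\<lambda>\<delta>. if \<delta> = 1 then 4 else if \<delta> = 2 then - 2 else if \<delta> = 4 then 2 else - 4)"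
  "explicit_hauptmodul 9 = eta_quotient {1, 9} (\<lambda>\<delta>. if \<delta> = 1 then 3 else - 3)"
  "explicit_hauptmodul 10 = eta_quotient {1, 2, 5, 10} (\<lambda>\<delta>. if \<delta> = 1 then - 1 else if \<delta> = 2 then 1 else if \<delta> = 5 then 5 else - 5)"
  "explicit_hauptmodul 12 = eta_quotient {2, 4, 6, 12} (\<lambda>\<delta>. if \<delta> = 2 then - 2 else if \<delta> = 4 then 4 else if \<delta> = 6 then 2 else - 4)"
  "explicit_hauptmodul 13 = eta_quotient {1, 13} (\<lambda>\<delta>. if \<delta> = 1 then 2 else - 2)"
  "explicit_hauptmodul 25 = eta_quotient {1, 25} (\<lambda>\<delta>. if \<delta> = 1 then 1 else - 1)"
  by (simp_all add: fun_eq_iff explicit_hauptmodul_def eta_quotient_def Let_def power_int_minus divide_simps)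

lemma level_j_eq_hauptmodul:
  assumes N: "N \<in> {1, 2, 3, 4, 5, 6, 7, 8, 9, 10, 12, 13, 18, 25}" and j: "is_level_j N j"
    and J: "hauptmodul N J"
  obtains c where "\<And>z. Im z > 0 \<Longrightarrow> j z = J z + c"
proof -
  have "\<exists>c. \<forall>z. Im z > 0 \<longrightarrow> j z = J z + c"
  proof (cases "N = 18")
    case True
    hence hj: "hauptmodul 18 j" using j by (simp add: is_level_j_def)
    show ?thesis
      by (rule hauptmodul_unique[of 18 J j])
         (use J True hauptmodul_holomorphic[OF hj] hauptmodul_invariant[OF hj]
            hauptmodul_regular_at_other_cusps[OF hj] hauptmodul_minus_pole(1)[OF hj] in \<open>auto simp del: moebius_act.simps\<close>)
  next
    case False
    hence jz: "j z = explicit_hauptmodul N z" if "Im z > 0" for z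
      using j that by (simp add: is_level_j_def upper_half_plane_def)
    show ?thesis
    proof (cases "N = 1")
      case True
      obtain c where "\<And>z. Im z > 0 \<Longrightarrow> modular_j z = J z + c" using modular_j_eq_hauptmodul J True by blast
      thus ?thesis using jz True by (intro exI[of _ c]) (simp add: explicit_hauptmodul_def Let_def)
    next
      case N1: False
      obtain D r g0 where data: "eta_data N D r g0" and eq: "explicit_hauptmodul N = eta_quotient D r"
        using N False N1 eta_data_table explicit_hauptmodul_eta_quotient by (elim insertE emptyE) blast+
      obtain c where "\<And>z. Im z > 0 \<Longrightarrow> eta_quotient D r z = J z + c"
        using eta_quotient_eq_hauptmodul[OF data J] by blast
      thus ?thesis using jz eq by auto
    qed
  qed
  thus ?thesis using that by blast
qed

theorem theorem1p1:
  fixes N \<nu> :: nat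
    and J :: "nat \<Rightarrow> complex \<Rightarrow> complex"
    and j :: "complex \<Rightarrow> complex"
    and P :: "nat \<Rightarrow> complex poly"
  assumes "N \<in> {1, 2, 3, 4, 5, 6, 7, 8, 9, 10, 12, 13, 18, 25}"
    and "is_level_j N j"
    and "\<And>M. M dvd N \<Longrightarrow> normalized_hauptmodul M (J M)"
    and "generates_polys (q_expansion j) P"
    and "\<nu> > 0"
  shows "equals_q_series (\<lambda>z. poly (P \<nu>) (j z))
    (\<Sum>d | d dvd gcd \<nu> N.
      of_nat (\<nu> div d) *
        fls_compose_power (hecke_T (N div d) (\<nu> div d) (q_expansion (J (N div d)))) d)"
proof -
  have "N > 0" using assms(1) by auto
  have "hauptmodul N (J N)" using assms(3)[of N] by (simp add: normalized_hauptmodul_def)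
  then obtain c where "\<And>z. Im z > 0 \<Longrightarrow> j z = J N z + c"
    using level_j_eq_hauptmodul[OF assms(1,2)] by blast
  from replication_formula[OF \<open>N > 0\<close> assms(5,3) this assms(4)]
  show ?thesis unfolding replication_series_def .
qed

end
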